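(* Suppose that $T=\sum_{k=M}^N Q_k(z)D^k$, with $Q_k\in\mathbb{R}[z]$ and $Q_MQ_N\not\equiv 0$, is a non-degenerate hyperbolicity preserver with Fuchs index $r=1$, that $n\ge M$ is an integer, and that there is no $\theta\in\mathbb{R}$ with $Q_M(\theta)=\cdots=Q_n(\theta)=0$. Then the zeros of the spectral polynomials $p_n$ and $p_{n+1}$ interlace. Moreover, $p_n$ and $p_{n+1}$ have no zeros in common.
   Context: $D=d/dz$ and $Q_k\equiv 0$ for $k>N$. A nonzero polynomial in $\mathbb{R}[z]$ is hyperbolic if all its zeros are real. A linear operator $T:\mathbb{R}[z]\to\mathbb{R}[z]$ preserves hyperbolicity (is a hyperbolicity preserver) if $T(f)$ is hyperbolic or identically zero whenever $f$ is hyperbolic. The Fuchs index of $T$ is $r=\max_k(\deg Q_k-k)$ (over $k$ with $Q_k\not\equiv0$); $T$ is non-degenerate if $\deg Q_N=N+r$. Under these hypotheses there are exactly $n+1$ polynomials $v$ (Van Vleck polynomials) for which there is a monic polynomial $f$ of degree $n$ with $T(f)=vf$, and each such $v$ has degree one and a real zero. The $n$th spectral polynomial $p_n$ is the monic polynomial (of degree $n+1$) whose zeros are precisely the zeros of these $n+1$ Van Vleck polynomials. The hypothesis for $n$ implies the one for $n+1$, so $p_{n+1}$ is defined likewise. The zeros $\alpha_1\le\cdots\le\alpha_p$ of $f$ and $\beta_1\le\cdots\le\beta_q$ of $g$ interlace if $\alpha_1\le\beta_1\le\alpha_2\le\beta_2\le\cdots$ or $\beta_1\le\alpha_1\le\beta_2\le\alpha_2\le\cdots$.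 *)

theory Defs
  imports Complex_Main "HOL-Computational_Algebra.Computational_Algebra"
begin

definition zeros :: "real poly \<Rightarrow> complex set" where
  "zeros f = {z. poly (map_poly complex_of_real f) z = 0}"

definition hyperbolic :: "real poly \<Rightarrow> bool" where
  "hyperbolic f \<longleftrightarrow> f \<noteq> 0 \<and> zeros f \<subseteq> \<real>"

definition hyperbolicity_preserver :: "(real poly \<Rightarrow> real poly) \<Rightarrow> bool" where
  "hyperbolicity_preserver T \<longleftrightarrow> (\<forall>f. hyperbolic f \<longrightarrow> T f = 0 \<or> hyperbolic (T f))"

definition diff_op :: "nat \<Rightarrow> nat \<Rightarrow> (nat \<Rightarrow> real poly) \<Rightarrow> real poly \<Rightarrow> real poly" where
  "diff_op M N Q f = (\<Sum>k=M..N. Q k * (pderiv ^^ k) f)"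

definition fuchs_index :: "nat \<Rightarrow> nat \<Rightarrow> (nat \<Rightarrow> real poly) \<Rightarrow> int" where
  "fuchs_index M N Q = Max ((\<lambda>k. int (degree (Q k)) - int k) ` {k \<in> {M..N}. Q k \<noteq> 0})"

definition nondegenerate :: "nat \<Rightarrow> nat \<Rightarrow> (nat \<Rightarrow> real poly) \<Rightarrow> bool" where
  "nondegenerate M N Q \<longleftrightarrow> int (degree (Q N)) = int N + fuchs_index M N Q"

definition van_vleck :: "(real poly \<Rightarrow> real poly) \<Rightarrow> nat \<Rightarrow> real poly set" where
  "van_vleck T n = {v. \<exists>f. lead_coeff f = 1 \<and> degree f = n \<and> T f = v * f}"

text \<open>The description is proper when there are exactly \<open>n + 1\<close> Van Vleck polynomials, each of
  degree one: their leading coefficient is the coefficient of \<open>z ^ (n + 1)\<close> in \<open>T (z ^ n)\<close>, so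
  their zeros are pairwise distinct, and a monic polynomial of degree \<open>n + 1\<close> is determined by
  \<open>n + 1\<close> distinct zeros.\<close>

definition spectral_poly :: "(real poly \<Rightarrow> real poly) \<Rightarrow> nat \<Rightarrow> real poly" where
  "spectral_poly T n =
     (THE p. lead_coeff p = 1 \<and> degree p = n + 1 \<and> zeros p = (\<Union>v\<in>van_vleck T n. zeros v))"

definition zero_list :: "real poly \<Rightarrow> real list" where
  "zero_list f = sorted_list_of_multiset (proots f)"

text \<open>\<open>splice [\<alpha>\<^sub>1, \<alpha>\<^sub>2, \<dots>] [\<beta>\<^sub>1, \<beta>\<^sub>2, \<dots>] = [\<alpha>\<^sub>1, \<beta>\<^sub>1, \<alpha>\<^sub>2, \<beta>\<^sub>2, \<dots>]\<close>. The condition on the lengths is needed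
  because \<open>splice\<close> appends what remains of the longer list, whereas the chain of inequalities
  alternates to its end.\<close>

definition alternating :: "real list \<Rightarrow> real list \<Rightarrow> bool" where
  "alternating as bs \<longleftrightarrow>
     (length as = length bs \<or> length as = length bs + 1) \<and> sorted (splice as bs)"

text \<open>Hyperbolicity ensures that \<open>zero_list\<close>, which has the real zeros with multiplicity, has
  all the zeros.\<close>

definition interlace :: "real poly \<Rightarrow> real poly \<Rightarrow> bool" where
  "interlace f g \<longleftrightarrow> hyperbolic f \<and> hyperbolic g \<and>
     (alternating (zero_list f) (zero_list g) \<or> alternating (zero_list g) (zero_list f))"

end

(*
  For f with zero list x of length n, T f has n + 1 real zeros, and by the interlacing theory of
  hyperbolic pencils they depend monotonically on x.  Deleting the j-th of them gives a monotone
  self-map F_j of the zero lists in a large box; its fixed points are the polynomials f with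
  T f = lambda_n (X - theta) f whose theta is the j-th zero of T f (Knaster-Tarski).  A fixed point
  x of F_j satisfies F_(j+1) x <= x, so F_(j+1) has a fixed point below x, and comparing sums of
  zeros gives theta_j < theta_(j+1): all n + 1 eigenvalues are found.  Likewise (x, R) and (-R, x)
  are a super- and a subsolution for F_j and F_(j+1) in degree n + 1, whence the interlacing.

  Strictness rests on the symbol sum_k Q_k(theta) w^k being real-rooted in w: a real-rooted P(D)
  creates no double zeros, so a double zero of T f is one of f unless all Q_k with k <= n vanish there.
*)
theory Submission
  imports Defs "HOL-Analysis.Analysis"
begin

section \<open>Hyperbolic polynomials and the phase of a zero list\<close>

text \<open>The hypothesis on \<open>T\<close> enters in two ways. Applied to pairs that differ in
  one zero, it produces pencils, hence the order properties of \<open>Z\<close>. Applied to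
  \<open>(z - \<zeta>)^k\<close> with \<open>k\<close> tending to infinity, it gives in the limit
  real zeros of the symbol and nonpositive zeros of its leading part. From this, up to one common
  sign, the coefficient of \<open>z^(k+1)\<close> in \<open>Q k\<close> is positive for all
  \<open>M \<le> k \<le> N\<close>. That positivity makes large boxes invariant and
  \<open>lam\<close> strictly increasing; the latter turns the order of two fixed points into the
  order of their eigenvalues through \<open>lam n * (\<theta>' - \<theta>) = (lam n - lam (n - 1)) *
  (sum x - sum y)\<close>. The fixed point theorem yields some fixed point of \<open>F_j\<close>,
  without uniqueness, whereas the comparison of degrees \<open>n\<close> and \<open>n + 1\<close>
  needs that the eigenvalue depends on \<open>j\<close> alone. Counting supplies this:
  \<open>n + 1\<close> distinct values exhaust the eigenvalues by linear independence, each has a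
  single monic eigenvector, and no zero list is fixed for two indices.\<close>

definition cev :: "real poly \<Rightarrow> complex \<Rightarrow> complex" where
  "cev p z = poly (map_poly complex_of_real p) z"

lemma cev_0 [simp]: "cev 0 z = 0"
  by (simp add: cev_def)

lemma cev_pCons [simp]: "cev (pCons a p) z = of_real a + z * cev p z"
  by (simp add: cev_def map_poly_pCons)

lemma cev_add [simp]: "cev (p + q) z = cev p z + cev q z"
  by (induction p q rule: poly_induct2) (auto simp: algebra_simps)

lemma cev_smult [simp]: "cev (smult c p) z = of_real c * cev p z"
  by (induction p) (auto simp: algebra_simps)

lemma cev_minus [simp]: "cev (- p) z = - cev p z"
  by (induction p) (auto simp: algebra_simps)

lemma cev_diff [simp]: "cev (p - q) z = cev p z - cev q z"
  using cev_add[of p "- q" z] by simp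

lemma cev_mult [simp]: "cev (p * q) z = cev p z * cev q z"
  by (induction p) (auto simp: algebra_simps)

lemma cev_sum [simp]: "cev (sum f A) z = (\<Sum>i\<in>A. cev (f i) z)"
  by (induction A rule: infinite_finite_induct) auto

lemma cev_of_real: "cev p (of_real x) = of_real (poly p x)"
  by (induction p) auto

lemma cev_cnj: "cev p (cnj z) = cnj (cev p z)"
  by (induction p) auto

definition root_prod :: "real list \<Rightarrow> real poly" where
  "root_prod xs = (\<Prod>x\<leftarrow>xs. [:- x, 1:])"

lemma root_prod_Nil [simp]: "root_prod [] = 1"
  and root_prod_Cons [simp]: "root_prod (x # xs) = [:- x, 1:] * root_prod xs"
  and root_prod_append [simp]: "root_prod (xs @ ys) = root_prod xs * root_prod ys"
  by (simp_all add: root_prod_def)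

lemma root_prod_nz [simp]: "root_prod xs \<noteq> 0"
  by (induction xs) (simp_all del: mult_pCons_left)

lemma degree_root_prod [simp]: "degree (root_prod xs) = length xs"
  by (induction xs) (simp_all add: degree_mult_eq del: mult_pCons_left)

lemma lead_coeff_root_prod [simp]: "lead_coeff (root_prod xs) = 1"
  by (induction xs) (simp_all add: lead_coeff_mult del: mult_pCons_left)

lemma coeff_root_prod_length [simp]: "coeff (root_prod xs) (length xs) = 1"
  using lead_coeff_root_prod[of xs] by simp

lemma proots_root_prod [simp]: "proots (root_prod xs) = mset xs"
  by (induction xs) (simp_all add: proots_mult del: mult_pCons_left)

lemma poly_root_prod_0_iff: "poly (root_prod xs) x = 0 \<longleftrightarrow> x \<in> set xs"
  by (induction xs) auto

lemma root_prod_cong: "mset xs = mset ys \<Longrightarrow> root_prod xs = root_prod ys"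
  unfolding root_prod_def by (metis mset_map prod_mset_prod_list)

lemma coeff_root_prod_subleading:
  assumes "xs \<noteq> []"
  shows "coeff (root_prod xs) (length xs - 1) = - sum_list xs"
  using assms
proof (induction xs)
  case (Cons x xs)
  show ?case
  proof (cases "xs = []")
    case False
    then obtain k where k: "length xs = Suc k"
      by (cases xs) auto
    have "coeff (root_prod xs) k = - sum_list xs"
      using Cons.IH[OF False] k by simp
    then show ?thesis
      using k coeff_root_prod_length[of xs] by (simp del: coeff_root_prod_length)
  qed simp
qed simp

lemma cev_root_prod_upper:
  assumes "Im z > 0"
  shows "cev (root_prod xs) z \<noteq> 0"
proof (induction xs)
  case (Cons x xs)
  moreover have "z \<noteq> of_real x"
    using assms by auto
  ultimately show ?case
    by (simp del: mult_pCons_left)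
qed (simp add: one_pCons)

lemma hyperbolic_splits:
  assumes "p \<noteq> 0" "\<And>z. Im z > 0 \<Longrightarrow> cev p z \<noteq> 0"
  shows "\<exists>xs. p = smult (lead_coeff p) (root_prod xs)"
  using assms
proof (induction "degree p" arbitrary: p)
  case 0
  then obtain c where "p = [:c:]"
    by (metis degree_eq_zeroE)
  then show ?case
    by (intro exI[of _ "[]"]) (simp add: one_pCons)
next
  case (Suc d)
  have "\<not> constant (poly (map_poly complex_of_real p))"
    using Suc(2) by (simp add: constant_degree degree_map_poly)
  then obtain z where z: "cev p z = 0"
    using fundamental_theorem_of_algebra unfolding cev_def by blast
  have "Im z \<le> 0" "Im (cnj z) \<le> 0"
    using Suc(4)[of z] Suc(4)[of "cnj z"] z by (force simp: cev_cnj)+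
  then have "z = of_real (Re z)"
    by (simp add: complex_eq_iff)
  then have "poly p (Re z) = 0"
    using z by (metis cev_of_real of_real_eq_0_iff)
  then obtain q where q: "p = [:- Re z, 1:] * q"
    by (auto simp: poly_eq_0_iff_dvd dvd_def)
  have q0: "q \<noteq> 0"
    using q Suc(3) by auto
  have "degree p = Suc (degree q)"
    unfolding q using q0 by (simp add: degree_mult_eq del: mult_pCons_left)
  moreover have "cev q w \<noteq> 0" if "Im w > 0" for w
    using Suc(4)[OF that] unfolding q by (auto simp del: mult_pCons_left)
  ultimately obtain xs where "q = smult (lead_coeff q) (root_prod xs)"
    using Suc(1)[of q] Suc(2) q0 by auto
  moreover have "lead_coeff p = lead_coeff q"
    unfolding q by (simp add: lead_coeff_mult del: mult_pCons_left)
  ultimately have "p = smult (lead_coeff p) (root_prod (Re z # xs))"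
    using q by (metis mult_smult_right root_prod_Cons)
  then show ?case ..
qed

text \<open>Real coefficients make the zeros symmetric under conjugation, so the upper half plane
  decides. Later hyperbolicity checks use this form.\<close>

lemma hyperbolic_iff_upper: "hyperbolic p \<longleftrightarrow> p \<noteq> 0 \<and> (\<forall>z. Im z > 0 \<longrightarrow> cev p z \<noteq> 0)"
proof
  assume "hyperbolic p"
  then show "p \<noteq> 0 \<and> (\<forall>z. Im z > 0 \<longrightarrow> cev p z \<noteq> 0)"
    unfolding hyperbolic_def zeros_def cev_def by (auto simp: complex_is_Real_iff)
next
  assume *: "p \<noteq> 0 \<and> (\<forall>z. Im z > 0 \<longrightarrow> cev p z \<noteq> 0)"
  have "Im z = 0" if "cev p z = 0" for z
  proof -
    have "cev p (cnj z) = 0"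
      using that by (simp add: cev_cnj)
    then show ?thesis
      using * that by (cases "Im z < 0") (auto simp: not_less order.order_iff_strict)
  qed
  then show "hyperbolic p"
    using * unfolding hyperbolic_def zeros_def cev_def by (auto simp: complex_is_Real_iff)
qed

lemma hyperbolic_eq_root_prod:
  assumes "hyperbolic p"
  shows "p = smult (lead_coeff p) (root_prod (zero_list p))"
proof -
  obtain xs where xs: "p = smult (lead_coeff p) (root_prod xs)"
    using hyperbolic_splits assms hyperbolic_iff_upper by blast
  have "p \<noteq> 0"
    using assms by (simp add: hyperbolic_def)
  then have "proots p = mset xs"
    by (subst xs) simp
  then have "mset (zero_list p) = mset xs"
    by (simp add: zero_list_def)
  then show ?thesis
    using xs root_prod_cong by metis
qed

lemma hyperbolic_root_prod [simp]: "hyperbolic (root_prod xs)"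
  by (simp add: hyperbolic_iff_upper cev_root_prod_upper)

lemma hyperbolic_smult [simp]: "hyperbolic (smult c p) \<longleftrightarrow> c \<noteq> 0 \<and> hyperbolic p"
  by (auto simp: hyperbolic_iff_upper)

lemma hyperbolic_mult [simp]: "hyperbolic (p * q) \<longleftrightarrow> hyperbolic p \<and> hyperbolic q"
  by (auto simp: hyperbolic_iff_upper)

lemma hyperbolic_power: "hyperbolic p \<Longrightarrow> hyperbolic (p ^ k)"
  by (induction k) (auto simp: hyperbolic_iff_upper one_pCons)

lemma hyperbolic_linear [simp]: "hyperbolic [:a, b:] \<longleftrightarrow> a \<noteq> 0 \<or> b \<noteq> 0"
  by (auto simp: hyperbolic_iff_upper complex_eq_iff)

lemma length_zero_list:
  assumes "hyperbolic p"
  shows "length (zero_list p) = degree p"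
proof -
  have "degree p = degree (smult (lead_coeff p) (root_prod (zero_list p)))"
    using hyperbolic_eq_root_prod[OF assms] by simp
  also have "\<dots> = length (zero_list p)"
    using assms by (simp add: hyperbolic_def)
  finally show ?thesis ..
qed

lemma sorted_zero_list [simp]: "sorted (zero_list p)"
  by (simp add: zero_list_def)

lemma set_zero_list: "p \<noteq> 0 \<Longrightarrow> set (zero_list p) = {x. poly p x = 0}"
  by (simp add: zero_list_def)

lemma zero_list_root_prod [simp]: "zero_list (root_prod xs) = sort xs"
  by (simp add: zero_list_def)

text \<open>An argument of \<open>z - r\<close>, continuous on the upper half plane and tending to
  \<open>0\<close> or \<open>\<pi>\<close> at the real points to the right or to the left of \<open>r\<close>.\<close>

definition phase1 :: "real \<Rightarrow> complex \<Rightarrow> real" where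
  "phase1 r z = pi / 2 - arctan ((Re z - r) / Im z)"

definition phase :: "real list \<Rightarrow> complex \<Rightarrow> real" where
  "phase xs z = (\<Sum>r\<leftarrow>xs. phase1 r z)"

definition count_gt :: "real list \<Rightarrow> real \<Rightarrow> nat" where
  "count_gt xs x = length (filter (\<lambda>r. x < r) xs)"

lemma phase_simps [simp]: "phase [] z = 0" "phase (x # xs) z = phase1 x z + phase xs z"
  by (simp_all add: phase_def)

lemma count_gt_simps [simp]:
  "count_gt [] x = 0" "count_gt (r # rs) x = (if x < r then 1 else 0) + count_gt rs x"
  by (simp_all add: count_gt_def)

lemma phase1_polar:
  assumes "Im z > 0"
  shows "z - of_real r = of_real (cmod (z - of_real r)) * cis (phase1 r z)"
proof -
  define t where "t = (Re z - r) / Im z"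
  have m: "cmod (z - of_real r) = Im z * sqrt (1 + t\<^sup>2)"
  proof -
    have "(Re z - r)\<^sup>2 + (Im z)\<^sup>2 = (Im z)\<^sup>2 * (1 + t\<^sup>2)"
      using assms by (simp add: t_def field_simps)
    then show ?thesis
      using assms by (simp add: cmod_def real_sqrt_mult)
  qed
  have s: "sqrt (1 + t\<^sup>2) > 0"
    by (simp add: add_pos_nonneg)
  show ?thesis
    unfolding m phase1_def t_def[symmetric]
    using assms s
    by (simp add: complex_eq_iff cos_diff sin_diff cos_arctan sin_arctan)
       (simp add: t_def)
qed

lemma cev_root_prod_polar:
  assumes "Im z > 0"
  shows "\<exists>\<rho>>0. cev (root_prod xs) z = of_real \<rho> * cis (phase xs z)"
proof (induction xs)
  case Nil
  show ?case
    by (auto simp: one_pCons)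
next
  case (Cons x xs)
  then obtain \<rho> where \<rho>: "\<rho> > 0" "cev (root_prod xs) z = of_real \<rho> * cis (phase xs z)"
    by auto
  have "cmod (z - of_real x) > 0"
    using assms by auto
  moreover have "cev (root_prod (x # xs)) z
      = of_real (cmod (z - of_real x) * \<rho>) * cis (phase (x # xs) z)"
  proof -
    have "cev (root_prod (x # xs)) z = (z - of_real x) * cev (root_prod xs) z"
      by (simp del: mult_pCons_left)
    also have "\<dots> = (of_real (cmod (z - of_real x)) * cis (phase1 x z)) * (of_real \<rho> * cis (phase xs z))"
      using phase1_polar[OF assms, of x] \<rho>(2) by metis
    finally show ?thesis
      by (simp add: cis_mult[symmetric] mult_ac)
  qed
  ultimately show ?case
    using \<rho>(1) by (intro exI[of _ "cmod (z - of_real x) * \<rho>"]) auto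
qed

lemma continuous_phase: "continuous_on {z. Im z > 0} (phase xs)"
proof (induction xs)
  case (Cons x xs)
  have "continuous_on {z. Im z > 0} (phase1 x)"
    unfolding phase1_def by (intro continuous_intros) auto
  with Cons show ?case
    by (simp add: continuous_on_add)
qed simp

lemma phase1_tendsto:
  assumes "x \<noteq> r"
  shows "((\<lambda>y. phase1 r (Complex x y)) \<longlongrightarrow> (if x < r then pi else 0)) (at_right 0)"
proof (cases "x < r")
  case True
  have "filterlim (\<lambda>y::real. (x - r) * inverse y) at_bot (at_right 0)"
    using True by (intro filterlim_tendsto_neg_mult_at_bot[OF tendsto_const _ filterlim_inverse_at_top_right]) auto
  then have "((\<lambda>y. arctan ((x - r) * inverse y)) \<longlongrightarrow> - (pi / 2)) (at_right 0)"
    by (rule filterlim_compose[OF tendsto_arctan_at_bot])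
  then have "((\<lambda>y. pi / 2 - arctan ((x - r) * inverse y)) \<longlongrightarrow> pi / 2 - (- (pi / 2))) (at_right 0)"
    by (intro tendsto_intros)
  moreover have "phase1 r (Complex x y) = pi / 2 - arctan ((x - r) * inverse y)" for y
    by (simp add: phase1_def divide_inverse[of "x - r" y, symmetric])
  ultimately show ?thesis
    using True by simp
next
  case False
  then have "x - r > 0"
    using assms by simp
  then have "filterlim (\<lambda>y::real. (x - r) * inverse y) at_top (at_right 0)"
    by (intro filterlim_tendsto_pos_mult_at_top[OF tendsto_const _ filterlim_inverse_at_top_right]) auto
  then have "((\<lambda>y. arctan ((x - r) * inverse y)) \<longlongrightarrow> pi / 2) (at_right 0)"
    by (rule filterlim_compose[OF tendsto_arctan_at_top])
  then have "((\<lambda>y. pi / 2 - arctan ((x - r) * inverse y)) \<longlongrightarrow> pi / 2 - pi / 2) (at_right 0)"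
    by (intro tendsto_intros)
  moreover have "phase1 r (Complex x y) = pi / 2 - arctan ((x - r) * inverse y)" for y
    by (simp add: phase1_def divide_inverse[of "x - r" y, symmetric])
  ultimately show ?thesis
    using False by simp
qed

text \<open>Each zero to the right of \<open>x\<close> contributes \<open>pi\<close> and each zero
  to the left nothing. Boundary values of phases thus turn into counts of zeros.\<close>

lemma phase_tendsto:
  assumes "x \<notin> set xs"
  shows "((\<lambda>y. phase xs (Complex x y)) \<longlongrightarrow> pi * count_gt xs x) (at_right 0)"
  using assms
proof (induction xs)
  case (Cons r rs)
  have "((\<lambda>y. phase1 r (Complex x y) + phase rs (Complex x y))
      \<longlongrightarrow> (if x < r then pi else 0) + pi * count_gt rs x) (at_right 0)"
    using Cons by (intro tendsto_add phase1_tendsto) auto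
  moreover have "(if x < r then pi else 0) + pi * count_gt rs x = pi * count_gt (r # rs) x"
    by (simp add: algebra_simps)
  ultimately show ?case
    by simp
qed simp

text \<open>Right continuity of the counting function: a bound proved off the zeros extends to the
  zeros themselves.\<close>

lemma count_gt_right:
  "\<exists>e>0. \<forall>y. x < y \<and> y < x + e \<longrightarrow> y \<notin> set xs \<and> count_gt xs y = count_gt xs x"
proof (induction xs)
  case Nil
  show ?case
    by (auto intro: exI[of _ 1])
next
  case (Cons r rs)
  then obtain e where e: "e > 0"
    "\<And>y. x < y \<and> y < x + e \<Longrightarrow> y \<notin> set rs \<and> count_gt rs y = count_gt rs x"
    by blast
  show ?case
  proof (cases "x < r")
    case True
    have "y \<notin> set (r # rs) \<and> count_gt (r # rs) y = count_gt (r # rs) x"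
      if "x < y \<and> y < x + min e (r - x)" for y
      using e(2)[of y] that True by (auto simp: min_def split: if_splits)
    then show ?thesis
      using e(1) True by (intro exI[of _ "min e (r - x)"]) auto
  next
    case False
    have "y \<notin> set (r # rs) \<and> count_gt (r # rs) y = count_gt (r # rs) x"
      if "x < y \<and> y < x + e" for y
      using e(2)[of y] that False by auto
    then show ?thesis
      using e(1) by blast
  qed
qed

text \<open>The jump at \<open>x\<close> is the multiplicity of \<open>x\<close>, so bounds on
  counts become bounds on multiplicities.\<close>

lemma count_gt_left:
  "\<exists>e>0. \<forall>y. x - e < y \<and> y < x \<longrightarrow> y \<notin> set xs \<and> count_gt xs y = count_gt xs x + count_list xs x"
proof (induction xs)
  case Nil
  show ?case
    by (auto intro: exI[of _ 1])
next
  case (Cons r rs)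
  then obtain e where e: "e > 0"
    "\<And>y. x - e < y \<and> y < x \<Longrightarrow> y \<notin> set rs \<and> count_gt rs y = count_gt rs x + count_list rs x"
    by blast
  show ?case
  proof (cases "r < x")
    case True
    have "y \<notin> set (r # rs) \<and> count_gt (r # rs) y = count_gt (r # rs) x + count_list (r # rs) x"
      if "x - min e (x - r) < y \<and> y < x" for y
      using e(2)[of y] that True by (auto simp: min_def split: if_splits)
    then show ?thesis
      using e(1) True by (intro exI[of _ "min e (x - r)"]) auto
  next
    case False
    have "y \<notin> set (r # rs) \<and> count_gt (r # rs) y = count_gt (r # rs) x + count_list (r # rs) x"
      if "x - e < y \<and> y < x" for y
      using e(2)[of y] that False by auto
    then show ?thesis
      using e(1) by blast
  qed
qed

lemma count_gt_below:
  assumes "\<forall>r\<in>set xs. x < r"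
  shows "count_gt xs x = length xs"
  using assms by (induction xs) auto

lemma count_gt_above:
  assumes "\<forall>r\<in>set xs. r \<le> x"
  shows "count_gt xs x = 0"
  using assms by (induction xs) auto

text \<open>The continuous function \<open>phase xs - phase ys\<close> avoids the multiples of \<open>\<pi>\<close>, so it is
  trapped between two neighbouring ones; this is what forces the zeros to interlace.\<close>

lemma phase_trapped:
  assumes "\<And>z. Im z > 0 \<Longrightarrow> Im (cev (root_prod xs) z * cnj (cev (root_prod ys) z)) \<noteq> 0"
  obtains m :: int where "m = -1 \<or> m = 0"
    "\<And>x. int (count_gt xs x) - int (count_gt ys x) \<in> {m, m + 1}"
    "\<And>z. Im z > 0 \<Longrightarrow> phase xs z - phase ys z \<in> {pi * m<..<pi * (m + 1)}"
proof -
  define H where "H = {z. Im z > 0}"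
  define g where "g z = phase xs z - phase ys z" for z
  have sin_g: "sin (g z) \<noteq> 0" if "z \<in> H" for z
  proof
    assume *: "sin (g z) = 0"
    have z: "Im z > 0"
      using that by (simp add: H_def)
    obtain a b where "cev (root_prod xs) z = of_real a * cis (phase xs z)"
      "cev (root_prod ys) z = of_real b * cis (phase ys z)"
      using cev_root_prod_polar[OF z] by blast
    then have "cev (root_prod xs) z * cnj (cev (root_prod ys) z) = of_real (a * b) * cis (g z)"
      by (simp add: cis_cnj g_def cis_mult algebra_simps flip: cis_inverse) (simp add: cis_mult)
    then show False
      using assms[OF z] * by simp
  qed
  have cont: "continuous_on H g"
    unfolding g_def H_def by (intro continuous_intros continuous_phase)
  have "connected H"
    unfolding H_def using convex_halfspace_Im_gt convex_connected by blast
  then have conn: "connected (g ` H)"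
    using cont connected_continuous_image by blast
  have iH: "\<i> \<in> H"
    by (simp add: H_def)
  define m where "m = \<lfloor>g \<i> / pi\<rfloor>"
  have npi: "pi * of_int k \<notin> g ` H" for k :: int
  proof
    assume "pi * of_int k \<in> g ` H"
    then obtain z where "z \<in> H" "g z = pi * of_int k"
      by auto
    then show False
      using sin_g[of z] sin_npi_int[of k] by (simp add: mult.commute)
  qed
  have mi: "pi * m \<le> g \<i>" "g \<i> < pi * (m + 1)"
    using floor_correct[of "g \<i> / pi"] unfolding m_def[symmetric] by (simp_all add: field_simps)
  have trap: "g z \<in> {pi * m<..<pi * (m + 1)}" if "z \<in> H" for z
  proof (rule ccontr)
    assume "\<not> ?thesis"
    then consider "g z \<le> pi * m" | "g z \<ge> pi * (m + 1)"
      by force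
    then show False
    proof cases
      case 1
      then have "pi * m \<in> g ` H"
        using connectedD_interval[OF conn, of "g z" "g \<i>" "pi * m"] mi that iH by auto
      then show False
        using npi by blast
    next
      case 2
      then have "pi * (m + 1) \<in> g ` H"
        using connectedD_interval[OF conn, of "g \<i>" "g z" "pi * (m + 1)"] mi that iH by auto
      then show False
        using npi[of "m + 1"] by simp
    qed
  qed
  have count0: "int (count_gt xs x) - int (count_gt ys x) \<in> {m, m + 1}"
    if "x \<notin> set xs" "x \<notin> set ys" for x
  proof -
    have lim: "((\<lambda>y. g (Complex x y)) \<longlongrightarrow> pi * count_gt xs x - pi * count_gt ys x) (at_right 0)"
      unfolding g_def by (intro tendsto_diff phase_tendsto that)
    have ev: "\<forall>\<^sub>F y in at_right 0. pi * m \<le> g (Complex x y) \<and> g (Complex x y) \<le> pi * (m + 1)"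
      using trap by (auto simp: eventually_at_right_field H_def less_imp_le intro!: exI[of _ 1])
    have "pi * m \<le> pi * count_gt xs x - pi * count_gt ys x"
      by (rule tendsto_lowerbound[OF lim]) (use ev in \<open>auto elim: eventually_mono\<close>)
    moreover have "pi * count_gt xs x - pi * count_gt ys x \<le> pi * (m + 1)"
      by (rule tendsto_upperbound[OF lim]) (use ev in \<open>auto elim: eventually_mono\<close>)
    ultimately have "real_of_int m \<le> real (count_gt xs x) - real (count_gt ys x)"
      "real (count_gt xs x) - real (count_gt ys x) \<le> real_of_int (m + 1)"
      by (simp_all flip: right_diff_distrib)
    then have "m \<le> int (count_gt xs x) - int (count_gt ys x)"
      "int (count_gt xs x) - int (count_gt ys x) \<le> m + 1"
      by linarith+
    then show ?thesis
      by force
  qed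
  \<comment> \<open>The boundary limit exists only off the zeros; a point slightly to the right has
    the same counts.\<close>
  have count: "int (count_gt xs x) - int (count_gt ys x) \<in> {m, m + 1}" for x
  proof -
    obtain e d where "e > 0" "\<And>y. x < y \<and> y < x + e \<Longrightarrow> y \<notin> set xs \<and> count_gt xs y = count_gt xs x"
      and "d > 0" "\<And>y. x < y \<and> y < x + d \<Longrightarrow> y \<notin> set ys \<and> count_gt ys y = count_gt ys x"
      using count_gt_right[of x xs] count_gt_right[of x ys] by blast
    then show ?thesis
      using count0[of "x + min e d / 2"] by auto
  qed
  \<comment> \<open>To the right of all zeros both counts are 0, which leaves only
    \<open>m = -1\<close> and \<open>m = 0\<close>.\<close>
  obtain b where "\<forall>r\<in>set (xs @ ys). r \<le> b"
    using finite_set bdd_above_finite unfolding bdd_above_def by metis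
  then have "0 \<in> {m, m + 1}"
    using count[of b] by (simp add: count_gt_above)
  then have "m = -1 \<or> m = 0"
    by auto
  then show thesis
    using that[of m] count trap unfolding H_def g_def by blast
qed

section \<open>Pencils of hyperbolic polynomials\<close>

text \<open>Dictionary between counts and positions: inequalities of counting functions become
  entrywise inequalities of sorted lists.\<close>

lemma less_nth_iff_count_gt:
  assumes "sorted xs" "i < length xs"
  shows "x < xs ! i \<longleftrightarrow> length xs - i \<le> count_gt xs x"
  using assms
proof (induction xs arbitrary: i)
  case (Cons r rs)
  have le: "count_gt rs x \<le> length rs"
    by (simp add: count_gt_def)
  have full: "x < r \<Longrightarrow> count_gt rs x = length rs"
    using Cons.prems(1) by (intro count_gt_below) auto
  show ?case
  proof (cases i)
    case 0
    then show ?thesis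
      using le full by auto
  next
    case (Suc j)
    then have IH: "x < rs ! j \<longleftrightarrow> length rs - j \<le> count_gt rs x"
      using Cons by auto
    show ?thesis
      using Suc IH full Cons.prems by auto
  qed
qed simp

lemma list_all2_le_if_count_gt_le:
  assumes "sorted xs" "sorted ys" "length xs = length ys"
    "\<And>x. count_gt xs x \<le> count_gt ys x"
  shows "list_all2 (\<le>) xs ys"
proof (rule list_all2_all_nthI[OF assms(3)])
  fix i assume i: "i < length xs"
  have "length xs - i \<le> count_gt ys x" if "x < xs ! i" for x
    using that less_nth_iff_count_gt[OF assms(1) i, of x] assms(4)[of x] by simp
  then have "x < ys ! i" if "x < xs ! i" for x
    using that less_nth_iff_count_gt[OF assms(2), of i] i assms(3) by simp
  then show "xs ! i \<le> ys ! i"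
    using linorder_not_le by blast
qed

lemma sum_list_mono_list_all2:
  fixes xs ys :: "real list"
  assumes "list_all2 (\<le>) xs ys"
  shows "sum_list xs \<le> sum_list ys"
  using assms by (induction rule: list_all2_induct) auto

lemma list_all2_le_sum_list_eq:
  fixes xs ys :: "real list"
  assumes "list_all2 (\<le>) xs ys" "sum_list ys \<le> sum_list xs"
  shows "xs = ys"
  using assms
proof (induction rule: list_all2_induct)
  case (Cons x xs y ys)
  then show ?case
    using sum_list_mono_list_all2[of xs ys] by auto
qed simp

lemma order_eq_count_zero_list:
  assumes "p \<noteq> 0"
  shows "order x p = count_list (zero_list p) x"
proof -
  have "count_list (zero_list p) x = count (mset (zero_list p)) x"
    by (rule count_mset[symmetric])
  then show ?thesis
    using assms by (simp add: zero_list_def)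
qed

text \<open>The condition in the Hermite-Kakeya-Obreschkoff theorem. Since 0 is not
  \<open>hyperbolic\<close>, it includes linear independence of \<open>p\<close> and
  \<open>q\<close>.\<close>

definition hyperbolic_pencil :: "real poly \<Rightarrow> real poly \<Rightarrow> bool" where
  "hyperbolic_pencil p q \<longleftrightarrow> (\<forall>a b. a \<noteq> 0 \<or> b \<noteq> 0 \<longrightarrow> hyperbolic (smult a p + smult b q))"

lemma hyperbolic_pencil_left: "hyperbolic_pencil p q \<Longrightarrow> hyperbolic p"
  unfolding hyperbolic_pencil_def by (metis add.right_neutral smult_0_left smult_1_left zero_neq_one)

lemma hyperbolic_pencil_right: "hyperbolic_pencil p q \<Longrightarrow> hyperbolic q"
  unfolding hyperbolic_pencil_def by (metis add.left_neutral smult_0_left smult_1_left zero_neq_one)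

text \<open>If the quotient \<open>p / q\<close> took a real value \<open>t\<close> at
  \<open>z\<close>, the member \<open>p - t q\<close> of the pencil would vanish at a nonreal
  point.\<close>

lemma hyperbolic_pencil_Im:
  assumes "hyperbolic_pencil p q" "Im z > 0"
  shows "Im (cev p z * cnj (cev q z)) \<noteq> 0"
proof
  assume *: "Im (cev p z * cnj (cev q z)) = 0"
  have q: "cev q z \<noteq> 0"
    using hyperbolic_pencil_right[OF assms(1)] assms(2) hyperbolic_iff_upper by blast
  define t where "t = Re (cev p z * cnj (cev q z)) / (cmod (cev q z))\<^sup>2"
  have "of_real t * (cev q z * cnj (cev q z)) = cev p z * cnj (cev q z)"
    using q * by (simp add: t_def complex_mult_cnj complex_eq_iff cmod_power2 cmod_def)
  then have "cev p z = of_real t * cev q z"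
    using q by (simp flip: mult.assoc)
  then have "cev (smult 1 p + smult (- t) q) z = 0"
    by simp
  moreover have "hyperbolic (smult 1 p + smult (- t) q)"
    using assms(1) unfolding hyperbolic_pencil_def by (metis zero_neq_one)
  ultimately show False
    using assms(2) hyperbolic_iff_upper by blast
qed

lemma cev_zero_list:
  "hyperbolic p \<Longrightarrow> cev p z = of_real (lead_coeff p) * cev (root_prod (zero_list p)) z"
  by (subst hyperbolic_eq_root_prod[of p]) (auto simp del: mult_pCons_left)

lemma hyperbolic_pencil_trapped:
  assumes "hyperbolic_pencil p q"
  obtains m :: int where "m = -1 \<or> m = 0"
    "\<And>x. int (count_gt (zero_list p) x) - int (count_gt (zero_list q) x) \<in> {m, m + 1}"
    "\<And>z. Im z > 0 \<Longrightarrow>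
      phase (zero_list p) z - phase (zero_list q) z \<in> {pi * m<..<pi * (m + 1)}"
proof (rule phase_trapped)
  fix z assume z: "Im z > 0"
  note hp = hyperbolic_pencil_left[OF assms] and hq = hyperbolic_pencil_right[OF assms]
  have "Im (cev p z * cnj (cev q z)) = lead_coeff p * lead_coeff q *
      Im (cev (root_prod (zero_list p)) z * cnj (cev (root_prod (zero_list q)) z))"
    unfolding cev_zero_list[OF hp, of z] cev_zero_list[OF hq, of z] by (simp add: algebra_simps)
  then show "Im (cev (root_prod (zero_list p)) z * cnj (cev (root_prod (zero_list q)) z)) \<noteq> 0"
    using hyperbolic_pencil_Im[OF assms z] by auto
qed (use that in blast)

lemma ex_below_lists: "\<exists>x. (\<forall>r\<in>set xs. x < r) \<and> (\<forall>r\<in>set ys. x < (r::real))"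
proof -
  have "bdd_below (set xs \<union> set ys)"
    by (intro bdd_below_finite) auto
  then obtain b where "\<forall>r\<in>set xs \<union> set ys. b \<le> r"
    unfolding bdd_below_def by blast
  then show ?thesis
    by (intro exI[of _ "b - 1"]) force
qed

text \<open>To the left of all zeros the counts are the degrees, and their difference is at most
  \<open>m + 1 \<le> 1\<close>.\<close>

lemma hyperbolic_pencil_degree:
  assumes "hyperbolic_pencil p q"
  shows "degree p \<le> degree q + 1"
proof -
  obtain m :: int where m: "m = -1 \<or> m = 0"
    "\<And>x. int (count_gt (zero_list p) x) - int (count_gt (zero_list q) x) \<in> {m, m + 1}"
    "\<And>z. Im z > 0 \<Longrightarrow>
      phase (zero_list p) z - phase (zero_list q) z \<in> {pi * m<..<pi * (m + 1)}"
    by (rule hyperbolic_pencil_trapped[OF assms]) (rule that; assumption)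
  obtain x where "\<forall>r\<in>set (zero_list p). x < r" "\<forall>r\<in>set (zero_list q). x < r"
    using ex_below_lists by blast
  then have "int (degree p) - int (degree q) \<in> {m, m + 1}"
    using m(2)[of x] assms
    by (simp add: count_gt_below length_zero_list hyperbolic_pencil_left hyperbolic_pencil_right)
  then show ?thesis
    using m(1) by auto
qed

text \<open>A degree difference of 1 forces \<open>m = 0\<close>. The phase difference then lies
  strictly between 0 and \<open>pi\<close>, where the sine is positive.\<close>

lemma hyperbolic_pencil_Suc_degree:
  assumes "hyperbolic_pencil p q" "degree p = degree q + 1"
  shows "count_gt (zero_list q) x \<le> count_gt (zero_list p) x"
    and "count_gt (zero_list p) x \<le> count_gt (zero_list q) x + 1"
    and "Im z > 0 \<Longrightarrow> lead_coeff p * lead_coeff q > 0 \<Longrightarrow> Im (cev p z * cnj (cev q z)) > 0"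
proof -
  note hp = hyperbolic_pencil_left[OF assms(1)] and hq = hyperbolic_pencil_right[OF assms(1)]
  obtain m :: int where m: "m = -1 \<or> m = 0"
    "\<And>x. int (count_gt (zero_list p) x) - int (count_gt (zero_list q) x) \<in> {m, m + 1}"
    "\<And>z. Im z > 0 \<Longrightarrow>
      phase (zero_list p) z - phase (zero_list q) z \<in> {pi * m<..<pi * (m + 1)}"
    by (rule hyperbolic_pencil_trapped[OF assms(1)]) (rule that; assumption)
  obtain y where "\<forall>r\<in>set (zero_list p). y < r" "\<forall>r\<in>set (zero_list q). y < r"
    using ex_below_lists by blast
  then have "1 \<in> {m, m + 1}"
    using m(2)[of y] assms(2) by (simp add: count_gt_below length_zero_list hp hq)
  then have m0: "m = 0"
    using m(1) by auto
  show "count_gt (zero_list q) x \<le> count_gt (zero_list p) x"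
    "count_gt (zero_list p) x \<le> count_gt (zero_list q) x + 1"
    using m(2)[of x] m0 by auto
  show "Im (cev p z * cnj (cev q z)) > 0" if z: "Im z > 0" and l: "lead_coeff p * lead_coeff q > 0"
  proof -
    obtain a b where ab: "a > 0" "b > 0"
      "cev (root_prod (zero_list p)) z = of_real a * cis (phase (zero_list p) z)"
      "cev (root_prod (zero_list q)) z = of_real b * cis (phase (zero_list q) z)"
      using cev_root_prod_polar[OF z] by metis
    have "cev p z * cnj (cev q z) = of_real (lead_coeff p * lead_coeff q * a * b) *
        cis (phase (zero_list p) z - phase (zero_list q) z)"
      unfolding cev_zero_list[OF hp, of z] cev_zero_list[OF hq, of z] ab
      by (simp add: cis_cnj algebra_simps flip: cis_inverse) (simp add: cis_mult)
    moreover have "sin (phase (zero_list p) z - phase (zero_list q) z) > 0"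
      using m(3)[OF z] m0 by (intro sin_gt_zero) auto
    ultimately show ?thesis
      using ab l by simp
  qed
qed

text \<open>The count differences at \<open>x\<close> and just left of \<open>x\<close> both lie in
  \<open>{m, m + 1}\<close>, so the two jumps, which are the orders at \<open>x\<close>, differ by
  at most 1.\<close>

lemma hyperbolic_pencil_power_dvd:
  assumes "hyperbolic_pencil p q" "[:- x, 1:] ^ Suc k dvd p"
  shows "[:- x, 1:] ^ k dvd q"
proof -
  note hp = hyperbolic_pencil_left[OF assms(1)] and hq = hyperbolic_pencil_right[OF assms(1)]
  have nz: "p \<noteq> 0" "q \<noteq> 0"
    using hp hq by (auto simp: hyperbolic_def)
  obtain m :: int where m: "m = -1 \<or> m = 0"
    "\<And>x. int (count_gt (zero_list p) x) - int (count_gt (zero_list q) x) \<in> {m, m + 1}"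
    "\<And>z. Im z > 0 \<Longrightarrow>
      phase (zero_list p) z - phase (zero_list q) z \<in> {pi * m<..<pi * (m + 1)}"
    by (rule hyperbolic_pencil_trapped[OF assms(1)]) (rule that; assumption)
  obtain d e where d: "d > 0" "\<And>y. x - d < y \<and> y < x \<Longrightarrow> count_gt (zero_list p) y
      = count_gt (zero_list p) x + count_list (zero_list p) x"
    and e: "e > 0" "\<And>y. x - e < y \<and> y < x \<Longrightarrow> count_gt (zero_list q) y
      = count_gt (zero_list q) x + count_list (zero_list q) x"
    using count_gt_left[of x "zero_list p"] count_gt_left[of x "zero_list q"] by blast
  define y where "y = x - min d e / 2"
  have "x - d < y \<and> y < x" "x - e < y \<and> y < x"
    using d(1) e(1) by (auto simp: y_def min_def)
  then have "order x p \<le> order x q + 1"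
    using m(2)[of x] m(2)[of y] d(2) e(2) nz by (auto simp: order_eq_count_zero_list)
  moreover have "Suc k \<le> order x p"
    using assms(2) nz(1) unfolding order_divides by simp
  ultimately have "k \<le> order x q"
    by simp
  then show ?thesis
    unfolding order_divides by simp
qed

text \<open>The sign of \<open>m\<close> decides which list lies above the other in every entry. The
  sums pick the direction: in the wrong case they force the lists to coincide.\<close>

lemma hyperbolic_pencil_mono:
  assumes "hyperbolic_pencil p q" "degree p = degree q"
    and "sum_list (zero_list p) \<le> sum_list (zero_list q)"
  shows "list_all2 (\<le>) (zero_list p) (zero_list q)"
proof -
  note hp = hyperbolic_pencil_left[OF assms(1)] and hq = hyperbolic_pencil_right[OF assms(1)]
  have len: "length (zero_list p) = length (zero_list q)"
    using assms(2) by (simp add: length_zero_list hp hq)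
  obtain m :: int where m: "m = -1 \<or> m = 0"
    "\<And>x. int (count_gt (zero_list p) x) - int (count_gt (zero_list q) x) \<in> {m, m + 1}"
    "\<And>z. Im z > 0 \<Longrightarrow>
      phase (zero_list p) z - phase (zero_list q) z \<in> {pi * m<..<pi * (m + 1)}"
    by (rule hyperbolic_pencil_trapped[OF assms(1)]) (rule that; assumption)
  show ?thesis
  proof (cases "m = 0")
    case True
    have "count_gt (zero_list q) x \<le> count_gt (zero_list p) x" for x
      using m(2)[of x] True by auto
    then have "list_all2 (\<le>) (zero_list q) (zero_list p)"
      using len by (intro list_all2_le_if_count_gt_le) auto
    then have "zero_list q = zero_list p"
      using list_all2_le_sum_list_eq assms(3) by blast
    then show ?thesis
      by (simp add: list_all2_refl)
  next
    case False
    then have "count_gt (zero_list p) x \<le> count_gt (zero_list q) x" for x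
      using m(1) m(2)[of x] by auto
    then show ?thesis
      using len by (intro list_all2_le_if_count_gt_le) auto
  qed
qed

lemma hyperbolic_pencil_interlace:
  assumes "hyperbolic_pencil p q" "degree p = degree q + 1" "i < length (zero_list q)"
  shows "zero_list p ! i \<le> zero_list q ! i" "zero_list q ! i \<le> zero_list p ! Suc i"
proof -
  note hp = hyperbolic_pencil_left[OF assms(1)] and hq = hyperbolic_pencil_right[OF assms(1)]
  have len: "length (zero_list p) = length (zero_list q) + 1"
    using assms(2) by (simp add: length_zero_list hp hq)
  have "x < zero_list q ! i" if "x < zero_list p ! i" for x
    using that less_nth_iff_count_gt[of "zero_list p" i x] less_nth_iff_count_gt[of "zero_list q" i x]
      hyperbolic_pencil_Suc_degree(2)[OF assms(1,2), of x] len assms(3) by auto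
  then show "zero_list p ! i \<le> zero_list q ! i"
    using linorder_not_le by blast
  have "x < zero_list p ! Suc i" if "x < zero_list q ! i" for x
    using that less_nth_iff_count_gt[of "zero_list p" "Suc i" x]
      less_nth_iff_count_gt[of "zero_list q" i x]
      hyperbolic_pencil_Suc_degree(1)[OF assms(1,2), of x] len assms(3) by auto
  then show "zero_list q ! i \<le> zero_list p ! Suc i"
    using linorder_not_le by blast
qed

section \<open>Differential operators\<close>

lemma coeff_mult_top:
  fixes p q :: "'a :: comm_semiring_0 poly"
  assumes "degree p \<le> m" "degree q \<le> n"
  shows "coeff (p * q) (m + n) = coeff p m * coeff q n"
proof -
  have "coeff (p * q) (m + n) = (\<Sum>i\<le>m + n. coeff p i * coeff q (m + n - i))"
    by (simp add: coeff_mult)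
  also have "\<dots> = (\<Sum>i\<in>{m}. coeff p i * coeff q (m + n - i))"
  proof (rule sum.mono_neutral_right)
    show "\<forall>i\<in>{..m + n} - {m}. coeff p i * coeff q (m + n - i) = 0"
    proof
      fix i assume "i \<in> {..m + n} - {m}"
      then consider "i > m" | "i < m"
        by force
      then show "coeff p i * coeff q (m + n - i) = 0"
        using assms by cases (auto simp: coeff_eq_0)
    qed
  qed auto
  finally show ?thesis
    by simp
qed

section \<open>Falling factorials and derivatives of powers\<close>

definition falling :: "nat \<Rightarrow> nat \<Rightarrow> real" where
  "falling k j = (\<Prod>i<j. real k - real i)"

lemma falling_0 [simp]: "falling k 0 = 1"
  and falling_Suc: "falling k (Suc j) = falling k j * (real k - real j)"
  by (simp_all add: falling_def)

lemma falling_eq_0: "k < j \<Longrightarrow> falling k j = 0"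
  by (auto simp: falling_def)

lemma falling_pos: "j \<le> k \<Longrightarrow> falling k j > 0"
  unfolding falling_def by (intro prod_pos) auto

lemma falling_nonneg: "falling k j \<ge> 0"
  by (cases "j \<le> k") (auto simp: falling_eq_0 falling_pos less_imp_le)

lemma falling_mono: "k \<le> l \<Longrightarrow> falling k j \<le> falling l j"
proof (cases "j \<le> k")
  case True
  assume "k \<le> l"
  then show ?thesis
    unfolding falling_def using True by (intro prod_mono) auto
qed (simp add: falling_eq_0 falling_nonneg)

lemma falling_strict_mono:
  assumes "k < l" "1 \<le> j" "j \<le> l"
  shows "falling k j < falling l j"
proof (cases "j \<le> k")
  case True
  obtain i where i: "j = Suc i"
    using assms(2) by (cases j) auto
  have "falling k i * (real k - real i) < falling l i * (real l - real i)"
    using assms True i falling_mono[of k l i] falling_pos[of i k]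
    by (intro mult_le_less_imp_less) auto
  then show ?thesis
    by (simp add: i falling_Suc)
next
  case False
  then show ?thesis
    using assms by (simp add: falling_eq_0 falling_pos)
qed

lemma falling_eq_pochhammer:
  assumes "j \<le> k"
  shows "falling k j = pochhammer (real (Suc (k - j))) j"
  using assms
proof (induction j)
  case (Suc j)
  then have "falling k (Suc j) = (real (k - j)) * pochhammer (real (Suc (k - j))) j"
    by (simp add: falling_Suc of_nat_diff)
  also have "\<dots> = pochhammer (real (Suc (k - Suc j))) (Suc j)"
    using Suc.prems by (simp add: pochhammer_rec Suc_diff_Suc algebra_simps)
  finally show ?case .
qed simp

text \<open>With this, \<open>T\<close> applied to \<open>k\<close>-th powers approaches the symbol
  as \<open>k\<close> grows.\<close>

lemma falling_asymp: "(\<lambda>k. falling k j / real k ^ j) \<longlonglongrightarrow> 1"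
proof (induction j)
  case (Suc j)
  have "(\<lambda>k. falling k j / real k ^ j * (1 - real j / real k)) \<longlonglongrightarrow> 1 * (1 - 0)"
    by (intro tendsto_mult tendsto_diff Suc.IH tendsto_const tendsto_divide_0[OF tendsto_const]
        filterlim_at_top_imp_at_infinity filterlim_real_sequentially)
  moreover have "\<forall>\<^sub>F k in sequentially. falling k j / real k ^ j * (1 - real j / real k)
      = falling k (Suc j) / real k ^ Suc j"
    using eventually_gt_at_top[of 0] by eventually_elim (simp add: falling_Suc field_simps)
  ultimately show ?case
    by (simp add: filterlim_cong)
qed simp

lemma higher_pderiv_linear_power:
  fixes a :: "'a :: real_field"
  shows "(pderiv ^^ j) ([:a, 1:] ^ k) = smult (of_real (falling k j)) ([:a, 1:] ^ (k - j))"
proof (induction j)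
  case (Suc j)
  have "(pderiv ^^ Suc j) ([:a, 1:] ^ k) = smult (of_real (falling k j) * of_nat (k - j)) ([:a, 1:] ^ (k - Suc j))"
    by (simp add: Suc.IH pderiv_smult pderiv_power pderiv_pCons)
  also have "of_real (falling k j) * of_nat (k - j) = (of_real (falling k (Suc j)) :: 'a)"
    by (cases "j \<le> k") (simp_all add: falling_Suc falling_eq_0 of_nat_diff)
  finally show ?case .
qed simp

lemma higher_pderiv_zero:
  fixes f :: "real poly"
  assumes "degree f < j"
  shows "(pderiv ^^ j) f = 0"
  using assms by (intro poly_eqI) (simp add: coeff_higher_pderiv coeff_eq_0)

lemma coeff_higher_pderiv_top:
  fixes f :: "real poly"
  assumes "j \<le> d"
  shows "coeff ((pderiv ^^ j) f) (d - j) = falling d j * coeff f d"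
  using assms by (simp add: coeff_higher_pderiv falling_eq_pochhammer)

lemma smult_sum_right: "smult c (sum f A) = (\<Sum>i\<in>A. smult c (f i))"
  by (induction A rule: infinite_finite_induct) (auto simp: smult_add_right)

lemma diff_op_add: "diff_op M N Q (p + q) = diff_op M N Q p + diff_op M N Q q"
  by (simp add: diff_op_def higher_pderiv_add algebra_simps sum.distrib)

lemma diff_op_smult: "diff_op M N Q (smult c p) = smult c (diff_op M N Q p)"
  by (simp add: diff_op_def higher_pderiv_smult smult_sum_right)

lemma diff_op_minus: "diff_op M N Q (- p) = - diff_op M N Q p"
  using diff_op_smult[of M N Q "-1" p] by simp

lemma diff_op_diff: "diff_op M N Q (p - q) = diff_op M N Q p - diff_op M N Q q"
  using diff_op_add[of M N Q p "- q"] by (simp add: diff_op_minus)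

lemma diff_op_0 [simp]: "diff_op M N Q 0 = 0"
  by (simp add: diff_op_def)

lemmas diff_op_linear = diff_op_add diff_op_smult diff_op_diff diff_op_minus

lemma degree_diff_op_le:
  assumes "\<And>k. k \<in> {M..N} \<Longrightarrow> degree (Q k) \<le> k + 1" "degree f \<le> d"
  shows "degree (diff_op M N Q f) \<le> d + 1"
  unfolding diff_op_def
proof (rule degree_sum_le)
  fix k assume k: "k \<in> {M..N}"
  show "degree (Q k * (pderiv ^^ k) f) \<le> d + 1"
  proof (cases "k \<le> d")
    case True
    then show ?thesis
      using assms(1)[OF k] assms(2) degree_mult_le[of "Q k" "(pderiv ^^ k) f"]
      by (simp add: degree_higher_pderiv)
  next
    case False
    then have "(pderiv ^^ k) f = 0"
      using assms(2) by (intro higher_pderiv_zero) auto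
    then show ?thesis
      by simp
  qed
qed simp

lemma coeff_diff_op_top:
  assumes "\<And>k. k \<in> {M..N} \<Longrightarrow> degree (Q k) \<le> k + 1" "degree f \<le> d"
  shows "coeff (diff_op M N Q f) (d + 1) = (\<Sum>k=M..N. coeff (Q k) (k + 1) * falling d k) * coeff f d"
proof -
  have "coeff (Q k * (pderiv ^^ k) f) (d + 1) = coeff (Q k) (k + 1) * falling d k * coeff f d"
    if k: "k \<in> {M..N}" for k
  proof (cases "k \<le> d")
    case True
    have "coeff (Q k * (pderiv ^^ k) f) (k + 1 + (d - k))
        = coeff (Q k) (k + 1) * coeff ((pderiv ^^ k) f) (d - k)"
      using assms(1)[OF k] assms(2) by (intro coeff_mult_top) (auto simp: degree_higher_pderiv)
    then show ?thesis
      using True by (simp add: coeff_higher_pderiv_top)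
  next
    case False
    then have "(pderiv ^^ k) f = 0"
      using assms(2) by (intro higher_pderiv_zero) auto
    then show ?thesis
      using False by (simp add: falling_eq_0)
  qed
  then show ?thesis
    by (simp add: diff_op_def coeff_sum sum_distrib_right)
qed

text \<open>Replaces Hurwitz's theorem when passing to limits of zero-free polynomials.\<close>

lemma norm_poly_le_zero_free:
  fixes p :: "complex poly"
  assumes "degree p \<le> n" "r > 0" "\<And>w. w \<in> ball a r \<Longrightarrow> poly p w \<noteq> 0"
  shows "cmod (poly p w) \<le> cmod (poly p a) * (1 + cmod (w - a) / r) ^ n"
proof -
  obtain root where rt: "smult (lead_coeff p) (\<Prod>i<degree p. [:- root i, 1:]) = p"
    by (rule complex_poly_decompose'[of p])
  define C where "C = 1 + cmod (w - a) / r"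
  have C: "C \<ge> 1"
    using assms(2) by (simp add: C_def)
  have eval: "poly p z = lead_coeff p * (\<Prod>i<degree p. z - root i)" for z
    using arg_cong[OF rt, of "\<lambda>p. poly p z"] by (simp add: poly_prod)
  \<comment> \<open>Every root keeps distance at least \<open>r\<close> from \<open>a\<close>, so
    passing from \<open>a\<close> to \<open>w\<close> stretches each linear factor by at most
    \<open>C\<close>.\<close>
  have factor: "cmod (w - root i) \<le> cmod (a - root i) * C" if "i < degree p" for i
  proof -
    have "poly p (root i) = 0"
      using that by (auto simp: eval)
    then have "root i \<notin> ball a r"
      using assms(3) by blast
    then have r: "r \<le> cmod (a - root i)"
      by (simp add: dist_norm)
    have "cmod (w - root i) \<le> cmod (a - root i) + cmod (w - a)"
      using norm_triangle_ineq[of "a - root i" "w - a"] by simp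
    also have "cmod (w - a) = r * (cmod (w - a) / r)"
      using assms(2) by simp
    also have "\<dots> \<le> cmod (a - root i) * (cmod (w - a) / r)"
      using r assms(2) by (intro mult_right_mono) auto
    finally show ?thesis
      by (simp add: C_def distrib_left)
  qed
  have "cmod (poly p w) = cmod (lead_coeff p) * (\<Prod>i<degree p. cmod (w - root i))"
    by (simp add: eval norm_mult prod_norm)
  also have "\<dots> \<le> cmod (lead_coeff p) * (\<Prod>i<degree p. cmod (a - root i) * C)"
    using factor by (intro mult_left_mono prod_mono) auto
  also have "\<dots> = cmod (poly p a) * C ^ degree p"
    by (simp add: eval norm_mult prod_norm prod.distrib)
  also have "\<dots> \<le> cmod (poly p a) * C ^ n"
    using C assms(1) by (intro mult_left_mono power_increasing) auto
  finally show ?thesis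
    by (simp add: C_def)
qed

text \<open>The preceding bound passes to the limit. If the limit polynomial vanishes at
  \<open>a\<close>, the bound tends to 0 at every \<open>w\<close>, so the limit vanishes
  identically.\<close>

lemma zero_free_limit:
  fixes c :: "nat \<Rightarrow> nat \<Rightarrow> complex"
  assumes lim: "\<And>j. j \<in> {M..N} \<Longrightarrow> (\<lambda>k. c k j) \<longlonglongrightarrow> d j" and r: "r > 0"
    and nz: "\<forall>\<^sub>F k in sequentially. \<forall>w\<in>ball a r. (\<Sum>j=M..N. c k j * w ^ j) \<noteq> 0"
    and z: "(\<Sum>j=M..N. d j * a ^ j) = 0"
    and j: "j \<in> {M..N}"
  shows "d j = 0"
proof -
  define p where "p k = (\<Sum>j=M..N. monom (c k j) j)" for k
  have pp: "poly (p k) w = (\<Sum>j=M..N. c k j * w ^ j)" for k w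
    by (simp add: p_def poly_sum poly_monom)
  have deg: "degree (p k) \<le> N" for k
    unfolding p_def by (intro degree_sum_le) (auto intro: order.trans[OF degree_monom_le])
  have lim': "(\<lambda>k. poly (p k) w) \<longlonglongrightarrow> (\<Sum>j=M..N. d j * w ^ j)" for w
    unfolding pp by (intro tendsto_intros lim)
  have "(\<Sum>j=M..N. d j * w ^ j) = 0" for w
  proof -
    have "(\<lambda>k. cmod (poly (p k) a) * (1 + cmod (w - a) / r) ^ N) \<longlonglongrightarrow>
        cmod 0 * (1 + cmod (w - a) / r) ^ N"
      using lim'[of a] z by (intro tendsto_intros) simp
    moreover have "\<forall>\<^sub>F k in sequentially.
        cmod (poly (p k) w) \<le> cmod (poly (p k) a) * (1 + cmod (w - a) / r) ^ N"
      using nz by eventually_elim (intro norm_poly_le_zero_free deg r, simp add: pp)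
    ultimately have "cmod (\<Sum>j=M..N. d j * w ^ j) \<le> cmod 0 * (1 + cmod (w - a) / r) ^ N"
      using tendsto_norm[OF lim'[of w]] by (intro tendsto_le[OF _ _ _]) auto
    then show ?thesis
      by simp
  qed
  then have "poly (\<Sum>j=M..N. monom (d j) j) w = poly 0 w" for w
    by (simp add: poly_sum poly_monom)
  then have "(\<Sum>j=M..N. monom (d j) j) = 0"
    using poly_eq_poly_eq_iff by blast
  then have "coeff (\<Sum>j=M..N. monom (d j) j) j = 0"
    by simp
  then show ?thesis
    using j by (simp add: coeff_sum)
qed

section \<open>The symbol of a hyperbolicity preserver\<close>

lemma map_poly_of_real_pderiv:
  "map_poly complex_of_real (pderiv p) = pderiv (map_poly complex_of_real p)"
  by (intro poly_eqI) (simp add: coeff_map_poly coeff_pderiv)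

lemma cev_higher_pderiv:
  "cev ((pderiv ^^ j) p) z = poly ((pderiv ^^ j) (map_poly complex_of_real p)) z"
proof -
  have "map_poly complex_of_real ((pderiv ^^ j) p) = (pderiv ^^ j) (map_poly complex_of_real p)"
    by (induction j) (simp_all add: map_poly_of_real_pderiv)
  then show ?thesis
    by (simp add: cev_def)
qed

lemma cmod_diff_less_lower_zero:
  assumes "Im z > 0" "Im \<zeta> < 0"
  shows "cmod (z - cnj \<zeta>) < cmod (z - \<zeta>)"
proof -
  have "(Im z + Im \<zeta>)\<^sup>2 < (Im z - Im \<zeta>)\<^sup>2"
    using mult_pos_neg[OF assms] by (simp add: power2_eq_square algebra_simps)
  then show ?thesis
    by (simp add: cmod_def)
qed

text \<open>\<open>degree_Q\<close> and \<open>lead_Q_N\<close> restate non-degeneracy with Fuchs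
  index 1 on coefficients. Positivity in \<open>lead_Q_N\<close> is a normalisation, reached by
  multiplying \<open>T\<close> with a sign.\<close>

locale preserver =
  fixes M N :: nat and Q :: "nat \<Rightarrow> real poly"
  assumes M_le_N: "M \<le> N"
    and Q_M: "Q M \<noteq> 0"
    and degree_Q: "\<And>k. k \<in> {M..N} \<Longrightarrow> degree (Q k) \<le> k + 1"
    and lead_Q_N: "coeff (Q N) (N + 1) > 0"
    and preserves: "hyperbolicity_preserver (diff_op M N Q)"
begin

abbreviation T :: "real poly \<Rightarrow> real poly" where
  "T \<equiv> diff_op M N Q"

abbreviation q :: "nat \<Rightarrow> real" where
  "q k \<equiv> coeff (Q k) (k + 1)"

text \<open>The coefficient of \<open>z^(d+1)\<close> in \<open>T (z^d)\<close>, hence the common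
  leading coefficient of all Van Vleck polynomials in degree \<open>d\<close> when it is
  nonzero.\<close>

definition lam :: "nat \<Rightarrow> real" where
  "lam d = (\<Sum>k=M..N. q k * falling d k)"

lemma degree_T: "degree f \<le> d \<Longrightarrow> degree (T f) \<le> d + 1"
  by (intro degree_diff_op_le degree_Q)

lemma coeff_T: "degree f \<le> d \<Longrightarrow> coeff (T f) (d + 1) = lam d * coeff f d"
  unfolding lam_def by (intro coeff_diff_op_top degree_Q)

lemma T_neq_0: "lam (degree f) \<noteq> 0 \<Longrightarrow> f \<noteq> 0 \<Longrightarrow> T f \<noteq> 0"
  using coeff_T[of f "degree f"] by auto

lemma degree_T_eq:
  assumes "lam (degree f) \<noteq> 0" "f \<noteq> 0"
  shows "degree (T f) = degree f + 1"
proof (rule antisym)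
  show "degree f + 1 \<le> degree (T f)"
    using coeff_T[of f "degree f"] assms by (intro le_degree) simp
qed (simp add: degree_T[of f "degree f", simplified])

lemma hyperbolic_T: "hyperbolic f \<Longrightarrow> T f \<noteq> 0 \<Longrightarrow> hyperbolic (T f)"
  using preserves unfolding hyperbolicity_preserver_def by blast

lemma hyperbolic_pencil_T:
  assumes "\<And>a b. a \<noteq> 0 \<or> b \<noteq> 0 \<Longrightarrow> hyperbolic (smult a f + smult b g) \<and> T (smult a f + smult b g) \<noteq> 0"
  shows "hyperbolic_pencil (T f) (T g)"
  unfolding hyperbolic_pencil_def
proof (intro allI impI)
  fix a b :: real assume "a \<noteq> 0 \<or> b \<noteq> 0"
  then show "hyperbolic (smult a (T f) + smult b (T g))"
    using hyperbolic_T[of "smult a f + smult b g"] assms[of a b] by (simp add: diff_op_linear)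
qed

text \<open>After division by \<open>k^N\<close> only the term \<open>j = N\<close> survives. The
  signs of the other \<open>q j\<close> are still unknown here, so positivity is available only for
  large \<open>k\<close>.\<close>

lemma lam_eventually_pos: "\<forall>\<^sub>F k in sequentially. lam k > 0"
proof -
  have "(\<lambda>k. \<Sum>j=M..N. q j * (falling k j / real k ^ j) * (1 / real k) ^ (N - j))
      \<longlonglongrightarrow> (\<Sum>j=M..N. q j * 1 * 0 ^ (N - j))"
    by (intro tendsto_intros falling_asymp lim_1_over_n)
  also have "(\<Sum>j=M..N. q j * 1 * 0 ^ (N - j)) = (\<Sum>j=M..N. if j = N then q N else 0)"
    by (intro sum.cong) (auto simp: power_0_left)
  also have "\<dots> = q N"
    using M_le_N by simp
  finally have "\<forall>\<^sub>F k in sequentially.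
      (\<Sum>j=M..N. q j * (falling k j / real k ^ j) * (1 / real k) ^ (N - j)) > 0"
    using lead_Q_N order_tendstoD(1) by blast
  moreover have "\<forall>\<^sub>F k in sequentially. (\<Sum>j=M..N. q j * (falling k j / real k ^ j) * (1 / real k) ^ (N - j))
      = lam k / real k ^ N"
    using eventually_gt_at_top[of 0]
  proof eventually_elim
    case (elim k)
    have "q j * (falling k j / real k ^ j) * (1 / real k) ^ (N - j) = q j * falling k j / real k ^ N"
      if "j \<in> {M..N}" for j
    proof -
      have "real k ^ N = real k ^ j * real k ^ (N - j)"
        using that by (simp flip: power_add)
      then show ?thesis
        using elim by (simp add: power_divide)
    qed
    then show ?case
      by (simp add: lam_def sum_divide_distrib)
  qed
  ultimately show ?thesis
    using eventually_gt_at_top[of 0]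
    by eventually_elim (auto simp: zero_less_divide_iff)
qed

text \<open>Writing \<open>(z - \<zeta>)\<^sup>k = f + i g\<close> with real \<open>f\<close> and \<open>g\<close>, all real combinations of
  \<open>f\<close> and \<open>g\<close> are hyperbolic (Hermite--Biehler), hence so are those of \<open>T f\<close> and \<open>T g\<close>.\<close>

lemma T_power_neq_0:
  assumes k: "k \<ge> 1" "lam k > 0" "lam (k - 1) > 0" and z: "Im z > 0" and \<zeta>: "Im \<zeta> < 0"
  shows "(\<Sum>j=M..N. cev (Q j) z * of_real (falling k j) * (z - \<zeta>) ^ (k - j)) \<noteq> 0"
proof -
  define F where "F = [:- \<zeta>, 1:] ^ k"
  define f where "f = map_poly Re F"
  define g where "g = map_poly Im F"
  have F: "F = map_poly complex_of_real f + smult \<i> (map_poly complex_of_real g)"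
    by (intro poly_eqI) (simp add: f_def g_def coeff_map_poly complex_eq_iff)
  have cf: "coeff f i = Re (coeff F i)" and cg: "coeff g i = Im (coeff F i)" for i
    by (simp_all add: f_def g_def coeff_map_poly)
  have degF: "degree F = k"
    by (simp add: F_def degree_power_eq)
  have F0: "coeff F k = 1"
    using coeff_linear_poly_power[of k k "- \<zeta>" 1] by (simp add: F_def)
  have F1: "coeff F (k - 1) = - of_nat k * \<zeta>"
  proof -
    have "k choose (k - 1) = k"
      using k(1) by (cases k) auto
    then show ?thesis
      using coeff_linear_poly_power[of "k - 1" k "- \<zeta>" 1] k(1) by (simp add: F_def)
  qed
  have degf: "degree f = k"
    using cf[of k] F0 degF by (intro antisym degree_le le_degree) (auto simp: cf coeff_eq_0)
  \<comment> \<open>\<open>Im \<zeta> < 0\<close> makes the degrees of \<open>f\<close> and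
    \<open>g\<close> differ by exactly 1. With \<open>lam k\<close> and \<open>lam (k - 1)\<close>
    nonzero the same holds for the images, and this fixes the sign of their phase
    difference.\<close>
  have cg1: "coeff g (k - 1) > 0"
    unfolding cg F1 using \<zeta> k(1) by (simp add: mult_pos_neg)
  have degg: "degree g = k - 1"
  proof (rule antisym)
    have "coeff g i = 0" if "k - 1 < i" for i
    proof -
      have "i = k \<or> i > k"
        using that by linarith
      then show ?thesis
        using F0 degF by (auto simp: cg coeff_eq_0)
    qed
    then show "degree g \<le> k - 1"
      by (simp add: degree_le)
  qed (use cg1 in \<open>auto intro: le_degree\<close>)
  have ev: "cev f w + \<i> * cev g w = (w - \<zeta>) ^ k" for w
    using arg_cong[OF F, of "\<lambda>p. poly p w"] by (simp add: cev_def F_def)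
  have ev': "cev f w - \<i> * cev g w = (w - cnj \<zeta>) ^ k" for w
    using arg_cong[OF ev[of "cnj w"], of cnj] by (simp flip: cev_cnj)
  \<comment> \<open>A vanishing combination would equate the \<open>k\<close>-th powers of the
    distances from \<open>w\<close> to \<open>\<zeta>\<close> and to its conjugate, but
    \<open>w\<close> is strictly closer to the conjugate.\<close>
  have nz: "of_real a * cev f w + of_real b * cev g w \<noteq> 0" if "a \<noteq> 0 \<or> b \<noteq> 0" "Im w > 0" for a b w
  proof
    assume *: "of_real a * cev f w + of_real b * cev g w = 0"
    have "(w - \<zeta>) ^ k * Complex a (- b) + (w - cnj \<zeta>) ^ k * Complex a b
        = 2 * (of_real a * cev f w + of_real b * cev g w)"
      unfolding ev[symmetric] ev'[symmetric] Complex_eq by (simp add: algebra_simps)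
    then have "(w - \<zeta>) ^ k * Complex a (- b) = - ((w - cnj \<zeta>) ^ k * Complex a b)"
      using * by (simp add: eq_neg_iff_add_eq_0)
    then have "cmod ((w - \<zeta>) ^ k * Complex a (- b)) = cmod ((w - cnj \<zeta>) ^ k * Complex a b)"
      by simp
    moreover have conj_norm: "cmod (Complex a (- b)) = cmod (Complex a b)"
      by (simp add: cmod_def)
    ultimately have "cmod (w - \<zeta>) ^ k * cmod (Complex a b) = cmod (w - cnj \<zeta>) ^ k * cmod (Complex a b)"
      unfolding norm_mult norm_power by simp
    moreover have "Complex a b \<noteq> 0"
      using that by (auto simp: complex_eq_iff)
    ultimately have "cmod (w - \<zeta>) ^ k = cmod (w - cnj \<zeta>) ^ k"
      by simp
    moreover have "cmod (w - cnj \<zeta>) ^ k < cmod (w - \<zeta>) ^ k"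
      using cmod_diff_less_lower_zero[OF that(2) \<zeta>] k(1) by (intro power_strict_mono) auto
    ultimately show False
      by simp
  qed
  have comb: "hyperbolic (smult a f + smult b g) \<and> T (smult a f + smult b g) \<noteq> 0"
    if ab: "a \<noteq> 0 \<or> b \<noteq> 0" for a b
  proof
    have "smult a f + smult b g \<noteq> 0"
      using nz[OF ab, of \<i>] by (metis cev_0 cev_add cev_smult imaginary_unit.sel(2) zero_less_one)
    then show "hyperbolic (smult a f + smult b g)"
      using nz[OF ab] by (simp add: hyperbolic_iff_upper)
    show "T (smult a f + smult b g) \<noteq> 0"
    proof (cases "a = 0")
      case False
      have "coeff (T (smult a f + smult b g)) (k + 1) = lam k * coeff (smult a f + smult b g) k"
        using degf degg by (intro coeff_T degree_add_le) (auto intro: order.trans[OF degree_smult_le])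
      also have "\<dots> = lam k * a"
        by (simp add: cf cg F0)
      finally show ?thesis
        using False k(2) by auto
    next
      case True
      have "coeff (T (smult b g)) (k - 1 + 1) = lam (k - 1) * (b * coeff g (k - 1))"
        using coeff_T[of "smult b g" "k - 1"] degg by simp
      then have "coeff (T (smult b g)) (k - 1 + 1) \<noteq> 0"
        using True ab k(3) cg1 by simp
      then show ?thesis
        using True by auto
    qed
  qed
  have pencil: "hyperbolic_pencil (T f) (T g)"
    using comb by (intro hyperbolic_pencil_T)
  have f0: "f \<noteq> 0" and g0: "g \<noteq> 0"
    using cg1 cf[of k] F0 by auto
  have degT: "degree (T f) = degree (T g) + 1"
    using degree_T_eq[of f] degree_T_eq[of g] f0 g0 degf degg k by simp
  have "lead_coeff (T f) = lam k"
    using degree_T_eq[of f] f0 degf k coeff_T[of f k] cf[of k] F0 by simp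
  moreover have "lead_coeff (T g) = lam (k - 1) * coeff g (k - 1)"
    using degree_T_eq[of g] g0 degg k coeff_T[of g "k - 1"] by simp
  ultimately have Im: "Im (cev (T f) z * cnj (cev (T g) z)) > 0"
    using hyperbolic_pencil_Suc_degree(3)[OF pencil degT z] k cg1 by simp
  have "cev (T f) z + \<i> * cev (T g) z = (\<Sum>j=M..N. cev (Q j) z * poly ((pderiv ^^ j) F) z)"
    unfolding F by (simp add: diff_op_def cev_higher_pderiv higher_pderiv_add higher_pderiv_smult
        sum_distrib_left sum.distrib algebra_simps)
  also have "\<dots> = (\<Sum>j=M..N. cev (Q j) z * of_real (falling k j) * (z - \<zeta>) ^ (k - j))"
    by (simp add: F_def higher_pderiv_linear_power algebra_simps)
  finally have eq: "cev (T f) z + \<i> * cev (T g) z = \<dots>" .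
  \<comment> \<open>At a zero the product of \<open>T f\<close> with the conjugate of
    \<open>T g\<close> would be \<open>-\<i>\<close> times a nonnegative number, against the
    positive imaginary part just found.\<close>
  have "cev (T f) z + \<i> * cev (T g) z \<noteq> 0"
  proof
    assume "cev (T f) z + \<i> * cev (T g) z = 0"
    then have "cev (T f) z = - (\<i> * cev (T g) z)"
      by (simp add: eq_neg_iff_add_eq_0)
    then have "Im (cev (T f) z * cnj (cev (T g) z)) = - ((Re (cev (T g) z))\<^sup>2 + (Im (cev (T g) z))\<^sup>2)"
      by (simp add: power2_eq_square)
    then show False
      using Im sum_power2_ge_zero[of "Re (cev (T g) z)" "Im (cev (T g) z)"] by linarith
  qed
  then show ?thesis
    using eq by simp
qed

text \<open>The substitution \<open>\<zeta> = z - k / w\<close>, followed by multiplication with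
  \<open>(w / k)^k\<close>, turns \<open>T\<close> on a \<open>k\<close>-th power into a polynomial
  in \<open>w\<close> whose coefficients tend to those of the symbol. \<open>k \<ge> N\<close> makes
  every \<open>k - j\<close> a true difference.\<close>

lemma symbol_neq_0:
  assumes k: "k \<ge> 1" "k \<ge> N" "lam k > 0" "lam (k - 1) > 0"
    and z: "Im z > 0" and w: "w \<noteq> 0" "Im (z - of_nat k / w) < 0"
  shows "(\<Sum>j=M..N. cev (Q j) z * of_real (falling k j / real k ^ j) * w ^ j) \<noteq> 0"
proof -
  have "(of_nat k / w) ^ (k - j) * (w / of_nat k) ^ k = (w / of_nat k) ^ j" if "j \<in> {M..N}" for j
  proof -
    have "(w / of_nat k) ^ k = (w / of_nat k) ^ (k - j) * (w / of_nat k) ^ j"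
      using that k(2) by (simp flip: power_add)
    moreover have "(of_nat k / w) ^ (k - j) * (w / of_nat k) ^ (k - j) = 1"
      using w(1) k(1) by (simp flip: power_mult_distrib)
    ultimately show ?thesis
      by (metis mult.assoc mult_1)
  qed
  then have "(\<Sum>j=M..N. cev (Q j) z * of_real (falling k j) * (of_nat k / w) ^ (k - j)) * (w / of_nat k) ^ k
      = (\<Sum>j=M..N. cev (Q j) z * of_real (falling k j) * (w / of_nat k) ^ j)"
    by (simp add: sum_distrib_right mult.assoc)
  also have "\<dots> = (\<Sum>j=M..N. cev (Q j) z * of_real (falling k j / real k ^ j) * w ^ j)"
    by (simp add: power_divide field_simps)
  finally show ?thesis
    using T_power_neq_0[OF k(1,3,4) z w(2)] w(1) k(1) by auto
qed

lemma eventually_good: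
  "\<forall>\<^sub>F k in sequentially. k \<ge> 1 \<and> k \<ge> N \<and> lam k > 0 \<and> lam (k - 1) > 0"
proof -
  have "\<forall>\<^sub>F k in sequentially. lam (k - 1) > 0"
    using lam_eventually_pos eventually_compose_filterlim filterlim_minus_const_nat_at_top by blast
  then show ?thesis
    using lam_eventually_pos eventually_ge_at_top[of 1] eventually_ge_at_top[of N]
    by eventually_elim auto
qed

end

text \<open>Growth linear in \<open>k\<close>, uniform on a ball in the lower half plane: eventually
  \<open>z - k / w\<close> lies below the real axis for all \<open>w\<close> in the ball.\<close>

lemma Im_divide_ge:
  assumes "Im w \<le> - r" "r \<ge> 0" "cmod w \<le> B" "w \<noteq> 0"
  shows "Im (of_nat k / w) \<ge> real k * (r / B\<^sup>2)"
proof -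
  have "r / B\<^sup>2 \<le> - Im w / (cmod w)\<^sup>2"
    using assms by (intro frac_le power_mono) auto
  then have "real k * (r / B\<^sup>2) \<le> real k * (- Im w / (cmod w)\<^sup>2)"
    by (intro mult_left_mono) auto
  also have "\<dots> = Im (of_nat k / w)"
    by (simp add: Im_divide cmod_power2)
  finally show ?thesis .
qed

lemma ball_lower_half_plane:
  assumes "Im w0 < 0" "w \<in> ball w0 (- Im w0 / 2)"
  shows "Im w \<le> - (- Im w0 / 2)" "cmod w \<le> cmod w0 - Im w0 / 2" "w \<noteq> 0"
proof -
  have *: "cmod (w - w0) < - Im w0 / 2"
    using assms(2) by (simp add: dist_norm norm_minus_commute)
  have "\<bar>Im (w - w0)\<bar> \<le> cmod (w - w0)"
    by (rule abs_Im_le_cmod)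
  then show "Im w \<le> - (- Im w0 / 2)"
    using * by (auto simp: abs_le_iff)
  then show "w \<noteq> 0"
    using assms(1) by auto
  show "cmod w \<le> cmod w0 - Im w0 / 2"
    using * norm_triangle_ineq[of w0 "w - w0"] by simp
qed

context preserver
begin

definition symb :: "real \<Rightarrow> real poly" where
  "symb x = (\<Sum>j=M..N. monom (poly (Q j) x) j)"

lemma cev_monom: "cev (monom a j) w = of_real a * w ^ j"
  by (induction j) (simp_all add: monom_0 monom_Suc algebra_simps)

lemma symb_zero_free_lower:
  assumes "Im w0 < 0" "cev (symb x) w0 = 0"
  shows "symb x = 0"
proof -
  \<comment> \<open>Half the distance from \<open>w0\<close> to the real axis, so that the ball
    around \<open>w0\<close> stays in the lower half plane; \<open>B\<close> bounds its points in
    modulus.\<close>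
  define r where "r = - Im w0 / 2"
  define B where "B = cmod w0 + r"
  have r: "r > 0"
    using assms(1) by (simp add: r_def)
  then have B: "B > 0"
    using norm_ge_zero[of w0] unfolding B_def by linarith
  \<comment> \<open>Nonvanishing is known only for \<open>z\<close> in the upper half plane, so the
    real point \<open>x\<close> is approached from above.\<close>
  define z where "z k = of_real x + \<i> * of_real (1 / real k)" for k
  have zlim: "z \<longlonglongrightarrow> of_real x"
  proof -
    have "(\<lambda>k. of_real x + \<i> * of_real (1 / real k)) \<longlonglongrightarrow> of_real x + \<i> * of_real 0"
      by (intro tendsto_intros lim_1_over_n)
    then show ?thesis
      by (simp add: z_def[abs_def])
  qed
  define c where "c k j = cev (Q j) (z k) * of_real (falling k j / real k ^ j)" for k j
  have clim: "(\<lambda>k. c k j) \<longlonglongrightarrow> of_real (poly (Q j) x)" for j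
  proof -
    have "(\<lambda>k. cev (Q j) (z k)) \<longlonglongrightarrow> cev (Q j) (of_real x)"
      using zlim unfolding cev_def by (intro tendsto_intros)
    then have "(\<lambda>k. c k j) \<longlonglongrightarrow> cev (Q j) (of_real x) * of_real 1"
      unfolding c_def by (intro tendsto_mult tendsto_of_real falling_asymp)
    then show ?thesis
      by (simp add: cev_of_real)
  qed
  have "filterlim (\<lambda>k. real k * (r / B\<^sup>2)) at_top sequentially"
    using r B by (intro filterlim_at_top_mult_tendsto_pos[OF tendsto_const] filterlim_real_sequentially) auto
  then have "\<forall>\<^sub>F k in sequentially. real k * (r / B\<^sup>2) > 1"
    by (simp add: filterlim_at_top_dense)
  then have "\<forall>\<^sub>F k in sequentially. \<forall>w\<in>ball w0 r. (\<Sum>j=M..N. c k j * w ^ j) \<noteq> 0"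
    using eventually_good
  proof eventually_elim
    case (elim k)
    show ?case
    proof
      fix w assume "w \<in> ball w0 r"
      note w = ball_lower_half_plane[OF assms(1) this[unfolded r_def]]
      have "Im (of_nat k / w) \<ge> real k * (r / B\<^sup>2)"
        using w r by (intro Im_divide_ge) (auto simp: r_def B_def)
      moreover have "Im (z k) \<le> 1" "Im (z k) > 0"
        using elim by (auto simp: z_def)
      ultimately have "Im (z k - of_nat k / w) < 0"
        using elim by simp
      then show "(\<Sum>j=M..N. c k j * w ^ j) \<noteq> 0"
        using symbol_neq_0[of k "z k" w] elim w(3) \<open>Im (z k) > 0\<close> by (simp add: c_def)
    qed
  qed
  note zfl = zero_free_limit[OF clim r this]
  have "poly (Q j) x = 0" if "j \<in> {M..N}" for j
    using zfl[of j] assms(2) that by (simp add: symb_def cev_monom)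
  then show ?thesis
    by (simp add: symb_def)
qed

lemma hyperbolic_symb:
  assumes "symb x \<noteq> 0"
  shows "hyperbolic (symb x)"
  unfolding hyperbolic_iff_upper
proof (intro conjI allI impI notI)
  fix z assume "Im z > 0" "cev (symb x) z = 0"
  then show False
    using symb_zero_free_lower[of "cnj z" x] assms by (simp add: cev_cnj)
qed (use assms in auto)

section \<open>The leading part of the symbol and the signs of its coefficients\<close>

definition top_symb :: "real poly" where
  "top_symb = (\<Sum>j=M..N. monom (q j) j)"

lemma coeff_top_symb: "coeff top_symb j = (if j \<in> {M..N} then q j else 0)"
  by (simp add: top_symb_def coeff_sum)

lemma degree_top_symb: "degree top_symb = N"
  by (intro antisym degree_le le_degree) (use M_le_N lead_Q_N in \<open>auto simp: coeff_top_symb\<close>)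

lemma tendsto_cev_scaled:
  assumes "degree p \<le> d"
  shows "(\<lambda>k. cev p (of_nat k * u) / of_nat k ^ d) \<longlonglongrightarrow> of_real (coeff p d) * u ^ d"
proof -
  have expand: "cev p z = (\<Sum>i\<le>d. of_real (coeff p i) * z ^ i)" for z
  proof -
    have "cev p z = cev (\<Sum>i\<le>d. monom (coeff p i) i) z"
      by (subst poly_as_sum_of_monoms'[OF assms]) simp
    then show ?thesis
      by (simp add: cev_monom)
  qed
  have "(\<lambda>k. \<Sum>i\<le>d. of_real (coeff p i) * u ^ i * (of_real (1 / real k)) ^ (d - i))
      \<longlonglongrightarrow> (\<Sum>i\<le>d. of_real (coeff p i) * u ^ i * of_real 0 ^ (d - i))"
    by (intro tendsto_intros lim_1_over_n)
  also have "(\<Sum>i\<le>d. of_real (coeff p i) * u ^ i * of_real 0 ^ (d - i))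
      = (\<Sum>i\<le>d. if i = d then of_real (coeff p d) * u ^ d else 0)"
    by (intro sum.cong) (auto simp: power_0_left)
  also have "\<dots> = of_real (coeff p d) * u ^ d"
    by simp
  finally have "(\<lambda>k. \<Sum>i\<le>d. of_real (coeff p i) * u ^ i * (of_real (1 / real k)) ^ (d - i))
      \<longlonglongrightarrow> of_real (coeff p d) * u ^ d" .
  moreover have "\<forall>\<^sub>F k in sequentially.
      (\<Sum>i\<le>d. of_real (coeff p i) * u ^ i * (of_real (1 / real k)) ^ (d - i))
      = cev p (of_nat k * u) / of_nat k ^ d"
    using eventually_gt_at_top[of 0]
  proof eventually_elim
    case (elim k)
    have "of_real (coeff p i) * u ^ i * (of_real (1 / real k)) ^ (d - i)
        = of_real (coeff p i) * (of_nat k * u) ^ i / of_nat k ^ d" if "i \<le> d" for i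
    proof -
      have "(of_nat k :: complex) ^ d = of_nat k ^ i * of_nat k ^ (d - i)"
        using that by (simp flip: power_add)
      then show ?thesis
        using elim by (simp add: power_divide power_mult_distrib)
    qed
    then show ?case
      by (simp add: expand sum_divide_distrib)
  qed
  ultimately show ?thesis
    by (rule Lim_transform_eventually)
qed

text \<open>Blowing down, \<open>z = k u\<close> and \<open>w = w\<^sub>0 / k\<close>, the symbol tends to
  \<open>u \<Sum> q\<^sub>j (u w\<^sub>0)\<^sup>j\<close>; as \<open>u\<close> and \<open>w\<^sub>0\<close> run through the upper and lower half
  plane, \<open>u w\<^sub>0\<close> runs through the plane slit along the nonpositive reals.\<close>

lemma top_symb_zeros:
  assumes "cev top_symb x0 = 0"
  shows "x0 \<in> \<real>\<^sub>\<le>\<^sub>0"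
proof (rule ccontr)
  assume x0: "x0 \<notin> \<real>\<^sub>\<le>\<^sub>0"
  \<comment> \<open>Off the closed negative axis the principal root has positive real part. So
    \<open>\<i> y\<close> lies in the upper and \<open>-\<i> y\<close> in the lower half plane, and
    their product is \<open>x0\<close>.\<close>
  define y where "y = csqrt x0"
  have y2: "y\<^sup>2 = x0"
    by (simp add: y_def)
  have Rey: "Re y > 0"
  proof -
    have "Re y \<noteq> 0"
    proof
      assume "Re y = 0"
      then have "x0 = of_real (- (Im y)\<^sup>2)"
        unfolding y2[symmetric] by (simp add: complex_eq_iff power2_eq_square)
      then show False
        using x0 by (metis nonpos_Reals_of_real_iff neg_le_0_iff_le zero_le_power2)
    qed
    moreover have "Re y \<ge> 0"
      using csqrt_principal[of x0] by (auto simp: y_def)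
    ultimately show ?thesis
      by simp
  qed
  define u where "u = \<i> * y"
  define w0 where "w0 = - \<i> * y"
  have Im: "Im u > 0" "Im w0 < 0"
    using Rey by (simp_all add: u_def w0_def)
  have uw: "u * w0 = x0"
    unfolding u_def w0_def y2[symmetric] by (simp add: power2_eq_square complex_eq_iff)
  define r where "r = - Im w0 / 2"
  define B where "B = cmod w0 + r"
  have r: "r > 0"
    using Im by (simp add: r_def)
  then have B: "B > 0"
    using norm_ge_zero[of w0] unfolding B_def by linarith
  \<comment> \<open>The exponent \<open>j + 1\<close> is the degree bound of \<open>Q j\<close>.
    With \<open>w / k\<close> in place of \<open>w\<close>, all powers of \<open>k\<close> cancel
    except one common factor \<open>k\<close>.\<close>
  define c where "c k j = cev (Q j) (of_nat k * u) / of_nat k ^ (j + 1) * of_real (falling k j / real k ^ j)" for k j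
  have clim: "(\<lambda>k. c k j) \<longlonglongrightarrow> of_real (q j) * u ^ (j + 1)" if "j \<in> {M..N}" for j
  proof -
    have "(\<lambda>k. c k j) \<longlonglongrightarrow> of_real (q j) * u ^ (j + 1) * of_real 1"
      unfolding c_def by (intro tendsto_mult tendsto_of_real falling_asymp tendsto_cev_scaled degree_Q that)
    then show ?thesis
      by simp
  qed
  have "filterlim (\<lambda>k. real k * (r / B\<^sup>2)) at_top sequentially"
    using r B by (intro filterlim_at_top_mult_tendsto_pos[OF tendsto_const] filterlim_real_sequentially) auto
  then have "\<forall>\<^sub>F k in sequentially. real k * (r / B\<^sup>2) > Im u"
    by (simp add: filterlim_at_top_dense)
  then have "\<forall>\<^sub>F k in sequentially. \<forall>w\<in>ball w0 r. (\<Sum>j=M..N. c k j * w ^ j) \<noteq> 0"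
    using eventually_good
  proof eventually_elim
    case (elim k)
    show ?case
    proof
      fix w assume "w \<in> ball w0 r"
      note w = ball_lower_half_plane[OF Im(2) this[unfolded r_def]]
      have k: "real k > 0"
        using elim by simp
      have "Im (of_nat k / w) \<ge> real k * (r / B\<^sup>2)"
        using w r by (intro Im_divide_ge) (auto simp: r_def B_def)
      then have "Im u - Im (of_nat k / w) < 0"
        using elim by simp
      then have "real k * (Im u - Im (of_nat k / w)) < 0"
        using k by (simp add: mult_less_0_iff)
      moreover have "Im (of_nat k * u - of_nat k / (w / of_nat k)) = real k * (Im u - Im (of_nat k / w))"
      proof -
        have "of_nat k * u - of_nat k / (w / of_nat k) = of_real (real k) * (u - of_nat k / w)"
          using w(3) by (simp add: field_simps)
        then show ?thesis
          by simp
      qed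
      ultimately have "(\<Sum>j=M..N. cev (Q j) (of_nat k * u) * of_real (falling k j / real k ^ j) * (w / of_nat k) ^ j) \<noteq> 0"
        using symbol_neq_0[of k "of_nat k * u" "w / of_nat k"] elim w(3) Im(1) by simp
      also have "(\<Sum>j=M..N. cev (Q j) (of_nat k * u) * of_real (falling k j / real k ^ j) * (w / of_nat k) ^ j)
          = of_nat k * (\<Sum>j=M..N. c k j * w ^ j)"
        using k unfolding c_def sum_distrib_left
        by (intro sum.cong) (simp_all add: power_divide field_simps)
      finally show "(\<Sum>j=M..N. c k j * w ^ j) \<noteq> 0"
        by auto
    qed
  qed
  note zfl = zero_free_limit[OF clim r this]
  have "(\<Sum>j=M..N. of_real (q j) * u ^ (j + 1) * w0 ^ j) = u * cev top_symb (u * w0)"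
    by (simp add: top_symb_def cev_monom sum_distrib_left power_mult_distrib algebra_simps)
  also have "\<dots> = 0"
    using assms uw by simp
  \<comment> \<open>A zero off the slit would make every limit coefficient vanish, in particular the
    one carrying \<open>q N > 0\<close>.\<close>
  finally have "of_real (q N) * u ^ (N + 1) = 0"
    using zfl[of N] M_le_N by simp
  then show False
    using lead_Q_N Im(1) by auto
qed

lemma coeff_root_prod_nonneg:
  assumes "\<forall>x\<in>set xs. x \<le> 0"
  shows "coeff (root_prod xs) i \<ge> 0"
  using assms
proof (induction xs arbitrary: i)
  case (Cons x xs)
  then have "x * coeff (root_prod xs) i \<le> 0" "coeff (root_prod xs) k \<ge> 0" for k
    by (auto simp: mult_nonpos_nonneg)
  then show ?case
    by (cases i) (auto intro: order_trans)
next
  case Nil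
  then show ?case
    by (cases i) auto
qed

text \<open>Multiplying by \<open>z - x\<close> with \<open>x \<le> 0\<close> only adds nonnegative
  contributions, so no gap can open above a positive coefficient.\<close>

lemma coeff_root_prod_pos:
  assumes "\<forall>x\<in>set xs. x \<le> 0" "coeff (root_prod xs) i > 0" "i \<le> j" "j \<le> length xs"
  shows "coeff (root_prod xs) j > 0"
  using assms
proof (induction xs arbitrary: i j)
  case (Cons x xs)
  have nn: "coeff (root_prod xs) k \<ge> 0" for k
    using Cons.prems(1) by (intro coeff_root_prod_nonneg) auto
  have x: "x \<le> 0"
    using Cons.prems(1) by simp
  have low: "- (x * coeff (root_prod xs) k) \<ge> 0" for k
    using x nn[of k] by (simp add: mult_nonpos_nonneg)
  have IH: "coeff (root_prod xs) k > 0 \<Longrightarrow> k \<le> l \<Longrightarrow> l \<le> length xs \<Longrightarrow> coeff (root_prod xs) l > 0" for k l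
    using Cons.IH Cons.prems(1) by auto
  show ?case
  proof (cases j)
    case 0
    then show ?thesis
      using Cons.prems by simp
  next
    case (Suc j')
    show ?thesis
    proof (cases "\<exists>i'. i = Suc i' \<and> coeff (root_prod xs) i' > 0")
      case True
      then have "coeff (root_prod xs) j' > 0"
        using IH[of "i - 1" j'] Suc Cons.prems by auto
      then show ?thesis
        using Suc low[of j] by simp
    next
      case False
      then have "- (x * coeff (root_prod xs) i) > 0"
        using Cons.prems(2) nn by (cases i) (auto simp: not_less intro: order_antisym)
      then have "x < 0" "coeff (root_prod xs) i > 0"
        using x nn[of i] by (auto simp: mult_less_0_iff)
      then have IHi: "coeff (root_prod xs) j > 0" if "j \<le> length xs"
        using IH[of i j] Cons.prems(3) that by blast
      show ?thesis
      proof (cases "j \<le> length xs")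
        case True
        then have "x * coeff (root_prod xs) j < 0"
          using IHi \<open>x < 0\<close> by (simp add: mult_neg_pos)
        then show ?thesis
          using nn[of j'] Suc by simp
      next
        case False
        then have "j' = length xs"
          using Suc Cons.prems(4) by simp
        then show ?thesis
          using Suc low[of j] by simp
      qed
    qed
  qed
qed auto

lemma top_symb_split:
  obtains xs where "top_symb = smult (q N) (root_prod xs)" "length xs = N" "\<forall>x\<in>set xs. x \<le> 0"
proof -
  have nz: "top_symb \<noteq> 0"
    using coeff_top_symb[of N] M_le_N lead_Q_N by auto
  have "hyperbolic top_symb"
    unfolding hyperbolic_iff_upper
  proof (intro conjI allI impI notI)
    fix z assume "Im z > 0" "cev top_symb z = 0"
    then show False
      using top_symb_zeros[of z] by (auto simp: complex_nonpos_Reals_iff)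
  qed (use nz in auto)
  note split = hyperbolic_eq_root_prod[OF this] length_zero_list[OF this]
  have lc: "lead_coeff top_symb = q N"
    using M_le_N by (simp add: degree_top_symb coeff_top_symb)
  have "x \<le> 0" if "x \<in> set (zero_list top_symb)" for x
  proof -
    have "cev top_symb (of_real x) = 0"
      using that nz by (simp add: set_zero_list cev_of_real)
    then show ?thesis
      using top_symb_zeros by force
  qed
  then show ?thesis
    using that[of "zero_list top_symb"] split degree_top_symb lc by simp
qed

text \<open>Read off from the nonpositive zeros of \<open>top_symb\<close>. Whether the lowest
  coefficients vanish stays open here and is settled by \<open>q_M_pos\<close>.\<close>

lemma q_nonneg: "j \<in> {M..N} \<Longrightarrow> q j \<ge> 0"
  and q_pos_up: "i \<in> {M..N} \<Longrightarrow> q i > 0 \<Longrightarrow> i \<le> j \<Longrightarrow> j \<le> N \<Longrightarrow> q j > 0"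
proof -
  obtain xs where xs: "top_symb = smult (q N) (root_prod xs)" "length xs = N" "\<forall>x\<in>set xs. x \<le> 0"
    by (rule top_symb_split)
  have c: "q N * coeff (root_prod xs) j = q j" if "j \<in> {M..N}" for j
    using arg_cong[OF xs(1), of "\<lambda>p. coeff p j"] that by (simp add: coeff_top_symb)
  show "q j \<ge> 0" if "j \<in> {M..N}"
    using c[OF that] coeff_root_prod_nonneg[OF xs(3), of j] lead_Q_N
    by (metis less_imp_le mult_nonneg_nonneg)
  show "q j > 0" if "i \<in> {M..N}" "q i > 0" "i \<le> j" "j \<le> N"
  proof -
    have "coeff (root_prod xs) i > 0"
      using c[OF that(1)] that(2) lead_Q_N by (metis zero_less_mult_pos)
    then have "coeff (root_prod xs) j > 0"
      using coeff_root_prod_pos[OF xs(3)] that xs(2) by blast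
    moreover have "j \<in> {M..N}"
      using that by simp
    ultimately show ?thesis
      using c[of j] lead_Q_N by (metis mult_pos_pos)
  qed
qed

end

section \<open>Multiplicities\<close>

declare mult_pCons_left [simp del] mult_pCons_right [simp del]

section \<open>Operators \<open>p(D)\<close> with constant coefficients and double zeros\<close>

lemma pderiv_root_prod_Cons:
  "pderiv (root_prod (x # xs)) = root_prod xs + [:- x, 1:] * pderiv (root_prod xs)"
  by (simp add: pderiv_mult pderiv_pCons)

text \<open>The operator \<open>p(D)\<close> applied to \<open>f\<close>, in Horner form.\<close>

definition pd_op :: "real poly \<Rightarrow> real poly \<Rightarrow> real poly" where
  "pd_op p f = fold_coeffs (\<lambda>a g. smult a f + pderiv g) p 0"

lemma pd_op_0 [simp]: "pd_op 0 f = 0"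
  by (simp add: pd_op_def)

lemma pd_op_pCons [simp]: "pd_op (pCons a p) f = smult a f + pderiv (pd_op p f)"
  by (cases "a = 0 \<and> p = 0") (auto simp: pd_op_def fold_coeffs_pCons_not_0_0_eq)

lemma pd_op_add: "pd_op (p + q) f = pd_op p f + pd_op q f"
  by (induction p q rule: poly_induct2) (simp_all add: smult_add_left pderiv_add)

lemma pd_op_smult: "pd_op (smult c p) f = smult c (pd_op p f)"
  by (induction p) (simp_all add: smult_add_right pderiv_smult)

lemma pd_op_mult: "pd_op (p * q) f = pd_op p (pd_op q f)"
  by (induction p) (simp_all add: pd_op_add pd_op_smult mult_pCons_left)

lemma pd_op_pderiv: "pd_op p (pderiv f) = pderiv (pd_op p f)"
  by (induction p) (simp_all add: pderiv_add pderiv_smult)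

lemma pd_op_monom: "pd_op (monom c j) f = smult c ((pderiv ^^ j) f)"
  by (induction j) (simp_all add: monom_0 monom_Suc pderiv_smult)

lemma pd_op_sum: "pd_op (sum p A) f = (\<Sum>i\<in>A. pd_op (p i) f)"
  by (induction A rule: infinite_finite_induct) (simp_all add: pd_op_add)

text \<open>The logarithmic derivative is the sum of the \<open>1 / (z - x)\<close>, each with
  negative imaginary part above the real axis; multiplying by the squared modulus avoids the
  division.\<close>

lemma Im_log_deriv_root_prod:
  assumes "Im z > 0"
  shows "Im (cev (pderiv (root_prod xs)) z * cnj (cev (root_prod xs) z)) \<le> 0"
    and "xs \<noteq> [] \<Longrightarrow> Im (cev (pderiv (root_prod xs)) z * cnj (cev (root_prod xs) z)) < 0"
proof -
  define I where "I ys = Im (cev (pderiv (root_prod ys)) z * cnj (cev (root_prod ys) z))" for ys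
  have step: "I (y # ys) = - (cmod (cev (root_prod ys) z))\<^sup>2 * Im z + (cmod (z - of_real y))\<^sup>2 * I ys" for y ys
  proof -
    have "cev (pderiv (root_prod (y # ys))) z * cnj (cev (root_prod (y # ys)) z)
       = cnj (z - of_real y) * (cev (root_prod ys) z * cnj (cev (root_prod ys) z))
       + ((z - of_real y) * cnj (z - of_real y)) * (cev (pderiv (root_prod ys)) z * cnj (cev (root_prod ys) z))"
      unfolding pderiv_root_prod_Cons by (simp add: algebra_simps)
    moreover have "w * cnj w = of_real ((cmod w)\<^sup>2)" for w
      using complex_norm_square[of w] by (simp add: of_real_power)
    ultimately have "cev (pderiv (root_prod (y # ys))) z * cnj (cev (root_prod (y # ys)) z)
       = cnj (z - of_real y) * of_real ((cmod (cev (root_prod ys) z))\<^sup>2)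
       + of_real ((cmod (z - of_real y))\<^sup>2) * (cev (pderiv (root_prod ys)) z * cnj (cev (root_prod ys) z))"
      by metis
    then show ?thesis
      unfolding I_def by simp
  qed
  have le: "I ys \<le> 0" for ys
  proof (induction ys)
    case (Cons y ys)
    then have "(cmod (z - of_real y))\<^sup>2 * I ys \<le> 0"
      by (simp add: mult_nonneg_nonpos)
    moreover have "(cmod (cev (root_prod ys) z))\<^sup>2 * Im z \<ge> 0"
      using assms by simp
    ultimately show ?case
      by (simp add: step)
  qed (simp add: I_def)
  show "I xs \<le> 0"
    by (rule le)
  show "I xs < 0" if ne: "xs \<noteq> []"
  proof -
    obtain y ys where xs: "xs = y # ys"
      using ne by (cases xs) auto
    have "(cmod (cev (root_prod ys) z))\<^sup>2 * Im z > 0"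
      using assms cev_root_prod_upper by simp
    moreover have "(cmod (z - of_real y))\<^sup>2 * I ys \<le> 0"
      using le by (simp add: mult_nonneg_nonpos)
    ultimately show ?thesis
      unfolding xs step by simp
  qed
qed

text \<open>A zero above the real axis would be a point where the logarithmic derivative of
  \<open>g\<close> equals the real number \<open>a\<close>.\<close>

lemma hyperbolic_pderiv_minus:
  assumes "hyperbolic g" "smult (- a) g + pderiv g \<noteq> 0"
  shows "hyperbolic (smult (- a) g + pderiv g)"
  unfolding hyperbolic_iff_upper
proof (intro conjI allI impI notI)
  fix z assume z: "Im z > 0" and *: "cev (smult (- a) g + pderiv g) z = 0"
  define c xs where "c = lead_coeff g" and "xs = zero_list g"
  have g: "g = smult c (root_prod xs)"
    unfolding c_def xs_def by (rule hyperbolic_eq_root_prod[OF assms(1)])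
  have c: "c \<noteq> 0"
    using assms(1) by (auto simp: c_def hyperbolic_def)
  have eq: "cev (pderiv (root_prod xs)) z = of_real a * cev (root_prod xs) z"
    using * c unfolding g by (simp add: pderiv_smult algebra_simps)
  show False
  proof (cases "xs = []")
    case True
    then have "a = 0"
      using eq by (simp add: pderiv_1 one_pCons[symmetric]) (simp add: one_pCons)
    then show False
      using assms(2) True unfolding g by (simp add: pderiv_smult)
  next
    case False
    have "Im (cev (pderiv (root_prod xs)) z * cnj (cev (root_prod xs) z)) = 0"
      unfolding eq by (simp add: algebra_simps)
    then show False
      using Im_log_deriv_root_prod(2)[OF z False] by simp
  qed
qed (use assms in auto)

text \<open>Laguerre's inequality: \<open>f'^2 - f f''\<close> equals \<open>f^2\<close> times the
  sum of the \<open>1 / (x - x_i)^2\<close>, here in a form that survives at the zeros of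
  \<open>f\<close>.\<close>

lemma laguerre_root_prod:
  fixes xs :: "real list"
  defines "L \<equiv> \<lambda>xs x. (poly (pderiv (root_prod xs)) x)\<^sup>2
      - poly (root_prod xs) x * poly (pderiv (pderiv (root_prod xs))) x"
  shows "L xs x \<ge> 0" and "xs \<noteq> [] \<Longrightarrow> poly (root_prod xs) x \<noteq> 0 \<Longrightarrow> L xs x > 0"
proof -
  have step: "L (y # ys) x = (poly (root_prod ys) x)\<^sup>2 + (x - y)\<^sup>2 * L ys x" for y ys
    unfolding L_def pderiv_root_prod_Cons
    by (simp add: pderiv_mult pderiv_pCons pderiv_add power2_eq_square algebra_simps)
  have nonneg: "L ys x \<ge> 0" for ys
    by (induction ys) (simp_all add: step, simp add: L_def)
  show "L xs x \<ge> 0"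
    by (rule nonneg)
  show "L xs x > 0" if ne: "xs \<noteq> []" and nz: "poly (root_prod xs) x \<noteq> 0"
  proof -
    obtain y ys where xs: "xs = y # ys"
      using ne by (cases xs) auto
    then have "(poly (root_prod ys) x)\<^sup>2 > 0"
      using nz by simp
    then show ?thesis
      unfolding xs step using nonneg[of ys] by (simp add: add_pos_nonneg)
  qed
qed

lemma square_dvd_iff:
  fixes p :: "real poly"
  shows "[:- x, 1:]\<^sup>2 dvd p \<longleftrightarrow> poly p x = 0 \<and> poly (pderiv p) x = 0"
proof
  assume "[:- x, 1:]\<^sup>2 dvd p"
  then obtain r where "p = [:- x, 1:] * ([:- x, 1:] * r)"
    by (auto simp add: dvd_def power2_eq_square mult.assoc)
  then show "poly p x = 0 \<and> poly (pderiv p) x = 0"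
    by (simp add: pderiv_mult)
next
  assume *: "poly p x = 0 \<and> poly (pderiv p) x = 0"
  then obtain r where r: "p = [:- x, 1:] * r"
    by (auto simp: poly_eq_0_iff_dvd dvd_def)
  then have "poly r x = 0"
    using * by (simp add: pderiv_mult pderiv_pCons)
  then obtain s where "r = [:- x, 1:] * s"
    by (auto simp: poly_eq_0_iff_dvd dvd_def)
  then have "p = [:- x, 1:]\<^sup>2 * s"
    using r by (simp add: power2_eq_square mult.assoc)
  then show "[:- x, 1:]\<^sup>2 dvd p"
    by simp
qed

text \<open>At a double zero of \<open>g' - a g\<close> one has \<open>g' = a g\<close> and
  \<open>g'' = a g'\<close>, so the Laguerre expression vanishes. This forces \<open>g = 0\<close>
  at \<open>x\<close>, and then \<open>g' = 0\<close> too.\<close>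

lemma double_zero_pderiv_minus:
  assumes "hyperbolic g" "smult (- a) g + pderiv g \<noteq> 0" "[:- x, 1:]\<^sup>2 dvd smult (- a) g + pderiv g"
  shows "[:- x, 1:]\<^sup>2 dvd g"
proof -
  have e: "poly (pderiv g) x = a * poly g x" "poly (pderiv (pderiv g)) x = a * poly (pderiv g) x"
    using assms(3) by (auto simp: square_dvd_iff pderiv_diff pderiv_smult)
  have "poly g x = 0"
  proof (rule ccontr)
    assume gx: "poly g x \<noteq> 0"
    define c xs where "c = lead_coeff g" and "xs = zero_list g"
    have g: "g = smult c (root_prod xs)"
      unfolding c_def xs_def by (rule hyperbolic_eq_root_prod[OF assms(1)])
    have c: "c \<noteq> 0"
      using gx unfolding g by auto
    show False
    proof (cases "xs = []")
      case True
      then show False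
        using e(1) gx assms(2) unfolding g by (simp add: pderiv_smult)
    next
      case False
      have "poly (root_prod xs) x \<noteq> 0"
        using gx unfolding g by simp
      moreover have "(poly (pderiv (root_prod xs)) x)\<^sup>2 - poly (root_prod xs) x * poly (pderiv (pderiv (root_prod xs))) x = 0"
      proof -
        have "poly (pderiv (root_prod xs)) x = a * poly (root_prod xs) x"
          "poly (pderiv (pderiv (root_prod xs))) x = a * poly (pderiv (root_prod xs)) x"
          using e c unfolding g by (simp_all add: pderiv_smult)
        then show ?thesis
          by (simp add: power2_eq_square)
      qed
      ultimately show False
        using laguerre_root_prod(2)[OF False, of x] by simp
    qed
  qed
  then show ?thesis
    using e(1) by (simp add: square_dvd_iff)
qed

lemma double_zero_pd_op:
  assumes "hyperbolic p" "hyperbolic f" "pd_op p f \<noteq> 0" "[:- x, 1:]\<^sup>2 dvd pd_op p f"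
  shows "[:- x, 1:]\<^sup>2 dvd f"
proof -
  define c xs where "c = lead_coeff p" and "xs = zero_list p"
  have p: "p = smult c (root_prod xs)"
    unfolding c_def xs_def by (rule hyperbolic_eq_root_prod[OF assms(1)])
  have c: "c \<noteq> 0"
    using assms(1) by (auto simp: c_def hyperbolic_def)
  have step: "pd_op (root_prod (y # ys)) f
      = smult (- y) (pd_op (root_prod ys) f) + pderiv (pd_op (root_prod ys) f)" for y ys
    by (simp add: pd_op_mult)
  have hyp: "pd_op (root_prod ys) f \<noteq> 0 \<Longrightarrow> hyperbolic (pd_op (root_prod ys) f)" for ys
  proof (induction ys)
    case Nil
    show ?case
      using assms(2) by (simp add: one_pCons)
  next
    case (Cons y ys)
    then have "pd_op (root_prod ys) f \<noteq> 0"
      unfolding step by auto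
    then show ?case
      using Cons hyperbolic_pderiv_minus[of "pd_op (root_prod ys) f" y] unfolding step by blast
  qed
  have "pd_op (root_prod ys) f \<noteq> 0 \<Longrightarrow> [:- x, 1:]\<^sup>2 dvd pd_op (root_prod ys) f \<Longrightarrow> [:- x, 1:]\<^sup>2 dvd f" for ys
  proof (induction ys)
    case Nil
    then show ?case
      by (simp add: one_pCons)
  next
    case (Cons y ys)
    then have "pd_op (root_prod ys) f \<noteq> 0"
      unfolding step by auto
    then show ?case
      using Cons double_zero_pderiv_minus[of "pd_op (root_prod ys) f" y x] hyp[of ys]
      unfolding step by blast
  qed
  then show ?thesis
    using assms(3,4) c unfolding p pd_op_smult by (simp add: dvd_smult_iff)
qed

text \<open>The derivative of a product is the sum of the products with one factor left out. In the
  induction \<open>u\<close> collects the factors already passed.\<close>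

lemma functional_pderiv_root_prod:
  fixes \<phi> :: "real poly \<Rightarrow> real"
  assumes "\<And>p q. \<phi> (p + q) = \<phi> p + \<phi> q" "\<phi> 0 = 0"
    and "\<And>as y bs. xs = as @ y # bs \<Longrightarrow> \<phi> (u * root_prod (as @ bs)) = 0"
  shows "\<phi> (u * pderiv (root_prod xs)) = 0"
  using assms(3)
proof (induction xs arbitrary: u)
  case Nil
  then show ?case
    by (simp add: assms(2) pderiv_1)
next
  case (Cons x xs)
  have "\<phi> (u * [:- x, 1:] * pderiv (root_prod xs)) = 0"
  proof (rule Cons.IH)
    fix as y bs assume "xs = as @ y # bs"
    then show "\<phi> (u * [:- x, 1:] * root_prod (as @ bs)) = 0"
      using Cons.prems[of "x # as" y bs] by (simp add: mult.assoc)
  qed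
  moreover have "\<phi> (u * root_prod xs) = 0"
    using Cons.prems[of "[]" x xs] by simp
  moreover have "u * pderiv (root_prod (x # xs)) = u * [:- x, 1:] * pderiv (root_prod xs) + u * root_prod xs"
    unfolding pderiv_root_prod_Cons by (simp add: algebra_simps)
  ultimately show ?case
    by (simp only: assms(1))
qed

section \<open>Multiplicities of the zeros of \<open>T f\<close>\<close>

context preserver
begin

text \<open>Combinations of \<open>(z - a) h\<close> and \<open>h\<close> are a linear or constant
  factor times \<open>h\<close>, hence hyperbolic.\<close>

lemma hyperbolic_pencil_T_factor:
  assumes "hyperbolic h" "lam (degree h + 1) \<noteq> 0" "T h \<noteq> 0"
  shows "hyperbolic_pencil (T ([:- a, 1:] * h)) (T h)"
proof (rule hyperbolic_pencil_T)
  fix \<alpha> \<beta> :: real assume ab: "\<alpha> \<noteq> 0 \<or> \<beta> \<noteq> 0"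
  have eq: "smult \<alpha> ([:- a, 1:] * h) + smult \<beta> h = [:\<beta> - \<alpha> * a, \<alpha>:] * h"
    by (simp add: mult_pCons_left smult_diff_left smult_diff_right)
  have h0: "h \<noteq> 0"
    using assms(1) by (simp add: hyperbolic_def)
  have "T ([:\<beta> - \<alpha> * a, \<alpha>:] * h) \<noteq> 0"
  proof (cases "\<alpha> = 0")
    case True
    then have "T ([:\<beta> - \<alpha> * a, \<alpha>:] * h) = smult \<beta> (T h)"
      by (simp add: mult_pCons_left diff_op_smult)
    then show ?thesis
      using True ab assms(3) by simp
  next
    case False
    then have "degree ([:\<beta> - \<alpha> * a, \<alpha>:] * h) = degree h + 1"
      using h0 by (simp add: degree_mult_eq)
    then show ?thesis
      using assms(2) False h0 by (intro T_neq_0) auto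
  qed
  then show "hyperbolic (smult \<alpha> ([:- a, 1:] * h) + smult \<beta> h) \<and> T (smult \<alpha> ([:- a, 1:] * h) + smult \<beta> h) \<noteq> 0"
    unfolding eq using ab assms(1) by auto
qed

text \<open>Removing one zero of the argument costs at most one order at \<open>x\<close>; if
  \<open>T h = 0\<close>, divisibility is trivial.\<close>

lemma T_power_dvd_drop:
  assumes "hyperbolic h" "lam (degree h + 1) \<noteq> 0" "[:- x, 1:] ^ Suc k dvd T ([:- a, 1:] * h)"
  shows "[:- x, 1:] ^ k dvd T h"
  using hyperbolic_pencil_power_dvd[OF hyperbolic_pencil_T_factor[OF assms(1,2)] assms(3)]
  by (cases "T h = 0") auto

lemma T_factor_shift: "T ([:- b, 1:] * h) = T ([:- a, 1:] * h) + smult (a - b) (T h)"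
proof -
  have "[:- b, 1:] * h = [:- a, 1:] * h + smult (a - b) h"
    by (simp add: mult_pCons_left smult_diff_left)
  then show ?thesis
    by (simp only: diff_op_linear)
qed

lemma T_power_dvd_replace:
  assumes "hyperbolic h" "lam (degree h + 1) \<noteq> 0" "[:- x, 1:] ^ Suc k dvd T ([:- a, 1:] * h)"
  shows "[:- x, 1:] ^ k dvd T ([:- b, 1:] * h)"
  unfolding T_factor_shift[of b h a]
  using T_power_dvd_drop[OF assms] assms(3) by (intro dvd_add dvd_smult) (auto intro: power_le_dvd)

text \<open>If \<open>q M\<close> vanished, then just below the first degree where \<open>T\<close> raises the degree, the
  degrees of \<open>T h\<close> and \<open>T (X * h)\<close> would differ by two, so \<open>T h = 0\<close>; descending, \<open>T (X ^ M) = 0\<close>.\<close>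

lemma q_M_pos: "q M > 0"
proof (rule ccontr)
  assume "\<not> q M > 0"
  then have qM: "q M = 0"
    using q_nonneg[of M] M_le_N by simp
  define l where "l = (LEAST j. j \<in> {M..N} \<and> q j \<noteq> 0)"
  have "N \<in> {M..N} \<and> q N \<noteq> 0"
    using M_le_N lead_Q_N by auto
  from LeastI[of "\<lambda>j. j \<in> {M..N} \<and> q j \<noteq> 0", OF this]
  have l: "l \<in> {M..N}" "q l \<noteq> 0"
    by (auto simp: l_def)
  have below: "q j = 0" if "j \<in> {M..N}" "j < l" for j
    using not_less_Least[of j "\<lambda>j. j \<in> {M..N} \<and> q j \<noteq> 0"] that by (auto simp: l_def)
  have "lam d = (if d = l then q l * falling l l else 0)" if "d \<le> l" for d
  proof -
    have "lam d = (\<Sum>k=M..N. if k = l then q l * falling d l else 0)"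
      unfolding lam_def
    proof (intro sum.cong refl)
      fix k assume k: "k \<in> {M..N}"
      show "q k * falling d k = (if k = l then q l * falling d l else 0)"
        using below[OF k] that by (cases "k < l") (auto simp: falling_eq_0)
    qed
    then show ?thesis
      using l that by (auto simp: falling_eq_0)
  qed
  then have lam_l: "lam l \<noteq> 0" and lam_below: "\<And>d. d < l \<Longrightarrow> lam d = 0"
    using l falling_pos[of l l] by auto
  have Ml: "M < l"
    using l qM by (cases "l = M") auto
  have top: "T h = 0" if h: "hyperbolic h" "degree h = l - 1" for h
  proof (rule ccontr)
    assume Th: "T h \<noteq> 0"
    have d: "degree h + 1 = l" and h0: "h \<noteq> 0"
      using h Ml by (auto simp: hyperbolic_def)
    then have "hyperbolic_pencil (T ([:- 0, 1:] * h)) (T h)"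
      using h lam_l Th by (intro hyperbolic_pencil_T_factor) auto
    then have le: "degree (T ([:- 0, 1:] * h)) \<le> degree (T h) + 1"
      by (rule hyperbolic_pencil_degree)
    have deg: "degree ([:- 0, 1:] * h) = l"
      using d h0 by (simp add: degree_mult_eq)
    then have "degree (T ([:- 0, 1:] * h)) = l + 1"
      using lam_l h0 degree_T_eq[of "[:- 0, 1:] * h"] by auto
    moreover have "degree (T h) \<le> l" "coeff (T h) l = 0"
      using degree_T[of h "l - 1"] coeff_T[of h "l - 1"] h Ml lam_below[of "l - 1"] by auto
    then have "degree (T h) < l"
      using Th by (metis leading_coeff_0_iff order_le_less)
    ultimately show False
      using le by simp
  qed
  have "\<forall>h. hyperbolic h \<longrightarrow> degree h = M \<longrightarrow> T h = 0"
  proof (rule inc_induct[where i = M and j = "l - 1" and P = "\<lambda>m. \<forall>h. hyperbolic h \<longrightarrow> degree h = m \<longrightarrow> T h = 0"])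
    fix m assume IH: "\<forall>h. hyperbolic h \<longrightarrow> degree h = Suc m \<longrightarrow> T h = 0"
    show "\<forall>h. hyperbolic h \<longrightarrow> degree h = m \<longrightarrow> T h = 0"
    proof (intro allI impI)
      fix h assume h: "hyperbolic h" "degree h = m"
      then have h0: "h \<noteq> 0"
        by (auto simp: hyperbolic_def)
      have zero: "T ([:- b, 1:] * h) = 0" for b
        using IH h h0 by (simp add: degree_mult_eq)
      \<comment> \<open>The images of \<open>z h\<close> and \<open>(z - 1) h\<close> both vanish
        and differ by \<open>T h\<close>.\<close>
      then show "T h = 0"
        using T_factor_shift[of 0 h 1] zero[of 0] zero[of 1] by simp
    qed
  qed (use Ml top in auto)
  then have "T (root_prod (replicate M 0)) = 0"
    by simp
  moreover have "root_prod (replicate M 0) = [:0, 1:] ^ M"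
    by (simp add: root_prod_def)
  \<comment> \<open>On \<open>z^M\<close> only the lowest term acts, giving \<open>M!\<close> times
    \<open>Q M\<close>, which is nonzero.\<close>
  moreover have "T ([:0, 1:] ^ M) = (\<Sum>k=M..N. if k = M then smult (falling M M) (Q M) else 0)"
    unfolding diff_op_def
    by (intro sum.cong) (auto simp: higher_pderiv_linear_power falling_eq_0 mult_pCons_right)
  ultimately show False
    using Q_M M_le_N falling_pos[of M M] by simp
qed

lemma q_pos: "k \<in> {M..N} \<Longrightarrow> q k > 0"
  using q_pos_up[of M k] q_M_pos M_le_N by simp

lemma lam_eq_0: "d < M \<Longrightarrow> lam d = 0"
  unfolding lam_def by (intro sum.neutral) (auto simp: falling_eq_0)

lemma lam_pos:
  assumes "M \<le> d"
  shows "lam d > 0"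
  unfolding lam_def
proof (rule sum_pos2[of _ M])
  show "0 < q M * falling d M"
    using q_M_pos falling_pos[OF assms] by simp
  show "0 \<le> q k * falling d k" if "k \<in> {M..N}" for k
    using q_nonneg[OF that] falling_nonneg[of d k] by simp
qed (use M_le_N in auto)

lemma lam_nonneg: "lam d \<ge> 0"
  using lam_eq_0[of d] lam_pos[of d] by (cases "d < M") auto

lemma lam_strict_mono:
  assumes "N \<ge> 1" "k < l" "M \<le> l"
  shows "lam k < lam l"
  unfolding lam_def
proof (rule sum_strict_mono_ex1)
  show "\<forall>j\<in>{M..N}. q j * falling k j \<le> q j * falling l j"
    using q_nonneg assms by (auto intro!: mult_left_mono falling_mono)
  \<comment> \<open>\<open>falling d 0\<close> is constant in \<open>d\<close>, so the strict growth
    must come from an index that is at least 1.\<close>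
  show "\<exists>j\<in>{M..N}. q j * falling k j < q j * falling l j"
    using assms M_le_N q_pos[of "max M 1"]
    by (intro bexI[of _ "max M 1"] mult_strict_left_mono falling_strict_mono) auto
qed simp

text \<open>The bound \<open>k \<le> d\<close> reflects that \<open>D^k\<close> kills degree
  \<open>d\<close> for \<open>k > d\<close>: at a point that is not regular, \<open>T\<close> of
  every polynomial of degree at most \<open>d\<close> vanishes.\<close>

definition regular_at :: "nat \<Rightarrow> real \<Rightarrow> bool" where
  "regular_at d x \<longleftrightarrow> (\<exists>k\<in>{M..N}. k \<le> d \<and> poly (Q k) x \<noteq> 0)"

lemma regular_at_mono: "regular_at d x \<Longrightarrow> d \<le> e \<Longrightarrow> regular_at e x"
  unfolding regular_at_def using le_trans by blast

lemma regular_at_ge: "regular_at d x \<Longrightarrow> M \<le> d"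
  unfolding regular_at_def by auto

lemma pd_op_symb: "pd_op (symb x) f = (\<Sum>j=M..N. smult (poly (Q j) x) ((pderiv ^^ j) f))"
  by (simp add: symb_def pd_op_sum pd_op_monom)

lemma poly_pd_op_symb: "poly (pd_op (symb x) f) x = poly (T f) x"
  by (simp add: pd_op_symb diff_op_def poly_sum)

text \<open>The first \<open>k\<close> with \<open>Q k\<close> nonzero at \<open>x\<close> alone
  contributes to the coefficient in degree \<open>degree f - k\<close>.\<close>

lemma pd_op_symb_neq_0:
  assumes "regular_at (degree f) x" "f \<noteq> 0"
  shows "pd_op (symb x) f \<noteq> 0"
proof -
  let ?d = "degree f"
  define k where "k = (LEAST k. k \<in> {M..N} \<and> k \<le> ?d \<and> poly (Q k) x \<noteq> 0)"
  obtain k' where "k' \<in> {M..N} \<and> k' \<le> ?d \<and> poly (Q k') x \<noteq> 0"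
    using assms(1) unfolding regular_at_def by blast
  from LeastI[of "\<lambda>k. k \<in> {M..N} \<and> k \<le> ?d \<and> poly (Q k) x \<noteq> 0", OF this]
  have k: "k \<in> {M..N}" "k \<le> ?d" "poly (Q k) x \<noteq> 0"
    by (auto simp: k_def)
  have below: "poly (Q j) x = 0" if "j \<in> {M..N}" "j < k" for j
    using not_less_Least[of j "\<lambda>k. k \<in> {M..N} \<and> k \<le> ?d \<and> poly (Q k) x \<noteq> 0"] that k(2)
    by (auto simp: k_def)
  have "coeff (pd_op (symb x) f) (?d - k)
      = (\<Sum>j=M..N. poly (Q j) x * coeff ((pderiv ^^ j) f) (?d - k))"
    by (simp add: pd_op_symb coeff_sum)
  also have "\<dots> = (\<Sum>j=M..N. if j = k then poly (Q k) x * (falling ?d k * lead_coeff f) else 0)"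
  proof (intro sum.cong refl)
    fix j assume j: "j \<in> {M..N}"
    consider "j < k" | "j = k" | "j > k"
      by linarith
    then show "poly (Q j) x * coeff ((pderiv ^^ j) f) (?d - k)
        = (if j = k then poly (Q k) x * (falling ?d k * lead_coeff f) else 0)"
    proof cases
      case 3
      then show ?thesis
        using k(2) by (simp add: coeff_higher_pderiv coeff_eq_0)
    qed (use below[OF j] k(2) in \<open>auto simp: coeff_higher_pderiv_top\<close>)
  qed
  also have "\<dots> = poly (Q k) x * (falling ?d k * lead_coeff f)"
    using k(1) by simp
  also have "\<dots> \<noteq> 0"
    using k falling_pos[of k ?d] assms(2) by simp
  finally show ?thesis
    by auto
qed

lemma T_double_zero:
  assumes f: "hyperbolic f" and reg: "regular_at (degree f) x" and dvd: "[:- x, 1:]\<^sup>2 dvd T f"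
  shows "[:- x, 1:]\<^sup>2 dvd f"
proof -
  define c xs where "c = lead_coeff f" and "xs = zero_list f"
  have f_eq: "f = smult c (root_prod xs)"
    unfolding c_def xs_def by (rule hyperbolic_eq_root_prod[OF f])
  have f0: "f \<noteq> 0" and c: "c \<noteq> 0"
    using f by (auto simp: hyperbolic_def c_def)
  have deg: "degree f = length xs"
    using c by (simp add: f_eq)
  define p where "p = root_prod xs"
  have p: "[:- x, 1:]\<^sup>2 dvd T p"
    using dvd c by (simp add: f_eq p_def diff_op_smult dvd_smult_iff)
  have "poly (T (1 * pderiv (root_prod xs))) x = 0"
  proof (rule functional_pderiv_root_prod)
    fix as y bs assume xs: "xs = as @ y # bs"
    have "[:- x, 1:] ^ 1 dvd T (root_prod (as @ bs))"
    proof (rule T_power_dvd_drop)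
      have "root_prod xs = [:- y, 1:] * root_prod (as @ bs)"
        by (simp add: xs mult_ac)
      then show "[:- x, 1:] ^ Suc 1 dvd T ([:- y, 1:] * root_prod (as @ bs))"
        using p by (simp add: p_def power2_eq_square)
      show "lam (degree (root_prod (as @ bs)) + 1) \<noteq> 0"
        using lam_pos[OF regular_at_ge[OF reg]] unfolding deg xs degree_root_prod by simp
    qed simp
    then show "poly (T (1 * root_prod (as @ bs))) x = 0"
      by (simp add: poly_eq_0_iff_dvd)
  qed (simp_all add: diff_op_add)
  then have "poly (pderiv (pd_op (symb x) p)) x = 0"
    by (simp add: p_def poly_pd_op_symb flip: pd_op_pderiv)
  moreover have "poly (pd_op (symb x) p) x = 0"
    using p by (simp add: poly_pd_op_symb square_dvd_iff)
  ultimately have "[:- x, 1:]\<^sup>2 dvd pd_op (symb x) p"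
    by (simp add: square_dvd_iff)
  moreover have "pd_op (symb x) p \<noteq> 0"
    using reg deg by (intro pd_op_symb_neq_0) (auto simp: p_def)
  moreover have "hyperbolic (symb x)"
  proof (rule hyperbolic_symb)
    show "symb x \<noteq> 0"
      using \<open>pd_op (symb x) p \<noteq> 0\<close> by auto
  qed
  ultimately have "[:- x, 1:]\<^sup>2 dvd p"
    using double_zero_pd_op[of "symb x" p x] by (simp add: p_def)
  then show ?thesis
    unfolding f_eq p_def by (rule dvd_smult)
qed

text \<open>If \<open>x\<close> had order \<open>m\<close> in \<open>f\<close>, it would have order
  at least \<open>m + 1\<close> in \<open>T f\<close>. Moving \<open>m - 1\<close> copies of
  \<open>x\<close> away, here to \<open>x + 1\<close>, costs one order each, so a double zero of the
  image would remain over a simple zero of the argument, against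
  \<open>T_double_zero\<close>.\<close>

lemma T_eigen_zero:
  assumes f: "hyperbolic f" and reg: "regular_at (degree f) x"
    and eig: "T f = smult c ([:- x, 1:] * f)"
  shows "poly f x \<noteq> 0"
proof
  assume fx: "poly f x = 0"
  have f0: "f \<noteq> 0"
    using f by (simp add: hyperbolic_def)
  define m where "m = order x f"
  obtain h where h: "f = [:- x, 1:] ^ m * h" "\<not> [:- x, 1:] dvd h"
    using order_decomp[OF f0] unfolding m_def by blast
  have m: "m \<ge> 1"
    using fx f0 by (simp add: m_def order_root Suc_le_eq)
  have h0: "h \<noteq> 0"
    using h(2) by auto
  have hh: "hyperbolic h"
    using f unfolding h(1) by simp
  have deg: "degree f = m + degree h"
    using h0 unfolding h(1) by (simp add: degree_mult_eq degree_power_eq)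
  have "i \<le> m - 1 \<Longrightarrow>
    [:- x, 1:] ^ (m + 1 - i) dvd T ([:- x, 1:] ^ (m - i) * ([:- (x + 1), 1:] ^ i * h))" for i
  proof (induction i)
    case 0
    have "T f = smult c ([:- x, 1:] ^ (m + 1) * h)"
      unfolding eig by (subst h(1)) (simp add: mult.assoc)
    then show ?case
      by (simp add: h(1) dvd_smult)
  next
    case (Suc i)
    define g where "g = [:- x, 1:] ^ (m - Suc i) * ([:- (x + 1), 1:] ^ i * h)"
    have e1: "[:- x, 1:] ^ (m - i) * ([:- (x + 1), 1:] ^ i * h) = [:- x, 1:] * g"
      using Suc.prems by (simp add: g_def Suc_diff_Suc flip: power_Suc mult.assoc)
    have e2: "[:- x, 1:] ^ (m - Suc i) * ([:- (x + 1), 1:] ^ Suc i * h) = [:- (x + 1), 1:] * g"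
      by (simp add: g_def mult_ac)
    have e3: "m + 1 - i = Suc (m + 1 - Suc i)"
      using Suc.prems by simp
    have g0: "g \<noteq> 0"
      using h0 by (auto simp: g_def)
    have "degree g + 1 = degree f"
      unfolding deg using Suc.prems h0
      by (simp add: g_def degree_mult_eq degree_power_eq)
    then have lam_g: "lam (degree g + 1) \<noteq> 0"
      using lam_pos[OF regular_at_ge[OF reg]] by simp
    have "hyperbolic g"
      using hh by (simp add: g_def hyperbolic_power)
    moreover note lam_g
    moreover have "[:- x, 1:] ^ Suc (m + 1 - Suc i) dvd T ([:- x, 1:] * g)"
      using Suc.IH Suc.prems unfolding e1 e3 by simp
    ultimately show ?case
      unfolding e2 by (rule T_power_dvd_replace)
  qed
  from this[of "m - 1"] have dvd: "[:- x, 1:]\<^sup>2 dvd T ([:- x, 1:] * ([:- (x + 1), 1:] ^ (m - 1) * h))"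
    using m by (simp add: numeral_2_eq_2)
  have "degree ([:- x, 1:] * ([:- (x + 1), 1:] ^ (m - 1) * h)) = degree f"
    using m h0 unfolding deg by (simp add: degree_mult_eq degree_power_eq)
  moreover have "hyperbolic ([:- x, 1:] * ([:- (x + 1), 1:] ^ (m - 1) * h))"
    using hh by (simp add: hyperbolic_power)
  ultimately have "[:- x, 1:]\<^sup>2 dvd [:- x, 1:] * ([:- (x + 1), 1:] ^ (m - 1) * h)"
    using reg by (intro T_double_zero[OF _ _ dvd]) auto
  then have "[:- x, 1:] dvd [:- (x + 1), 1:] ^ (m - 1) * h"
    unfolding power2_eq_square by (subst (asm) dvd_mult_cancel_left) simp
  then show False
    using h(2) by (simp add: poly_eq_0_iff_dvd[symmetric])
qed

text \<open>Were \<open>x\<close> a common zero, then, \<open>x\<close> being simple for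
  \<open>T f\<close>, some shift of \<open>a\<close> would produce a double zero of the image,
  although \<open>(z - a) f\<close> has at most a simple zero at \<open>x\<close> for every
  \<open>a\<close>.\<close>

lemma T_factor_zero:
  assumes f: "hyperbolic f" and reg: "regular_at (degree f) x"
    and fx: "poly f x \<noteq> 0" and Tf: "poly (T f) x = 0"
  shows "poly (T ([:- a, 1:] * f)) x \<noteq> 0"
proof
  assume 0: "poly (T ([:- a, 1:] * f)) x = 0"
  have f0: "f \<noteq> 0"
    using f by (simp add: hyperbolic_def)
  have "poly (pderiv (T f)) x \<noteq> 0"
    using T_double_zero[OF f reg] fx Tf by (auto simp: square_dvd_iff)
  \<comment> \<open>Chosen so that the derivative at \<open>x\<close> of the shifted image
    vanishes.\<close>
  define t where "t = poly (pderiv (T ([:- a, 1:] * f))) x / poly (pderiv (T f)) x"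
  have "T ([:- (a + t), 1:] * f) = T ([:- a, 1:] * f) + smult (- t) (T f)"
    using T_factor_shift[of "a + t" f a] by simp
  then have dvd: "[:- x, 1:]\<^sup>2 dvd T ([:- (a + t), 1:] * f)"
    using 0 Tf \<open>poly (pderiv (T f)) x \<noteq> 0\<close>
    by (simp add: square_dvd_iff pderiv_diff pderiv_smult t_def)
  have "regular_at (degree ([:- (a + t), 1:] * f)) x"
    using reg f0 by (auto simp: degree_mult_eq intro: regular_at_mono)
  then have "[:- x, 1:]\<^sup>2 dvd [:- (a + t), 1:] * f"
    using f by (intro T_double_zero[OF _ _ dvd]) auto
  then show False
    using fx by (auto simp: square_dvd_iff pderiv_mult pderiv_pCons)
qed

end

section \<open>Zeros of the image as a monotone map\<close>

abbreviation list_le :: "real list \<Rightarrow> real list \<Rightarrow> bool"  (infix "\<preceq>" 50) where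
  "xs \<preceq> ys \<equiv> list_all2 (\<le>) xs ys"

lemma list_le_trans: "xs \<preceq> ys \<Longrightarrow> ys \<preceq> zs \<Longrightarrow> xs \<preceq> zs"
  by (rule list_all2_trans[of "(\<le>)" "(\<le>)" "(\<le>)"]) auto

lemma list_le_antisym: "xs \<preceq> ys \<Longrightarrow> ys \<preceq> xs \<Longrightarrow> xs = ys"
  by (rule list_all2_antisym[of "(\<le>)" "(\<le>)"]) auto

lemma list_le_refl [simp]: "xs \<preceq> xs"
  by (simp add: list_all2_refl)

lemma list_le_iff: "xs \<preceq> ys \<longleftrightarrow> length xs = length ys \<and> (\<forall>i<length xs. xs ! i \<le> ys ! i)"
  by (simp add: list_all2_conv_all_nth)

lemma list_fixed_point:
  assumes mono: "\<And>xs ys. length xs = n \<Longrightarrow> xs \<preceq> ys \<Longrightarrow> F xs \<preceq> F ys"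
    and n: "length lo = n" and lohi: "lo \<preceq> hi" and lo: "lo \<preceq> F lo" and hi: "F hi \<preceq> hi"
  obtains xs where "F xs = xs" "lo \<preceq> xs" "xs \<preceq> hi"
proof -
  \<comment> \<open>Tarski's construction: the greatest fixed point is the entrywise supremum of the
    lists that \<open>F\<close> raises, so continuity does not enter.\<close>
  define S where "S = {xs. lo \<preceq> xs \<and> xs \<preceq> hi \<and> xs \<preceq> F xs}"
  have loS: "lo \<in> S"
    using lohi lo by (simp add: S_def)
  have len: "length xs = n" if "xs \<in> S" for xs
    using that n by (auto simp: S_def list_le_iff)
  define s where "s = map (\<lambda>i. SUP xs\<in>S. xs ! i) [0..<n]"
  have bdd: "bdd_above ((\<lambda>xs. xs ! i) ` S)" if "i < n" for i
    using that n by (intro bdd_aboveI[of _ "hi ! i"]) (auto simp: S_def list_le_iff)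
  have upper: "xs \<preceq> s" if "xs \<in> S" for xs
    using len[OF that] that bdd by (auto simp: list_le_iff s_def intro!: cSUP_upper)
  have least: "s \<preceq> ys" if "\<And>xs. xs \<in> S \<Longrightarrow> xs \<preceq> ys" for ys
    using that[OF loS] that loS n unfolding list_le_iff s_def by (auto intro!: cSUP_least)
  have s_lo: "lo \<preceq> s" and s_hi: "s \<preceq> hi"
    using upper[OF loS] least[of hi] by (auto simp: S_def)
  have s_len: "length s = n"
    by (simp add: s_def)
  have sFs: "s \<preceq> F s"
  proof (rule least)
    fix xs assume xs: "xs \<in> S"
    then have "xs \<preceq> F xs"
      by (simp add: S_def)
    also have "F xs \<preceq> F s"
      using mono len upper xs by blast
    finally show "xs \<preceq> F s"
      using list_le_trans \<open>xs \<preceq> F xs\<close> \<open>F xs \<preceq> F s\<close> by blast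
  qed
  have "F s \<in> S"
    unfolding S_def using mono[OF s_len sFs] list_le_trans[OF lo mono[OF n s_lo]]
      list_le_trans[OF mono[OF s_len s_hi] hi] by simp
  then have "F s = s"
    using upper sFs list_le_antisym by blast
  then show thesis
    using that s_lo s_hi by blast
qed

definition drop_nth :: "nat \<Rightarrow> 'a list \<Rightarrow> 'a list" where
  "drop_nth j xs = take j xs @ drop (Suc j) xs"

lemma length_drop_nth [simp]: "j < length xs \<Longrightarrow> length (drop_nth j xs) = length xs - 1"
  by (simp add: drop_nth_def)

lemma nth_drop_nth:
  assumes "j < length xs" "i < length xs - 1"
  shows "drop_nth j xs ! i = (if i < j then xs ! i else xs ! Suc i)"
  using assms by (auto simp: drop_nth_def nth_append min_def)

lemma root_prod_drop_nth:
  assumes "j < length xs"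
  shows "root_prod xs = [:- (xs ! j), 1:] * root_prod (drop_nth j xs)"
  by (subst (1) id_take_nth_drop[OF assms]) (simp add: drop_nth_def mult_ac)

lemma sum_list_drop_nth:
  fixes xs :: "real list"
  assumes "j < length xs"
  shows "sum_list xs = xs ! j + sum_list (drop_nth j xs)"
  by (subst (1) id_take_nth_drop[OF assms]) (simp add: drop_nth_def)

lemma drop_nth_mono:
  assumes "xs \<preceq> ys" "j < length xs"
  shows "drop_nth j xs \<preceq> drop_nth j ys"
  using assms by (auto simp: list_le_iff nth_drop_nth)

lemma sorted_drop_nth: "sorted xs \<Longrightarrow> sorted (drop_nth j xs)"
proof (cases "j < length xs")
  case True
  assume "sorted xs"
  then show ?thesis
    using True unfolding sorted_iff_nth_mono by (auto simp: nth_drop_nth)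
qed (simp add: drop_nth_def)

context preserver
begin

definition Z :: "real list \<Rightarrow> real list" where
  "Z xs = zero_list (T (root_prod xs))"

lemma sorted_Z [simp]: "sorted (Z xs)"
  by (simp add: Z_def)

lemma hyperbolic_T_root_prod:
  assumes "M \<le> length xs"
  shows "hyperbolic (T (root_prod xs))"
  using lam_pos[OF assms] by (intro hyperbolic_T T_neq_0) auto

lemma degree_T_root_prod:
  assumes "M \<le> length xs"
  shows "degree (T (root_prod xs)) = length xs + 1"
  using lam_pos[OF assms] degree_T_eq[of "root_prod xs"] by simp

lemma length_Z [simp]: "M \<le> length xs \<Longrightarrow> length (Z xs) = length xs + 1"
  by (simp add: Z_def length_zero_list hyperbolic_T_root_prod degree_T_root_prod)

lemma T_root_prod:
  assumes "M \<le> length xs"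
  shows "T (root_prod xs) = smult (lam (length xs)) (root_prod (Z xs))"
proof -
  have "lead_coeff (T (root_prod xs)) = lam (length xs)"
    using degree_T_root_prod[OF assms] coeff_T[of "root_prod xs" "length xs"] by simp
  then show ?thesis
    using hyperbolic_eq_root_prod[OF hyperbolic_T_root_prod[OF assms]] by (simp add: Z_def)
qed

lemma set_Z:
  assumes "M \<le> length xs"
  shows "set (Z xs) = {x. poly (T (root_prod xs)) x = 0}"
  using hyperbolic_T_root_prod[OF assms] by (simp add: Z_def set_zero_list hyperbolic_def)

text \<open>In the difference of the two products the top terms cancel, so \<open>T\<close> acts on
  its next coefficient through \<open>lam m\<close> alone, and that coefficient is a difference of
  sums of zeros.\<close>

lemma sum_list_Z_diff:
  assumes "length xs = Suc m" "length ys = Suc m" "M \<le> Suc m"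
  shows "lam (Suc m) * (sum_list (Z xs) - sum_list (Z ys)) = lam m * (sum_list xs - sum_list ys)"
proof -
  have sub: "coeff (root_prod zs) k = - sum_list zs" if "length zs = Suc k" for zs k
  proof -
    have "zs \<noteq> []"
      using that by auto
    then show ?thesis
      using coeff_root_prod_subleading[of zs] that by simp
  qed
  define D where "D = root_prod xs - root_prod ys"
  have "degree D \<le> m"
  proof (rule degree_le, intro allI impI)
    fix i assume "m < i"
    then consider "i = Suc m" | "i > Suc m"
      by linarith
    then show "coeff D i = 0"
    proof cases
      case 1
      then show ?thesis
        using coeff_root_prod_length[of xs] coeff_root_prod_length[of ys] assms
        by (simp add: D_def del: coeff_root_prod_length)
    next
      case 2
      then show ?thesis
        using assms by (simp add: D_def coeff_eq_0)
    qed
  qed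
  then have "coeff (T D) (m + 1) = lam m * coeff D m"
    by (rule coeff_T)
  moreover have "coeff D m = sum_list ys - sum_list xs"
    using assms by (simp add: D_def sub)
  moreover have "coeff (T D) (m + 1) = lam (Suc m) * (sum_list (Z ys) - sum_list (Z xs))"
    using assms by (simp add: D_def diff_op_diff T_root_prod sub algebra_simps)
  ultimately show ?thesis
    by (simp add: algebra_simps)
qed

text \<open>Two products that differ in one zero span multiples of the common part by linear or
  constant factors. The images form a pencil, and the sum identity with \<open>lam\<close>
  nonnegative decides the direction.\<close>

lemma Z_replace_mono:
  assumes "a \<le> b" "M \<le> Suc (length xs)"
  shows "Z (a # xs) \<preceq> Z (b # xs)"
\<comment> \<open>Equal images would make the pencil degenerate; this happens for
  \<open>a = b\<close> or when \<open>T\<close> kills \<open>root_prod xs\<close>.\<close>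
proof (cases "T (root_prod (a # xs)) = T (root_prod (b # xs))")
  case True
  then show ?thesis
    by (simp add: Z_def list_all2_refl)
next
  case False
  have lam: "lam (Suc (length xs)) > 0"
    using assms(2) by (rule lam_pos)
  have eq: "smult \<alpha> (root_prod (a # xs)) + smult \<beta> (root_prod (b # xs))
      = [:- (\<alpha> * a + \<beta> * b), \<alpha> + \<beta>:] * root_prod xs" for \<alpha> \<beta>
    unfolding root_prod_Cons mult_pCons_left by (simp add: smult_add_left smult_diff_right smult_diff_left algebra_simps)
  have ab: "a \<noteq> b"
    using False by auto
  have "hyperbolic_pencil (T (root_prod (a # xs))) (T (root_prod (b # xs)))"
  proof (rule hyperbolic_pencil_T, rule conjI)
    fix \<alpha> \<beta> :: real assume nz: "\<alpha> \<noteq> 0 \<or> \<beta> \<noteq> 0"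
    have "\<alpha> + \<beta> \<noteq> 0 \<or> \<alpha> * a + \<beta> * b \<noteq> 0"
    proof (rule ccontr)
      assume "\<not> ?thesis"
      then have 1: "\<alpha> + \<beta> = 0" and 2: "\<alpha> * a + \<beta> * b = 0"
        by auto
      have "\<beta> = - \<alpha>"
        using 1 by linarith
      then have "\<alpha> * (a - b) = 0"
        using 2 by (simp add: algebra_simps)
      then show False
        using nz ab \<open>\<beta> = - \<alpha>\<close> by auto
    qed
    then show "hyperbolic (smult \<alpha> (root_prod (a # xs)) + smult \<beta> (root_prod (b # xs)))"
      unfolding eq by auto
    show "T (smult \<alpha> (root_prod (a # xs)) + smult \<beta> (root_prod (b # xs))) \<noteq> 0"
    proof (cases "\<alpha> + \<beta> = 0")
      case True
      then have "\<beta> = - \<alpha>"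
        by simp
      then have "T (smult \<alpha> (root_prod (a # xs)) + smult \<beta> (root_prod (b # xs)))
          = smult \<alpha> (T (root_prod (a # xs)) - T (root_prod (b # xs)))"
        by (simp add: diff_op_linear smult_diff_right)
      then show ?thesis
        using False nz \<open>\<beta> = - \<alpha>\<close> by auto
    next
      case nz': False
      then have "degree ([:- (\<alpha> * a + \<beta> * b), \<alpha> + \<beta>:] * root_prod xs) = Suc (length xs)"
        by (simp add: degree_mult_eq)
      then show ?thesis
        unfolding eq using lam nz' by (intro T_neq_0) auto
    qed
  qed
  moreover have "degree (T (root_prod (a # xs))) = degree (T (root_prod (b # xs)))"
    using assms(2) degree_T_root_prod[of "a # xs"] degree_T_root_prod[of "b # xs"] by simp
  moreover have "sum_list (Z (a # xs)) \<le> sum_list (Z (b # xs))"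
  proof -
    have "lam (Suc (length xs)) * (sum_list (Z (b # xs)) - sum_list (Z (a # xs)))
        = lam (length xs) * (b - a)"
      using sum_list_Z_diff[of "b # xs" "length xs" "a # xs"] assms(2) by simp
    also have "\<dots> \<ge> 0"
      using lam_nonneg assms(1) by simp
    finally show ?thesis
      using lam by (simp add: zero_le_mult_iff)
  qed
  ultimately show ?thesis
    unfolding Z_def by (rule hyperbolic_pencil_mono)
qed

lemma Z_cong: "mset xs = mset ys \<Longrightarrow> Z xs = Z ys"
  unfolding Z_def using root_prod_cong by metis

text \<open>One entry is raised at a time. \<open>Z\<close> depends only on the multiset, so treated
  entries can be parked in \<open>ws\<close> and the arguments need no sorting.\<close>

lemma Z_mono:
  assumes "xs \<preceq> ys" "M \<le> length xs"
  shows "Z xs \<preceq> Z ys"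
proof -
  have "M \<le> length xs + length ws \<Longrightarrow> Z (xs @ ws) \<preceq> Z (ys @ ws)" for ws
    using assms(1)
  proof (induction arbitrary: ws rule: list_all2_induct)
    case (Cons x xs y ys)
    have "Z (x # xs @ ws) \<preceq> Z (y # xs @ ws)"
      using Cons by (intro Z_replace_mono) auto
    also have "Z (y # xs @ ws) = Z (xs @ y # ws)" "Z (y # ys @ ws) = Z (ys @ y # ws)"
      by (auto intro: Z_cong)
    moreover have "Z (xs @ y # ws) \<preceq> Z (ys @ y # ws)"
      using Cons by simp
    ultimately show ?case
      using list_le_trans by simp
  qed simp
  from this[of "[]"] show ?thesis
    using assms(2) by simp
qed

lemma Z_interlace:
  assumes "M \<le> length xs" "i \<le> length xs"
  shows "Z (a # xs) ! i \<le> Z xs ! i" "Z xs ! i \<le> Z (a # xs) ! Suc i"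
proof -
  have "T (root_prod xs) \<noteq> 0"
    using hyperbolic_T_root_prod[OF assms(1)] by (simp add: hyperbolic_def)
  moreover have "lam (degree (root_prod xs) + 1) \<noteq> 0"
    using lam_pos[of "Suc (length xs)"] assms(1) by simp
  ultimately have "hyperbolic_pencil (T ([:- a, 1:] * root_prod xs)) (T (root_prod xs))"
    by (intro hyperbolic_pencil_T_factor) simp_all
  then have pencil: "hyperbolic_pencil (T (root_prod (a # xs))) (T (root_prod xs))"
    by simp
  have deg: "degree (T (root_prod (a # xs))) = degree (T (root_prod xs)) + 1"
    using degree_T_root_prod[of xs] degree_T_root_prod[of "a # xs"] assms by simp
  have "i < length (zero_list (T (root_prod xs)))"
    using assms length_Z[of xs] by (simp add: Z_def)
  from hyperbolic_pencil_interlace[OF pencil deg this]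
  show "Z (a # xs) ! i \<le> Z xs ! i" "Z xs ! i \<le> Z (a # xs) ! Suc i"
    by (simp_all add: Z_def)
qed

section \<open>Boxes invariant under \<open>Z\<close>\<close>

lemma Q_eventually_pos:
  assumes \<sigma>: "\<sigma> = 1 \<or> \<sigma> = -1"
  shows "\<exists>R0. \<forall>y\<ge>R0. \<forall>j\<in>{M..N}. \<sigma> ^ Suc j * poly (Q j) (\<sigma> * y) > 0"
proof -
  have "\<exists>R. \<forall>y\<ge>R. \<sigma> ^ Suc j * poly (Q j) (\<sigma> * y) > 0" if j: "j \<in> {M..N}" for j
  proof -
    define p where "p = smult (\<sigma> ^ Suc j) (pcompose (Q j) [:0, \<sigma>:])"
    have deg: "degree (Q j) = Suc j"
      using degree_Q[OF j] q_pos[OF j] by (intro antisym le_degree) auto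
    have "lead_coeff p = \<sigma> ^ Suc j * (q j * \<sigma> ^ Suc j)"
      using \<sigma> lead_coeff_comp[of "[:0, \<sigma>:]" "Q j"] by (auto simp: p_def deg)
    also have "\<dots> = q j"
      using \<sigma> by (auto simp: power_mult_distrib[symmetric])
    finally have lc: "lead_coeff p > 0"
      using q_pos[OF j] by simp
    obtain R where "\<And>y. y \<ge> R \<Longrightarrow> poly p y \<ge> lead_coeff p"
      using poly_pinfty_gt_lc[OF lc] by blast
    then have "poly p y > 0" if "y \<ge> R" for y
      using that lc by (meson less_le_trans)
    then show ?thesis
      by (intro exI[of _ R]) (simp add: p_def poly_pcompose mult.commute)
  qed
  then obtain R where R: "\<And>j y. j \<in> {M..N} \<Longrightarrow> y \<ge> R j \<Longrightarrow> \<sigma> ^ Suc j * poly (Q j) (\<sigma> * y) > 0"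
    by metis
  show ?thesis
  proof (intro exI allI impI ballI)
    fix y j assume y: "Max (R ` {M..N}) \<le> y" and j: "j \<in> {M..N}"
    then have "R j \<le> y"
      by (meson Max_ge finite_atLeastAtMost finite_imageI imageI order_trans)
    then show "\<sigma> ^ Suc j * poly (Q j) (\<sigma> * y) > 0"
      using R j by blast
  qed
qed

lemma root_prod_replicate: "root_prod (replicate d a) = [:- a, 1:] ^ d"
  by (simp add: root_prod_def)

text \<open>Beyond \<open>R\<close>, far out, every summand of \<open>T ((z - \<sigma> R)^d)\<close>
  has the sign \<open>\<sigma>^(d+1)\<close> or vanishes, and the one for \<open>M\<close> is
  nonzero. The sign \<open>\<sigma>\<close> treats both ends of the line at once.\<close>

lemma Z_replicate_bound:
  assumes \<sigma>: "\<sigma> = 1 \<or> \<sigma> = -1" and d: "M \<le> d"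
  shows "\<exists>R0. \<forall>R\<ge>R0. \<forall>z\<in>set (Z (replicate d (\<sigma> * R))). \<sigma> * z \<le> R"
proof -
  obtain R0 where R0: "\<And>y j. y \<ge> R0 \<Longrightarrow> j \<in> {M..N} \<Longrightarrow> \<sigma> ^ Suc j * poly (Q j) (\<sigma> * y) > 0"
    using Q_eventually_pos[OF \<sigma>] by blast
  have nz: "poly (T ([:- (\<sigma> * R), 1:] ^ d)) (\<sigma> * y) \<noteq> 0" if "R \<ge> R0" "y > R" for R y
  proof -
    have summand: "\<sigma> ^ Suc d * (poly (Q j) (\<sigma> * y) * (falling d j * (\<sigma> * y - \<sigma> * R) ^ (d - j)))
        = (\<sigma> ^ Suc j * poly (Q j) (\<sigma> * y)) * (falling d j * (y - R) ^ (d - j))" if "j \<in> {M..N}" for j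
    proof (cases "j \<le> d")
      case True
      have "\<sigma> ^ Suc d * (\<sigma> * y - \<sigma> * R) ^ (d - j) = (\<sigma> ^ Suc j * \<sigma> ^ (d - j)) * (\<sigma> ^ (d - j) * (y - R) ^ (d - j))"
        using True by (simp flip: power_add right_diff_distrib power_mult_distrib)
      also have "\<dots> = \<sigma> ^ Suc j * (y - R) ^ (d - j)"
        using \<sigma> by (auto simp flip: power_mult_distrib)
      finally have e: "\<sigma> ^ Suc d * (\<sigma> * y - \<sigma> * R) ^ (d - j) = \<sigma> ^ Suc j * (y - R) ^ (d - j)" .
      have "\<sigma> ^ Suc d * (poly (Q j) (\<sigma> * y) * (falling d j * (\<sigma> * y - \<sigma> * R) ^ (d - j)))
          = poly (Q j) (\<sigma> * y) * (falling d j * (\<sigma> ^ Suc d * (\<sigma> * y - \<sigma> * R) ^ (d - j)))"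
        by (simp only: mult_ac)
      then show ?thesis
        unfolding e by (simp only: mult_ac)
    qed (simp add: falling_eq_0)
    have "poly [:- (\<sigma> * R), 1:] (\<sigma> * y) = \<sigma> * y - \<sigma> * R"
      by simp
    then have "poly (Q j * (pderiv ^^ j) ([:- (\<sigma> * R), 1:] ^ d)) (\<sigma> * y)
        = poly (Q j) (\<sigma> * y) * (falling d j * (\<sigma> * y - \<sigma> * R) ^ (d - j))" for j
      unfolding higher_pderiv_linear_power poly_mult poly_smult poly_power by simp
    then have "\<sigma> ^ Suc d * poly (T ([:- (\<sigma> * R), 1:] ^ d)) (\<sigma> * y)
        = (\<Sum>j=M..N. (\<sigma> ^ Suc j * poly (Q j) (\<sigma> * y)) * (falling d j * (y - R) ^ (d - j)))"
      unfolding diff_op_def poly_sum sum_distrib_left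
      by (intro sum.cong refl) (simp only: summand)
    also have "\<dots> > 0"
    proof (rule sum_pos2[of _ M])
      show "0 < (\<sigma> ^ Suc M * poly (Q M) (\<sigma> * y)) * (falling d M * (y - R) ^ (d - M))"
        using that M_le_N falling_pos[OF d] by (intro mult_pos_pos[OF R0 mult_pos_pos]) auto
      show "0 \<le> (\<sigma> ^ Suc j * poly (Q j) (\<sigma> * y)) * (falling d j * (y - R) ^ (d - j))" if "j \<in> {M..N}" for j
        using that \<open>R \<ge> R0\<close> \<open>y > R\<close> falling_nonneg[of d j]
        by (intro mult_nonneg_nonneg[OF less_imp_le[OF R0] mult_nonneg_nonneg]) auto
    qed (use M_le_N in auto)
    finally show ?thesis
      by auto
  qed
  show ?thesis
  proof (intro exI allI impI ballI)
    fix R z assume R: "R0 \<le> R" and z: "z \<in> set (Z (replicate d (\<sigma> * R)))"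
    then have "poly (T ([:- (\<sigma> * R), 1:] ^ d)) z = 0"
      using d set_Z[of "replicate d (\<sigma> * R)"] by (simp add: root_prod_replicate)
    moreover have sz: "\<sigma> * (\<sigma> * z) = z"
      using \<sigma> by auto
    ultimately have "\<not> R < \<sigma> * z"
      using nz[OF R, of "\<sigma> * z"] unfolding sz by blast
    then show "\<sigma> * z \<le> R"
      by simp
  qed
qed

text \<open>By monotonicity of \<open>Z\<close>, bounds at the two constant lists control the whole
  box; those lists are the sub- and supersolution for every index.\<close>

definition confines :: "nat \<Rightarrow> real \<Rightarrow> bool" where
  "confines d R \<longleftrightarrow> R \<ge> 0 \<and> (\<forall>z\<in>set (Z (replicate d R)). z \<le> R) \<and> (\<forall>z\<in>set (Z (replicate d (- R))). - R \<le> z)"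

lemma ex_confines:
  assumes "M \<le> d"
  shows "\<exists>R\<ge>B. confines d R"
proof -
  obtain R1 where R1: "\<forall>R\<ge>R1. \<forall>z\<in>set (Z (replicate d (1 * R))). 1 * z \<le> R"
    using Z_replicate_bound[of 1 d] assms by blast
  obtain R2 where R2: "\<forall>R\<ge>R2. \<forall>z\<in>set (Z (replicate d (- 1 * R))). - 1 * z \<le> R"
    using Z_replicate_bound[of "-1" d] assms by blast
  define R where "R = max (max R1 R2) (max 0 B)"
  have "R \<ge> R1" "R \<ge> R2" "R \<ge> 0" "R \<ge> B"
    by (auto simp: R_def)
  moreover from this have "z \<le> R" if "z \<in> set (Z (replicate d R))" for z
    using R1 that by simp
  moreover have "- R \<le> z" if "z \<in> set (Z (replicate d (- R)))" for z
    using R2[rule_format, OF \<open>R \<ge> R2\<close>, of z] that by simp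
  ultimately show ?thesis
    unfolding confines_def by blast
qed

lemma confines_Z_le:
  assumes "confines d R" "M \<le> d" "xs \<preceq> replicate d R" "z \<in> set (Z xs)"
  shows "z \<le> R"
proof -
  have "length xs = d"
    using assms(3) by (simp add: list_le_iff)
  then have "Z xs \<preceq> Z (replicate d R)"
    using assms by (intro Z_mono) auto
  moreover obtain i where "i < length (Z xs)" "z = Z xs ! i"
    using assms(4) by (metis in_set_conv_nth)
  ultimately have "z \<le> Z (replicate d R) ! i" "i < length (Z (replicate d R))"
    by (auto simp: list_le_iff)
  then show ?thesis
    using assms(1) unfolding confines_def by (meson nth_mem order_trans)
qed

lemma confines_Z_ge:
  assumes "confines d R" "M \<le> d" "replicate d (- R) \<preceq> xs" "z \<in> set (Z xs)"
  shows "- R \<le> z"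
proof -
  have len: "length xs = d"
    using assms(3) by (simp add: list_le_iff)
  then have "Z (replicate d (- R)) \<preceq> Z xs"
    using assms by (intro Z_mono) auto
  moreover obtain i where "i < length (Z xs)" "z = Z xs ! i"
    using assms(4) by (metis in_set_conv_nth)
  ultimately have "Z (replicate d (- R)) ! i \<le> z" "i < length (Z (replicate d (- R)))"
    by (auto simp: list_le_iff)
  then show ?thesis
    using assms(1) unfolding confines_def by (meson nth_mem order_trans)
qed

end

section \<open>Van Vleck zeros as fixed points\<close>

lemma set_drop_nth_subset: "set (drop_nth j xs) \<subseteq> set xs"
  unfolding drop_nth_def using set_take_subset set_drop_subset by fastforce

lemma diff_op_sum: "diff_op M N Q (sum f A) = (\<Sum>a\<in>A. diff_op M N Q (f a))"
  by (induction A rule: infinite_finite_induct) (auto simp: diff_op_add)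

lemma sorted_splice_interlacing:
  assumes "length as = Suc (length bs)"
    and "\<And>i. i < length bs \<Longrightarrow> as ! i \<le> bs ! i \<and> bs ! i \<le> as ! Suc i"
  shows "sorted (splice as bs)"
  using assms
proof (induction bs arbitrary: as)
  case Nil
  then show ?case
    by (cases as) auto
next
  case (Cons b bs)
  then obtain a a' as' where as: "as = a # a' # as'"
    by (metis length_Suc_conv)
  have ab: "a \<le> b \<and> b \<le> a'"
    using Cons.prems(2)[of 0] as by simp
  have "sorted (splice (a' # as') bs)"
  proof (rule Cons.IH)
    fix i assume "i < length bs"
    then show "(a' # as') ! i \<le> bs ! i \<and> bs ! i \<le> (a' # as') ! Suc i"
      using Cons.prems(2)[of "Suc i"] as by simp
  qed (use Cons.prems(1) as in simp)
  then show ?case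
    using ab as by auto
qed

context preserver
begin

definition fixed :: "nat \<Rightarrow> real list \<Rightarrow> bool" where
  "fixed j xs \<longleftrightarrow> drop_nth j (Z xs) = xs"

definition regular :: "nat \<Rightarrow> bool" where
  "regular d \<longleftrightarrow> (\<forall>x. regular_at d x)"

lemma regular_imp_M_le: "regular d \<Longrightarrow> M \<le> d"
  unfolding regular_def using regular_at_ge by blast

text \<open>For \<open>N = 0\<close> the operator is multiplication by the linear
  \<open>Q 0\<close>, whose zero violates regularity. The case must go because \<open>lam\<close>
  would be constant.\<close>

lemma regular_imp_N_pos:
  assumes "regular d"
  shows "1 \<le> N"
proof (rule ccontr)
  assume "\<not> 1 \<le> N"
  then have N: "N = 0" "M = 0"
    using M_le_N by auto
  then have "degree (Q 0) \<le> 1" "coeff (Q 0) 1 \<noteq> 0"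
    using degree_Q[of 0] lead_Q_N by auto
  then have "Q 0 = [:coeff (Q 0) 0, coeff (Q 0) 1:]"
    by (intro poly_eqI) (auto simp: coeff_pCons coeff_eq_0 split: nat.split)
  then have "poly (Q 0) (- coeff (Q 0) 0 / coeff (Q 0) 1) = 0"
    using \<open>coeff (Q 0) 1 \<noteq> 0\<close> by (metis (no_types) add.commute add.right_inverse mult.commute mult_zero_right
        nonzero_divide_eq_eq poly_0 poly_pCons add_0_right)
  moreover obtain k where "k \<in> {M..N}" "poly (Q k) (- coeff (Q 0) 0 / coeff (Q 0) 1) \<noteq> 0"
    using assms unfolding regular_def regular_at_def by blast
  moreover from this have "k = 0"
    using N by simp
  ultimately show False
    by simp
qed

lemma fixed_sorted: "fixed j xs \<Longrightarrow> sorted xs"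
  unfolding fixed_def by (metis sorted_Z sorted_drop_nth)

lemma fixed_nth:
  assumes "fixed j xs" "M \<le> length xs" "j \<le> length xs" "i < length xs"
  shows "xs ! i = (if i < j then Z xs ! i else Z xs ! Suc i)"
  using nth_drop_nth[of j "Z xs" i] assms by (simp add: fixed_def)

lemma fixed_eigen:
  assumes "fixed j xs" "M \<le> length xs" "j \<le> length xs"
  shows "T (root_prod xs) = smult (lam (length xs)) ([:- (Z xs ! j), 1:] * root_prod xs)"
  using T_root_prod[OF assms(2)] root_prod_drop_nth[of j "Z xs"] assms by (simp add: fixed_def)

text \<open>An instance of \<open>T_eigen_zero\<close>; every strict inequality between Van Vleck
  zeros goes back to it.\<close>

lemma fixed_notin:
  assumes "fixed j xs" "regular (length xs)" "j \<le> length xs"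
  shows "Z xs ! j \<notin> set xs"
proof -
  have "poly (root_prod xs) (Z xs ! j) \<noteq> 0"
    using assms regular_imp_M_le[OF assms(2)]
    by (intro T_eigen_zero[OF _ _ fixed_eigen]) (auto simp: regular_def)
  then show ?thesis
    by (simp add: poly_root_prod_0_iff)
qed

lemma ex_fixed_between:
  assumes "M \<le> length lo" "j \<le> length lo" "lo \<preceq> hi" "lo \<preceq> drop_nth j (Z lo)" "drop_nth j (Z hi) \<preceq> hi"
  shows "\<exists>xs. fixed j xs \<and> lo \<preceq> xs \<and> xs \<preceq> hi"
proof -
  obtain xs where "drop_nth j (Z xs) = xs" "lo \<preceq> xs" "xs \<preceq> hi"
  proof (rule list_fixed_point[of "length lo" "\<lambda>xs. drop_nth j (Z xs)" lo hi])
    fix xs ys assume "length xs = length lo" "xs \<preceq> ys"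
    then show "drop_nth j (Z xs) \<preceq> drop_nth j (Z ys)"
      using assms(1,2) by (intro drop_nth_mono Z_mono) auto
  qed (use assms in auto)
  then show ?thesis
    unfolding fixed_def by blast
qed

lemma confines_lower:
  assumes "confines d R" "M \<le> d" "j \<le> d"
  shows "replicate d (- R) \<preceq> drop_nth j (Z (replicate d (- R)))"
  unfolding list_le_iff
proof (intro conjI allI impI)
  show len: "length (replicate d (- R)) = length (drop_nth j (Z (replicate d (- R))))"
    using assms by simp
  fix i assume i: "i < length (replicate d (- R))"
  then have "drop_nth j (Z (replicate d (- R))) ! i \<in> set (drop_nth j (Z (replicate d (- R))))"
    unfolding len by (rule nth_mem)
  then have "drop_nth j (Z (replicate d (- R))) ! i \<in> set (Z (replicate d (- R)))"
    by (rule subsetD[OF set_drop_nth_subset])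
  then show "replicate d (- R) ! i \<le> drop_nth j (Z (replicate d (- R))) ! i"
    using assms(1) i by (simp add: confines_def)
qed

lemma confines_upper:
  assumes "confines d R" "M \<le> d" "j \<le> d"
  shows "drop_nth j (Z (replicate d R)) \<preceq> replicate d R"
  unfolding list_le_iff
proof (intro conjI allI impI)
  show len: "length (drop_nth j (Z (replicate d R))) = length (replicate d R)"
    using assms by simp
  fix i assume i: "i < length (drop_nth j (Z (replicate d R)))"
  then have "drop_nth j (Z (replicate d R)) ! i \<in> set (Z (replicate d R))"
    by (rule subsetD[OF set_drop_nth_subset nth_mem])
  then show "drop_nth j (Z (replicate d R)) ! i \<le> replicate d R ! i"
    using assms(1) i len by (simp add: confines_def)
qed

lemma ex_fixed_next:
  assumes reg: "regular n" and confines: "confines n R" and x: "length x = n" "fixed j x" "j < n"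
    and lo: "replicate n (- R) \<preceq> x"
  shows "\<exists>y. replicate n (- R) \<preceq> y \<and> fixed (Suc j) y \<and> Z x ! j < Z y ! Suc j"
proof -
  have M: "M \<le> n"
    using reg by (rule regular_imp_M_le)
  \<comment> \<open>The two deletions differ only in entry \<open>j\<close>, which falls from
    \<open>Z x ! Suc j\<close> to \<open>Z x ! j\<close>.\<close>
  have "drop_nth (Suc j) (Z x) \<preceq> x"
    unfolding list_le_iff
  proof (intro conjI allI impI)
    fix i assume "i < length (drop_nth (Suc j) (Z x))"
    then have i: "i < n"
      using x M by simp
    have "Z x ! j \<le> Z x ! Suc j"
      using x M by (intro sorted_nth_mono) auto
    then show "drop_nth (Suc j) (Z x) ! i \<le> x ! i"
      using fixed_nth[OF x(2), of i] nth_drop_nth[of "Suc j" "Z x" i] x M i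
      by (cases "i = j") auto
  qed (use x M in simp)
  then obtain y where y: "fixed (Suc j) y" "replicate n (- R) \<preceq> y" "y \<preceq> x"
    using ex_fixed_between[of "replicate n (- R)" "Suc j" x] confines_lower[OF confines M, of "Suc j"] lo M x(3)
    by auto
  have ylen: "length y = n"
    using y(3) x(1) by (simp add: list_le_iff)
  obtain m where m: "n = Suc m"
    using x(3) by (cases n) auto
  have lam: "lam m < lam n"
    using lam_strict_mono[of m n] regular_imp_N_pos[OF reg] M m by simp
  have "lam n * (sum_list (Z x) - sum_list (Z y)) = lam m * (sum_list x - sum_list y)"
    using sum_list_Z_diff[of x m y] x ylen M m by simp
  moreover have "sum_list (Z x) = Z x ! j + sum_list x"
    using sum_list_drop_nth[of j "Z x"] x M by (simp add: fixed_def)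
  moreover have "sum_list (Z y) = Z y ! Suc j + sum_list y"
    using sum_list_drop_nth[of "Suc j" "Z y"] x ylen y(1) M by (simp add: fixed_def)
  \<comment> \<open>The deleted zero is the sum of \<open>Z x\<close> minus the sum of
    \<open>x\<close>, and likewise for \<open>y\<close>; eliminating the sums of \<open>Z\<close>
    leaves the factor \<open>lam n - lam m > 0\<close>.\<close>
  ultimately have key: "lam n * (Z y ! Suc j - Z x ! j) = (lam n - lam m) * (sum_list x - sum_list y)"
    by (simp add: algebra_simps)
  have le: "sum_list y \<le> sum_list x"
    using y(3) by (rule sum_list_mono_list_all2)
  \<comment> \<open>Equal sums give \<open>y = x\<close>, so entries \<open>j\<close> and
    \<open>Suc j\<close> of \<open>Z x\<close> agree, and the deleted zero would still be an entry
    of \<open>x\<close>.\<close>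
  have "sum_list x \<noteq> sum_list y"
  proof
    assume "sum_list x = sum_list y"
    then have yx: "y = x"
      using list_all2_le_sum_list_eq[OF y(3)] by simp
    then have "Z x ! Suc j = Z x ! j"
      using key lam_pos[OF M] by simp
    then have "x ! j = Z x ! j"
      using fixed_nth[OF x(2), of j] x M by simp
    then show False
      using fixed_notin[OF x(2)] x reg by (metis nth_mem less_imp_le)
  qed
  then have "lam n * (Z y ! Suc j - Z x ! j) > 0"
    unfolding key using le lam by (intro mult_pos_pos) auto
  then have "Z x ! j < Z y ! Suc j"
    using lam_pos[OF M] by (simp add: zero_less_mult_iff)
  then show ?thesis
    using y by blast
qed

lemma ex_fixed_chain:
  assumes reg: "regular n"
  shows "\<exists>X. (\<forall>j\<le>n. length (X j) = n \<and> fixed j (X j)) \<and> (\<forall>j<n. Z (X j) ! j < Z (X (Suc j)) ! Suc j)"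
proof -
  have M: "M \<le> n"
    using reg by (rule regular_imp_M_le)
  obtain R where R: "confines n R"
    using ex_confines[OF M] by blast
  \<comment> \<open>The guards make the requirements void beyond \<open>n\<close>, as the choice
    principle builds an infinite sequence.\<close>
  let ?P = "\<lambda>j x. j \<le> n \<longrightarrow> replicate n (- R) \<preceq> x \<and> fixed j x"
  let ?Q = "\<lambda>j x y. j < n \<longrightarrow> Z x ! j < Z y ! Suc j"
  have "\<exists>X. \<forall>j. ?P j (X j) \<and> ?Q j (X j) (X (Suc j))"
  proof (rule dependent_nat_choice)
    have "replicate n (- R) \<preceq> replicate n R"
      using R by (simp add: list_le_iff confines_def)
    then show "\<exists>x. ?P 0 x"
      using ex_fixed_between[of "replicate n (- R)" 0 "replicate n R"]
        confines_lower[OF R M, of 0] confines_upper[OF R M, of 0] M by auto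
  next
    fix x j assume P: "?P j x"
    show "\<exists>y. ?P (Suc j) y \<and> ?Q j x y"
    proof (cases "j < n")
      case True
      then have "length x = n"
        using P by (auto simp: list_le_iff)
      then show ?thesis
        using ex_fixed_next[OF reg R, of x j] P True by auto
    qed auto
  qed
  then obtain X where X: "\<And>j. ?P j (X j)" "\<And>j. ?Q j (X j) (X (Suc j))"
    by blast
  have "length (X j) = n" if "j \<le> n" for j
    using X(1)[of j] that by (auto simp: list_le_iff)
  then show ?thesis
    using X by blast
qed

text \<open>The map sending \<open>f\<close> to \<open>T f - l (z - a) f\<close> kills
  \<open>f a\<close> and multiplies \<open>f b\<close> by \<open>l (a - b)\<close>, as in the usual
  argument for eigenvectors.\<close>

lemma eigenvectors_independent:
  assumes "finite A" "l \<noteq> 0"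
    and "\<And>a. a \<in> A \<Longrightarrow> f a \<noteq> 0 \<and> T (f a) = smult l ([:- a, 1:] * f a)"
    and "(\<Sum>a\<in>A. smult (c a) (f a)) = 0"
  shows "\<forall>a\<in>A. c a = 0"
  using assms(1,3,4)
proof (induction A arbitrary: c rule: finite_induct)
  case (insert a A)
  let ?S = "\<Sum>b\<in>insert a A. smult (c b) (f b)"
  have "0 = T ?S - smult l ([:- a, 1:] * ?S)"
    by (simp only: insert.prems(2)) simp
  also have "\<dots> = (\<Sum>b\<in>insert a A. smult (c b) (T (f b)) - smult l ([:- a, 1:] * smult (c b) (f b)))"
    by (simp only: diff_op_sum diff_op_smult sum_distrib_left smult_sum_right sum_subtractf)
  also have "\<dots> = (\<Sum>b\<in>insert a A. smult (c b * (l * (a - b))) (f b))"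
  proof (intro sum.cong refl)
    fix b assume "b \<in> insert a A"
    then have e: "T (f b) = smult l ([:- b, 1:] * f b)"
      using insert.prems(1) by blast
    have "[:- b, 1:] * f b = [:- a, 1:] * f b + smult (a - b) (f b)"
      by (simp add: mult_pCons_left smult_diff_left)
    then show "smult (c b) (T (f b)) - smult l ([:- a, 1:] * smult (c b) (f b)) = smult (c b * (l * (a - b))) (f b)"
      by (simp only: e smult_add_right smult_smult mult_smult_right) (simp add: mult_ac)
  qed
  also have "\<dots> = (\<Sum>b\<in>A. smult (c b * (l * (a - b))) (f b))"
    using insert.hyps by simp
  finally have "\<forall>b\<in>A. c b * (l * (a - b)) = 0"
    using insert.IH[of "\<lambda>b. c b * (l * (a - b))"] insert.prems(1) by simp
  then have c0: "\<forall>b\<in>A. c b = 0"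
    using insert.hyps(2) assms(2) by auto
  then have "smult (c a) (f a) = 0"
    using insert.prems(2) insert.hyps by simp
  then show ?case
    using c0 insert.prems(1) by auto
qed simp

lemma card_eigenvalues_le:
  assumes A: "finite A" and l: "l \<noteq> 0"
    and f: "\<And>a. a \<in> A \<Longrightarrow> f a \<noteq> 0 \<and> degree (f a) \<le> n \<and> T (f a) = smult l ([:- a, 1:] * f a)"
  shows "card A \<le> n + 1"
proof -
  interpret vs: vector_space "smult :: real \<Rightarrow> real poly \<Rightarrow> real poly"
    by unfold_locales (simp_all add: smult_add_right smult_add_left)
  have inj: "inj_on f A"
  proof (rule inj_onI)
    fix a b assume ab: "a \<in> A" "b \<in> A" "f a = f b"
    then have "smult l ([:- a, 1:] * f a) = smult l ([:- b, 1:] * f a)"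
      using f by metis
    then have "[:- a, 1:] * f a = [:- b, 1:] * f a"
      using l by (metis smult_smult left_inverse smult_1_left)
    then show "a = b"
      using f[OF ab(1)] by simp
  qed
  have "vs.independent (f ` A)"
  proof (rule vs.independent_if_scalars_zero)
    fix c x assume c: "(\<Sum>x\<in>f ` A. smult (c x) x) = 0" and x: "x \<in> f ` A"
    have "(\<Sum>a\<in>A. smult (c (f a)) (f a)) = 0"
      using c by (simp add: sum.reindex[OF inj])
    then have "\<forall>a\<in>A. c (f a) = 0"
      using eigenvectors_independent[OF A l, of f "\<lambda>a. c (f a)"] f by blast
    then show "c x = 0"
      using x by auto
  qed (use A in simp)
  moreover have "f ` A \<subseteq> vs.span (monom 1 ` {..n})"
  proof
    fix p assume "p \<in> f ` A"
    then have "degree p \<le> n"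
      using f by auto
    then have "p = (\<Sum>i\<le>n. smult (coeff p i) (monom 1 i))"
      using poly_as_sum_of_monoms'[of p n] by (simp add: smult_monom)
    also have "\<dots> \<in> vs.span (monom 1 ` {..n})"
      by (intro vs.span_sum vs.span_scale vs.span_base) auto
    finally show "p \<in> vs.span (monom 1 ` {..n})" .
  qed
  ultimately have "card (f ` A) \<le> card ((\<lambda>i. monom (1::real) i) ` {..n})"
    by (intro conjunct2[OF vs.independent_span_bound]) auto
  also have "\<dots> \<le> n + 1"
    using card_image_le[of "{..n}" "\<lambda>i. monom (1::real) i"] by simp
  finally show ?thesis
    using card_image[OF inj] by simp
qed

text \<open>A nonzero difference has some degree \<open>k < n\<close>; its coefficient in degree
  \<open>k + 1\<close> after applying \<open>T\<close> would give
  \<open>lam k = lam n\<close>.\<close>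

lemma eigenvector_unique:
  assumes N: "1 \<le> N" and n: "M \<le> n"
    and f: "degree f = n" "lead_coeff f = 1" "T f = smult (lam n) ([:- a, 1:] * f)"
    and g: "degree g = n" "lead_coeff g = 1" "T g = smult (lam n) ([:- a, 1:] * g)"
  shows "f = g"
proof (rule ccontr)
  assume "f \<noteq> g"
  define h where "h = f - g"
  define k where "k = degree h"
  have h0: "h \<noteq> 0"
    using \<open>f \<noteq> g\<close> by (simp add: h_def)
  have "k \<le> n"
    unfolding k_def h_def using f g by (intro degree_diff_le) auto
  moreover have "coeff h n = 0"
    using f g by (simp add: h_def)
  ultimately have k: "k < n"
    using h0 unfolding k_def by (metis leading_coeff_0_iff order_le_less)
  have "T h = smult (lam n) ([:- a, 1:] * h)"
    by (simp add: h_def diff_op_diff f g smult_diff_right right_diff_distrib)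
  then have "lam k * coeff h k = lam n * coeff h k"
    using coeff_T[of h k] by (auto simp: k_def mult_pCons_left coeff_eq_0)
  moreover have "coeff h k \<noteq> 0"
    using h0 by (simp add: k_def)
  ultimately show False
    using lam_strict_mono[OF N k n] by simp
qed

end

section \<open>Interlacing of the spectral polynomials\<close>

lemma zeros_eq_cev: "zeros p = {z. cev p z = 0}"
  by (simp add: zeros_def cev_def)

lemma zeros_root_prod: "zeros (root_prod xs) = of_real ` set xs"
proof -
  have "cev (root_prod xs) z = 0 \<longleftrightarrow> z \<in> of_real ` set xs" for z
    by (induction xs) (auto simp: one_pCons)
  then show ?thesis
    by (auto simp: zeros_eq_cev)
qed

lemma zeros_smult: "c \<noteq> 0 \<Longrightarrow> zeros (smult c p) = zeros p"
  by (simp add: zeros_eq_cev)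

lemma root_prod_dvd:
  assumes "distinct xs" "\<And>x. x \<in> set xs \<Longrightarrow> poly p x = 0"
  shows "root_prod xs dvd p"
  using assms
proof (induction xs arbitrary: p)
  case (Cons x xs)
  then obtain r where r: "p = [:- x, 1:] * r"
    by (metis dvdE list.set_intros(1) poly_eq_0_iff_dvd)
  have "poly r y = 0" if "y \<in> set xs" for y
    using Cons.prems that unfolding r by (metis add.commute distinct.simps(2) eq_iff_diff_eq_0 list.set_intros(2)
        mult.right_neutral mult_eq_0_iff poly_0 poly_mult poly_pCons diff_conv_add_uminus mult_zero_right add_0_right)
  then have "root_prod xs dvd r"
    using Cons by auto
  then show ?case
    unfolding r root_prod_Cons by (rule mult_dvd_mono[OF dvd_refl])
qed simp

lemma monic_eq_root_prod:
  assumes "distinct xs" "\<And>x. x \<in> set xs \<Longrightarrow> poly p x = 0"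
    and "lead_coeff p = 1" "degree p = length xs"
  shows "p = root_prod xs"
proof -
  obtain r where r: "p = root_prod xs * r"
    using root_prod_dvd[OF assms(1,2)] by (auto simp: dvd_def)
  have r0: "r \<noteq> 0"
    using assms(3) unfolding r by auto
  have "degree r = 0"
    using assms(4) r0 unfolding r by (simp add: degree_mult_eq)
  moreover have "lead_coeff r = 1"
    using assms(3) unfolding r lead_coeff_mult by simp
  ultimately have "r = 1"
    by (metis degree_eq_zeroE lead_coeff_pCons(2) one_pCons)
  then show ?thesis
    using r by simp
qed

context preserver
begin

lemma regular_Suc: "regular n \<Longrightarrow> regular (Suc n)"
  unfolding regular_def by (meson le_SucI order_refl regular_at_mono)

text \<open>Adding a large zero moves the entries of \<open>Z\<close> down at the same index, so the
  enlarged list is a supersolution and a fixed point lies below it.\<close>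

lemma fixed_down:
  assumes reg: "regular n" and x: "length xs = n" "fixed j xs" "j \<le> n"
  shows "\<exists>ys. length ys = Suc n \<and> fixed j ys \<and> Z ys ! j < Z xs ! j"
proof -
  have M: "M \<le> n"
    using reg by (rule regular_imp_M_le)
  \<comment> \<open>The inserted 0 keeps \<open>Max\<close> meaningful for the empty list, the case
    \<open>n = 0\<close>.\<close>
  obtain R where R: "R \<ge> Max (insert 0 ((\<lambda>x. \<bar>x\<bar>) ` set xs))" "confines (Suc n) R"
    using ex_confines[of "Suc n"] M by (meson le_SucI)
  then have bnd: "\<bar>x\<bar> \<le> R" if "x \<in> set xs" for x
    using that by simp
  define g where "g = xs @ [R]"
  have glen: "length g = Suc n"
    by (simp add: g_def x)
  have Zg: "Z g = Z (R # xs)"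
    by (rule Z_cong) (simp add: g_def)
  have Zglen: "length (Z g) = Suc (Suc n)"
    using glen M by simp
  have gR: "g \<preceq> replicate (Suc n) R"
    using x(1) abs_le_D1[OF bnd[OF nth_mem]] by (auto simp: list_le_iff g_def nth_append simp del: replicate_Suc)
  have lo: "replicate (Suc n) (- R) \<preceq> g"
  proof -
    have "- R \<le> xs ! i" if "i < length xs" for i
      using bnd[OF nth_mem[OF that]] by (simp add: abs_le_iff)
    moreover have "R \<ge> 0"
      using R(2) by (simp add: confines_def)
    ultimately show ?thesis
      using x(1) by (auto simp: list_le_iff g_def nth_append simp del: replicate_Suc)
  qed
  have "drop_nth j (Z g) \<preceq> g"
    unfolding list_le_iff
  proof (intro conjI allI impI)
    show "length (drop_nth j (Z g)) = length g"
      using x(3) Zglen glen by simp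
    fix i assume "i < length (drop_nth j (Z g))"
    then have i: "i < Suc n"
      using x(3) Zglen by simp
    have d: "drop_nth j (Z g) ! i = (if i < j then Z g ! i else Z g ! Suc i)"
      using i x(3) Zglen by (intro nth_drop_nth) auto
    show "drop_nth j (Z g) ! i \<le> g ! i"
    proof (cases "i = n")
      case True
      have "drop_nth j (Z g) ! i \<in> set (Z g)"
        using d Zglen i by simp
      then show ?thesis
        using confines_Z_le[OF R(2) _ gR] M True x(1) by (simp add: g_def nth_append)
    next
      case False
      then have i': "i < n"
        using i by simp
      have "xs ! i = (if i < j then Z xs ! i else Z xs ! Suc i)"
        using fixed_nth[OF x(2), of i] M x i' by simp
      moreover have "g ! i = xs ! i"
        using i' x(1) by (simp add: g_def nth_append)
      ultimately show ?thesis
        using d i' Z_interlace(1)[of xs i R] Z_interlace(1)[of xs "Suc i" R] M x(1)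
        by (simp add: Zg)
    qed
  qed
  then obtain ys where ys: "fixed j ys" "replicate (Suc n) (- R) \<preceq> ys" "ys \<preceq> g"
    using ex_fixed_between[of "replicate (Suc n) (- R)" j g] confines_lower[OF R(2), of j] lo M x(3)
    by auto
  have len: "length ys = Suc n"
    using ys(3) glen by (simp add: list_le_iff)
  have "Z ys \<preceq> Z g"
    using ys(3) len M by (intro Z_mono) auto
  then have "Z ys ! j \<le> Z g ! j"
    using Zglen x(3) by (auto simp: list_le_iff)
  moreover have "Z g ! j \<le> Z xs ! j"
    unfolding Zg using Z_interlace(1)[of xs j R] M x by simp
  \<comment> \<open>Equality would give \<open>T f\<close> and \<open>T ((z - R) f)\<close> a common
    zero that is not a zero of \<open>f\<close>, against \<open>T_factor_zero\<close>.\<close>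
  moreover have "Z g ! j \<noteq> Z xs ! j"
  proof -
    have "poly (T ([:- R, 1:] * root_prod xs)) (Z xs ! j) \<noteq> 0"
    proof (rule T_factor_zero)
      show "poly (root_prod xs) (Z xs ! j) \<noteq> 0"
        using fixed_notin[OF x(2)] reg x by (simp add: poly_root_prod_0_iff)
      have "Z xs ! j \<in> set (Z xs)"
        using x M by simp
      then show "poly (T (root_prod xs)) (Z xs ! j) = 0"
        using set_Z[of xs] M x by simp
      show "regular_at (degree (root_prod xs)) (Z xs ! j)"
        using reg x by (simp add: regular_def)
    qed simp
    moreover have "Z g ! j \<in> set (Z (R # xs))"
      using Zglen x(3) Zg by (metis le_imp_less_Suc less_SucI nth_mem)
    then have "poly (T (root_prod (R # xs))) (Z g ! j) = 0"
      using set_Z[of "R # xs"] M x(1) by simp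
    ultimately show ?thesis
      by auto
  qed
  ultimately show ?thesis
    using len ys(1) by force
qed

lemma fixed_up:
  assumes reg: "regular n" and x: "length xs = n" "fixed j xs" "j \<le> n"
  shows "\<exists>ys. length ys = Suc n \<and> fixed (Suc j) ys \<and> Z xs ! j < Z ys ! Suc j"
proof -
  have M: "M \<le> n"
    using reg by (rule regular_imp_M_le)
  obtain R where R: "R \<ge> Max (insert 0 ((\<lambda>x. \<bar>x\<bar>) ` set xs))" "confines (Suc n) R"
    using ex_confines[of "Suc n"] M by (meson le_SucI)
  then have bnd: "\<bar>x\<bar> \<le> R" if "x \<in> set xs" for x
    using that by simp
  have R0: "R \<ge> 0"
    using R(2) by (simp add: confines_def)
  \<comment> \<open>A zero prepended at the far left shifts all positions by one, so index
    \<open>j\<close> becomes \<open>Suc j\<close>.\<close>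
  define g where "g = - R # xs"
  have glen: "length g = Suc n"
    by (simp add: g_def x)
  have Zglen: "length (Z g) = Suc (Suc n)"
    using glen M by simp
  have ge: "- R \<le> xs ! i" and le: "xs ! i \<le> R" if "i < length xs" for i
    using bnd[OF nth_mem[OF that]] by (simp_all add: abs_le_iff)
  have lo: "replicate (Suc n) (- R) \<preceq> g"
    using ge R0 x(1) by (auto simp: list_le_iff g_def nth_Cons simp del: replicate_Suc split: nat.split)
  have hi: "g \<preceq> replicate (Suc n) R"
    using le R0 x(1) by (auto simp: list_le_iff g_def nth_Cons simp del: replicate_Suc split: nat.split)
  have "g \<preceq> drop_nth (Suc j) (Z g)"
    unfolding list_le_iff
  proof (intro conjI allI impI)
    show "length g = length (drop_nth (Suc j) (Z g))"
      using x(3) Zglen glen by simp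
    fix i assume "i < length g"
    then have i: "i < Suc n"
      using glen by simp
    have d: "drop_nth (Suc j) (Z g) ! i = (if i < Suc j then Z g ! i else Z g ! Suc i)"
      using i x(3) Zglen by (intro nth_drop_nth) auto
    show "g ! i \<le> drop_nth (Suc j) (Z g) ! i"
    proof (cases i)
      case 0
      have "drop_nth (Suc j) (Z g) ! i \<in> set (Z g)"
        using d Zglen i by simp
      then show ?thesis
        using confines_Z_ge[OF R(2) _ lo] M 0 by (simp add: g_def)
    next
      case (Suc i')
      then have i': "i' < n"
        using i by simp
      have "xs ! i' = (if i' < j then Z xs ! i' else Z xs ! Suc i')"
        using fixed_nth[OF x(2), of i'] M x i' by simp
      then show ?thesis
        using d Suc i' Z_interlace(2)[of xs i' "- R"] Z_interlace(2)[of xs "Suc i'" "- R"] M x(1)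
        by (simp add: g_def)
    qed
  qed
  then obtain ys where ys: "fixed (Suc j) ys" "g \<preceq> ys" "ys \<preceq> replicate (Suc n) R"
    using ex_fixed_between[of g "Suc j" "replicate (Suc n) R"] confines_upper[OF R(2), of "Suc j"] hi M x(3) glen
    by auto
  have len: "length ys = Suc n"
    using ys(2) glen by (simp add: list_le_iff)
  have "Z g \<preceq> Z ys"
    using ys(2) glen M by (intro Z_mono) auto
  then have "Z g ! Suc j \<le> Z ys ! Suc j"
    using Zglen x(3) by (auto simp: list_le_iff)
  moreover have "Z xs ! j \<le> Z g ! Suc j"
    unfolding g_def using Z_interlace(2)[of xs j "- R"] M x by simp
  moreover have "Z g ! Suc j \<noteq> Z xs ! j"
  proof -
    have "poly (T ([:- (- R), 1:] * root_prod xs)) (Z xs ! j) \<noteq> 0"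
    proof (rule T_factor_zero)
      show "poly (root_prod xs) (Z xs ! j) \<noteq> 0"
        using fixed_notin[OF x(2)] reg x by (simp add: poly_root_prod_0_iff)
      have "Z xs ! j \<in> set (Z xs)"
        using x M by simp
      then show "poly (T (root_prod xs)) (Z xs ! j) = 0"
        using set_Z[of xs] M x by simp
      show "regular_at (degree (root_prod xs)) (Z xs ! j)"
        using reg x by (simp add: regular_def)
    qed simp
    moreover have "Z g ! Suc j \<in> set (Z g)"
      using Zglen x(3) by simp
    then have "poly (T (root_prod g)) (Z g ! Suc j) = 0"
      using set_Z[of g] M glen by simp
    ultimately show ?thesis
      by (auto simp: g_def)
  qed
  ultimately show ?thesis
    using len ys(1) by force
qed

text \<open>For \<open>a < b\<close> with equal eigenvalue, deletion at \<open>b\<close> keeps entry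
  \<open>a\<close>, so the eigenvalue would be a zero of its own eigenvector.\<close>

lemma eigenvalue_fixed_index_unique:
  assumes reg: "regular n" and len: "length xs = n"
    and ij: "fixed i xs" "fixed j xs" "i \<le> n" "j \<le> n"
  shows "i = j"
proof -
  have M: "M \<le> n"
    using reg by (rule regular_imp_M_le)
  have "Z xs ! i = Z xs ! j"
  proof -
    have "smult (lam n) ([:- (Z xs ! i), 1:] * root_prod xs) = smult (lam n) ([:- (Z xs ! j), 1:] * root_prod xs)"
      using fixed_eigen[OF ij(1)] fixed_eigen[OF ij(2)] ij M len by simp
    then have "[:- (Z xs ! i), 1:] * root_prod xs = [:- (Z xs ! j), 1:] * root_prod xs"
      using lam_pos[OF M] smult_cancel by (metis less_irrefl)
    then show ?thesis
      by simp
  qed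
  have contra: False if "a < b" "fixed a xs" "fixed b xs" "b \<le> n" "Z xs ! a = Z xs ! b" for a b
  proof -
    have "xs ! a = Z xs ! a"
      using fixed_nth[OF that(3), of a] that len M by simp
    then have "Z xs ! b \<in> set xs"
      using that len by (metis nth_mem order_less_le_trans)
    then show False
      using fixed_notin[OF that(3)] reg len that by simp
  qed
  show ?thesis
    using contra[of i j] contra[of j i] ij \<open>Z xs ! i = Z xs ! j\<close> by (metis linorder_neqE_nat)
qed

text \<open>The last clause is the one that permits comparison of degrees: whichever fixed point of
  index \<open>j\<close> an existence argument returns, its deleted zero is the \<open>j\<close>-th
  Van Vleck zero.\<close>

lemma spectral_poly_eq:
  assumes reg: "regular n"
  obtains ts where "length ts = Suc n" "sorted_wrt (<) ts" "spectral_poly T n = root_prod ts"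
    "\<And>j. j \<le> n \<Longrightarrow> \<exists>xs. length xs = n \<and> fixed j xs \<and> Z xs ! j = ts ! j"
    "\<And>j xs. j \<le> n \<Longrightarrow> length xs = n \<Longrightarrow> fixed j xs \<Longrightarrow> Z xs ! j = ts ! j"
proof -
  have M: "M \<le> n" and N: "1 \<le> N"
    using reg regular_imp_M_le regular_imp_N_pos by blast+
  have l: "lam n > 0"
    using M by (rule lam_pos)
  obtain X where X: "\<And>j. j \<le> n \<Longrightarrow> length (X j) = n" "\<And>j. j \<le> n \<Longrightarrow> fixed j (X j)"
    "\<And>j. j < n \<Longrightarrow> Z (X j) ! j < Z (X (Suc j)) ! Suc j"
    using ex_fixed_chain[OF reg] by blast
  define ts where "ts = map (\<lambda>j. Z (X j) ! j) [0..<Suc n]"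
  have len: "length ts = Suc n"
    by (simp add: ts_def)
  have nth: "ts ! j = Z (X j) ! j" if "j \<le> n" for j
    using that by (simp add: ts_def del: upt_Suc)
  have "transp ((<) :: real \<Rightarrow> real \<Rightarrow> bool)"
    by (auto intro: transpI)
  then have strict: "sorted_wrt (<) ts"
    using X(3) by (auto simp: sorted_wrt_iff_nth_Suc_transp len nth)
  have dist: "distinct ts"
    using strict strict_sorted_iff by blast
  have eigen: "T (root_prod (X j)) = smult (lam n) ([:- (ts ! j), 1:] * root_prod (X j))" if "j \<le> n" for j
    using fixed_eigen[OF X(2)] X(1) that M nth by simp
  have in_ts: "a \<in> set ts \<longleftrightarrow> (\<exists>j\<le>n. a = ts ! j)" for a
    using len by (auto simp: in_set_conv_nth less_Suc_eq_le)
  have ex_f: "\<exists>f. degree f = n \<and> lead_coeff f = 1 \<and> T f = smult (lam n) ([:- a, 1:] * f)" if a: "a \<in> set ts" for a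
  proof -
    obtain j where j: "j \<le> n" "a = ts ! j"
      using a in_ts[of a] by blast
    then show ?thesis
      using eigen[of j] X(1)[of j] lead_coeff_root_prod[of "X j"] by (intro exI[of _ "root_prod (X j)"]) simp
  qed
  \<comment> \<open>Another eigenvalue would give \<open>n + 2\<close> independent polynomials of
    degree at most \<open>n\<close>.\<close>
  have all: "a \<in> set ts"
    if f: "degree f = n" "lead_coeff f = 1" "T f = smult (lam n) ([:- a, 1:] * f)" for a f
  proof (rule ccontr)
    assume a: "a \<notin> set ts"
    have "\<forall>b\<in>insert a (set ts). \<exists>f. f \<noteq> 0 \<and> degree f \<le> n \<and> T f = smult (lam n) ([:- b, 1:] * f)"
    proof
      fix b assume "b \<in> insert a (set ts)"
      then obtain h where "degree h = n" "lead_coeff h = 1" "T h = smult (lam n) ([:- b, 1:] * h)"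
        using ex_f f by blast
      then show "\<exists>f. f \<noteq> 0 \<and> degree f \<le> n \<and> T f = smult (lam n) ([:- b, 1:] * f)"
        by (intro exI[of _ h]) auto
    qed
    then obtain F where "\<forall>b\<in>insert a (set ts). F b \<noteq> 0 \<and> degree (F b) \<le> n \<and> T (F b) = smult (lam n) ([:- b, 1:] * F b)"
      by metis
    then have "card (insert a (set ts)) \<le> n + 1"
      using l by (intro card_eigenvalues_le[of _ "lam n" F]) auto
    then show False
      using a dist len by (simp add: distinct_card)
  qed
  have vv: "van_vleck T n = (\<lambda>t. smult (lam n) [:- t, 1:]) ` set ts"
  proof (intro equalityI subsetI)
    fix v assume "v \<in> van_vleck T n"
    then obtain f where f: "lead_coeff f = 1" "degree f = n" "T f = v * f"
      unfolding van_vleck_def by blast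
    have f0: "f \<noteq> 0"
      using f(1) by auto
    have "T f \<noteq> 0" "degree (T f) = n + 1"
      using degree_T_eq[of f] T_neq_0[of f] l f f0 by auto
    then have "v \<noteq> 0" "degree v = 1"
      using f f0 by (auto simp: degree_mult_eq)
    moreover have "lead_coeff v = lam n"
    proof -
      have "lead_coeff (T f) = lam n"
        using coeff_T[of f n] f \<open>degree (T f) = n + 1\<close> by simp
      then show ?thesis
        using f by (simp add: lead_coeff_mult)
    qed
    ultimately have "v = [:coeff v 0, lam n:]"
      by (intro poly_eqI) (auto simp: coeff_pCons coeff_eq_0 split: nat.split)
    also have "\<dots> = smult (lam n) [:- (- coeff v 0 / lam n), 1:]"
      using l by simp
    finally have v: "v = smult (lam n) [:- (- coeff v 0 / lam n), 1:]" .
    then have "T f = smult (lam n) ([:- (- coeff v 0 / lam n), 1:] * f)"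
      using f(3) by (metis mult_smult_left)
    then have "- coeff v 0 / lam n \<in> set ts"
      using all f by blast
    then show "v \<in> (\<lambda>t. smult (lam n) [:- t, 1:]) ` set ts"
      using v by blast
  next
    fix v assume "v \<in> (\<lambda>t. smult (lam n) [:- t, 1:]) ` set ts"
    then obtain t where t: "t \<in> set ts" "v = smult (lam n) [:- t, 1:]"
      by blast
    obtain f where "degree f = n" "lead_coeff f = 1" "T f = smult (lam n) ([:- t, 1:] * f)"
      using ex_f[OF t(1)] by blast
    then have "lead_coeff f = 1 \<and> degree f = n \<and> T f = v * f"
      using t(2) by (simp only: mult_smult_left simp_thms)
    then show "v \<in> van_vleck T n"
      unfolding van_vleck_def by blast
  qed
  have "zeros (smult (lam n) [:- t, 1:]) = {of_real t}" for t
    using zeros_root_prod[of "[t]"] zeros_smult[of "lam n" "[:- t, 1:]"] l by simp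
  then have zz: "(\<Union>v\<in>van_vleck T n. zeros v) = of_real ` set ts"
    unfolding vv by auto
  have sp: "spectral_poly T n = root_prod ts"
    unfolding spectral_poly_def zz
  proof (rule the_equality)
    show "lead_coeff (root_prod ts) = 1 \<and> degree (root_prod ts) = n + 1 \<and> zeros (root_prod ts) = complex_of_real ` set ts"
      using lead_coeff_root_prod[of ts] by (simp add: zeros_root_prod len)
    fix p assume p: "lead_coeff p = 1 \<and> degree p = n + 1 \<and> zeros p = complex_of_real ` set ts"
    have "poly p t = 0" if "t \<in> set ts" for t
    proof -
      have "of_real t \<in> zeros p"
        using p that by blast
      then show ?thesis
        by (simp add: zeros_eq_cev cev_of_real)
    qed
    then show "p = root_prod ts"
      using p dist len by (intro monic_eq_root_prod) auto
  qed
  have uniq: "Z xs ! j = ts ! j" if "j \<le> n" "length xs = n" "fixed j xs" for j xs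
  proof -
    have e: "T (root_prod xs) = smult (lam n) ([:- (Z xs ! j), 1:] * root_prod xs)"
      using fixed_eigen[OF that(3)] that M by simp
    then have "Z xs ! j \<in> set ts"
      using all[of "root_prod xs"] that(2) lead_coeff_root_prod[of xs] by simp
    then obtain i where i: "i \<le> n" "Z xs ! j = ts ! i"
      using in_ts by blast
    have "root_prod xs = root_prod (X i)"
      using eigenvector_unique[OF N M, of "root_prod xs" "ts ! i" "root_prod (X i)"] e eigen[OF i(1)] i
        X(1)[OF i(1)] that(2) lead_coeff_root_prod[of xs] lead_coeff_root_prod[of "X i"] by simp
    then have "mset xs = mset (X i)"
      by (metis proots_root_prod)
    then have "xs = X i"
      using fixed_sorted[OF that(3)] fixed_sorted[OF X(2)[OF i(1)]] by (metis properties_for_sort sorted_sort_id)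
    then have "i = j"
      using eigenvalue_fixed_index_unique[OF reg that(2)] X(2)[OF i(1)] that i(1) by blast
    then show ?thesis
      using i by simp
  qed
  show thesis
  proof (rule that[OF len strict sp])
    show "\<exists>xs. length xs = n \<and> fixed j xs \<and> Z xs ! j = ts ! j" if "j \<le> n" for j
      using X(1,2) nth that by metis
  qed (use uniq in blast)
qed

lemma spectral_interlace:
  assumes reg: "regular n"
  shows "interlace (spectral_poly T n) (spectral_poly T (n + 1))
    \<and> zeros (spectral_poly T n) \<inter> zeros (spectral_poly T (n + 1)) = {}"
proof -
  obtain ts where ts: "length ts = Suc n" "sorted_wrt (<) ts" "spectral_poly T n = root_prod ts"
    "\<And>j. j \<le> n \<Longrightarrow> \<exists>xs. length xs = n \<and> fixed j xs \<and> Z xs ! j = ts ! j"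
    "\<And>j xs. j \<le> n \<Longrightarrow> length xs = n \<Longrightarrow> fixed j xs \<Longrightarrow> Z xs ! j = ts ! j"
    by (rule spectral_poly_eq[OF reg]) (rule that; assumption)
  obtain us where us: "length us = Suc (Suc n)" "sorted_wrt (<) us" "spectral_poly T (Suc n) = root_prod us"
    "\<And>j. j \<le> Suc n \<Longrightarrow> \<exists>xs. length xs = Suc n \<and> fixed j xs \<and> Z xs ! j = us ! j"
    "\<And>j xs. j \<le> Suc n \<Longrightarrow> length xs = Suc n \<Longrightarrow> fixed j xs \<Longrightarrow> Z xs ! j = us ! j"
    by (rule spectral_poly_eq[OF regular_Suc[OF reg]]) (rule that; assumption)
  have between: "us ! j < ts ! j" "ts ! j < us ! Suc j" if j: "j \<le> n" for j
  proof -
    obtain xs where xs: "length xs = n" "fixed j xs" "Z xs ! j = ts ! j"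
      using ts(4)[OF j] by blast
    show "us ! j < ts ! j"
      using fixed_down[OF reg xs(1,2) j] us(5)[of j] xs(3) j by force
    show "ts ! j < us ! Suc j"
      using fixed_up[OF reg xs(1,2) j] us(5)[of "Suc j"] xs(3) j by force
  qed
  have sorted: "sorted ts" "sorted us"
    using ts(2) us(2) strict_sorted_imp_sorted by blast+
  have "sorted (splice us ts)"
    using between ts(1) us(1) by (intro sorted_splice_interlacing) (auto simp: less_Suc_eq_le less_imp_le)
  then have "alternating (zero_list (root_prod us)) (zero_list (root_prod ts))"
    using sorted ts(1) us(1) by (simp add: alternating_def sorted_sort_id)
  then have "interlace (root_prod ts) (root_prod us)"
    by (simp add: interlace_def)
  moreover have "set ts \<inter> set us = {}"
  proof -
    have "ts ! j \<noteq> us ! i" if "j \<le> n" "i \<le> Suc n" for i j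
    proof (cases "i \<le> j")
      case True
      then have "us ! i \<le> us ! j"
        using sorted(2) us(1) that by (intro sorted_nth_mono) auto
      then show ?thesis
        using between(1)[OF that(1)] by simp
    next
      case False
      then have "us ! Suc j \<le> us ! i"
        using sorted(2) us(1) that by (intro sorted_nth_mono) auto
      then show ?thesis
        using between(2)[OF that(1)] by simp
    qed
    then show ?thesis
      using ts(1) us(1) unfolding disjoint_iff in_set_conv_nth by (metis less_Suc_eq_le)
  qed
  then have "zeros (root_prod ts) \<inter> zeros (root_prod us) = {}"
    by (auto simp: zeros_root_prod)
  ultimately show ?thesis
    using ts(3) us(3) by simp
qed

end

section \<open>Reduction to a positive leading coefficient\<close>

lemma spectral_poly_smult:
  assumes "\<sigma> \<noteq> 0"
  shows "spectral_poly (\<lambda>f. smult \<sigma> (T f)) n = spectral_poly T n"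
proof -
  have "van_vleck (\<lambda>f. smult \<sigma> (T f)) n = smult \<sigma> ` van_vleck T n"
  proof (intro equalityI subsetI)
    fix v assume "v \<in> van_vleck (\<lambda>f. smult \<sigma> (T f)) n"
    then obtain f where f: "lead_coeff f = 1" "degree f = n" "smult \<sigma> (T f) = v * f"
      unfolding van_vleck_def by blast
    have "T f = smult (inverse \<sigma>) v * f"
      using arg_cong[OF f(3), of "smult (inverse \<sigma>)"] assms by simp
    then have "smult (inverse \<sigma>) v \<in> van_vleck T n"
      using f unfolding van_vleck_def by blast
    moreover have "v = smult \<sigma> (smult (inverse \<sigma>) v)"
      using assms by simp
    ultimately show "v \<in> smult \<sigma> ` van_vleck T n"
      by blast
  next
    fix v assume "v \<in> smult \<sigma> ` van_vleck T n"
    then show "v \<in> van_vleck (\<lambda>f. smult \<sigma> (T f)) n"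
      unfolding van_vleck_def by fastforce
  qed
  then have "(\<Union>v\<in>van_vleck (\<lambda>f. smult \<sigma> (T f)) n. zeros v) = (\<Union>v\<in>van_vleck T n. zeros v)"
    using assms by (simp add: zeros_smult)
  then show ?thesis
    by (simp add: spectral_poly_def)
qed

theorem corollary4p8:
  fixes M N n :: nat
    and Q :: "nat \<Rightarrow> real poly"
    and T :: "real poly \<Rightarrow> real poly"
  assumes "T = diff_op M N Q"
    and "M \<le> N"
    and "Q M \<noteq> 0" and "Q N \<noteq> 0"
    and "\<forall>k>N. Q k = 0"
    and "hyperbolicity_preserver T"
    and "nondegenerate M N Q"
    and "fuchs_index M N Q = 1"
    and "M \<le> n"
    and "\<not> (\<exists>\<theta>::real. \<forall>k\<in>{M..n}. poly (Q k) \<theta> = 0)"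
  shows "interlace (spectral_poly T n) (spectral_poly T (n + 1))
    \<and> zeros (spectral_poly T n) \<inter> zeros (spectral_poly T (n + 1)) = {}"
proof -
  have degN: "degree (Q N) = N + 1"
    using assms(7,8) by (simp add: nondegenerate_def)
  have deg: "degree (Q k) \<le> k + 1" if k: "k \<in> {M..N}" for k
  proof (cases "Q k = 0")
    case False
    then have "int (degree (Q k)) - int k \<le> fuchs_index M N Q"
      unfolding fuchs_index_def using k by (intro Max_ge) auto
    then show ?thesis
      using assms(8) by simp
  qed simp
  \<comment> \<open>This sign makes the top coefficient of \<open>Q' N\<close> positive. Van Vleck
    polynomials are only rescaled, so their zeros and the spectral polynomials stay the
    same.\<close>
  define \<sigma> where "\<sigma> = sgn (lead_coeff (Q N))"
  have \<sigma>: "\<sigma> \<noteq> 0"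
    using assms(4) by (simp add: \<sigma>_def sgn_zero_iff)
  define Q' where "Q' = (\<lambda>k. smult \<sigma> (Q k))"
  have T': "diff_op M N Q' = (\<lambda>f. smult \<sigma> (T f))"
    by (simp add: fun_eq_iff Q'_def assms(1) diff_op_def smult_sum_right)
  interpret preserver M N Q'
  proof
    show "coeff (Q' N) (N + 1) > 0"
    proof -
      have "coeff (Q N) (N + 1) \<noteq> 0"
        using assms(4) degN by (metis leading_coeff_0_iff)
      then show ?thesis
        using degN by (auto simp: Q'_def \<sigma>_def sgn_if)
    qed
    show "hyperbolicity_preserver (diff_op M N Q')"
      using assms(6) \<sigma> unfolding T' hyperbolicity_preserver_def by auto
  qed (use assms(2,3) deg \<sigma> in \<open>auto simp: Q'_def\<close>)
  have "regular n"
    unfolding regular_def regular_at_def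
  proof
    fix x
    obtain k where k: "k \<in> {M..n}" "poly (Q k) x \<noteq> 0"
      using assms(10) by blast
    \<comment> \<open>For \<open>n > N\<close> the range \<open>M..n\<close> reaches past the
      operator, where all \<open>Q k\<close> are 0.\<close>
    then have "k \<le> N"
      using assms(5) by (metis not_le poly_0)
    then show "\<exists>k\<in>{M..N}. k \<le> n \<and> poly (Q' k) x \<noteq> 0"
      using k \<sigma> by (intro bexI[of _ k]) (auto simp: Q'_def)
  qed
  then show ?thesis
    using spectral_interlace[of n] \<sigma> unfolding T' by (simp add: spectral_poly_smult)
qed

end
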